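(* Let $n,l,r$ be non-negative integers with $l+r\le n$, let $b_1<\dots<b_n$ be a strictly increasing sequence of integers, let $\mathbf{s}=(s_1,\dots,s_l)$ be a weakly decreasing and $\mathbf{t}=(t_{n-r+1},\dots,t_n)$ a weakly increasing sequence of non-negative integers (with the non-interference assumption below). Then the evaluation at $(x_1,\dots,x_n)=(b_1,\dots,b_n)$ of the polynomial $$(-\overline{\Delta}[v]_{x_1})^{s_1}\cdots(-\overline{\Delta}[v]_{x_l})^{s_l}\,\underline{\Delta}[u]_{x_{n-r+1}}^{t_{n-r+1}}\cdots\underline{\Delta}[u]_{x_n}^{t_n}\,M_n(u,v,\mathbf{x})\qquad( * )$$ equals $\sum_T u^{\operatorname{inv}(T)}v^{\operatorname{inv}'(T)}$, where $T$ ranges over all $(\mathbf{s},\mathbf{t})$-trees of order $n$ such that for $1\le i\le n-r$ the bottom entry of the $i$-th NE-diagonal is $b_i$, and for $n-r+1\le i\le n$ the bottom entry of the $i$-th SE-diagonal is $b_i$. Furthermore, for $I\subseteq\{1\}\cup\{i: s_{i-1}>s_i\}$ and $J\subseteq\{j:t_j<t_{j+1}\}\cup\{n\}$, the sum $\sum_T u^{\operatorname{inv}_J(T)}v^{\operatorname{inv}'_I(T)}$ over the same trees is obtained by applying $\prod_{i\in I}(1+(1-v)\overline{\Delta}_{x_i})^{-1}\prod_{j\in J}(1+(u-1)\underline{\Delta}_{x_j})^{-1}$ to $( * )$ and then evaluating at $(x_1,\dots,x_n)=(b_1,\dots,b_n)$. Finally, if $\alpha\le a\le\beta$ are integers with $\alpha\le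 b_1$ and $b_n\le\beta$, then the corresponding generating functions of those trees whose top entry $m_{1,1}$ equals $a$ are obtained by replacing $M_n(u,v,\mathbf{x})$ by $M_{n,a,\alpha,\beta}(u,v,\mathbf{x})$. In the special case $u=v=1$, all these statements hold if $b_1\le\dots\le b_n$ is only weakly increasing.
   Context: Index a triangular array with $n$ rows as $(m_{i,j})_{1\le j\le i\le n}$ (row $i$ from top has entries $m_{i,1},\dots,m_{i,i}$). The $j$-th NE-diagonal (counted from the left) is $\{m_{i,j}: j\le i\le n\}$; the $k$-th SE-diagonal (counted from the left) is $\{m_{i,i-n+k}: n-k+1\le i\le n\}$. An $(\mathbf{s},\mathbf{t})$-tree of order $n$ is an integer array whose shape is obtained from the triangular shape with $n$ rows by deleting the bottom $s_i$ entries of the $i$-th NE-diagonal for $1\le i\le l$ and the bottom $t_i$ entries of the $i$-th SE-diagonal for $n-r+1\le i\le n$; it is assumed that the deletions in the $l$ leftmost NE-diagonals do not interfere with the deletions in the $r$ rightmost SE-diagonals. An entry $m_{i,j}$ is regular if both $m_{i+1,j}$ and $m_{i+1,j+1}$ belong to the array. Required: every regular entry satisfies $m_{i+1,j}\le m_{i,j}\le m_{i+1,j+1}$, and two adjacent regular entries $m_{i,j},m_{i,j+1}$ in the same row are distinct. Set $\operatorname{inv}(T)=\#\{m_{i,j}\text{ regular}: m_{i,j}=m_{i+1,j+1}\}$, $\operatorname{inv}'(T)=\#\{m_{i,j}\text{ regular}:m_{i,j}=m_{i+1,j}\}$; $\operatorname{inv}_J(T)$ counts regular $m_{i,j}$ with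 $m_{i,j}=m_{i+1,j+1}$ and $m_{i+1,j+1}$ not the bottom entry of a SE-diagonal whose index lies in $J$; $\operatorname{inv}'_I(T)$ counts regular $m_{i,j}$ with $m_{i,j}=m_{i+1,j}$ and $m_{i+1,j}$ not the bottom entry of a NE-diagonal whose index lies in $I$. Operators: $\operatorname{E}_xp(x)=p(x+1)$, $\overline{\Delta}_x=\operatorname{E}_x-\operatorname{Id}$, $\underline{\Delta}_x=\operatorname{Id}-\operatorname{E}_x^{-1}$, $\overline{\Delta}[v]_x=\sum_{i\ge0}(v-1)^i\overline{\Delta}_x^{i+1}$, $\underline{\Delta}[u]_x=\sum_{i\ge0}(1-u)^i\underline{\Delta}_x^{i+1}$ (finite sums on polynomials); $(1+(1-v)\overline{\Delta}_x)^{-1}=\sum_{i\ge0}(v-1)^i\overline{\Delta}_x^i$, $(1+(u-1)\underline{\Delta}_x)^{-1}=\sum_{i\ge0}(1-u)^i\underline{\Delta}_x^i$. $\operatorname{Strict}_{x,y}=u\operatorname{E}_y+v\operatorname{E}_x^{-1}+(1-u-v)\operatorname{E}_x^{-1}\operatorname{E}_y$. $\operatorname{GT}_n(\mathbf{x})=\prod_{1\le i<j\le n}\frac{x_j-x_i+j-i}{j-i}$, $M_n(u,v,\mathbf{x})=\prod_{1\le p<q\le n}\operatorname{Strict}_{x_q,x_p}\operatorname{GT}_n(\mathbf{x})$. For integers $\alpha\le a\le\beta$, $\operatorname{GT}_{n,a,\alpha,\beta}(\mathbf{x})=\sum_{b=0}^{\beta-\alpha}(-1)^{a+\alpha+b}\binom{b}{a-\alpha}\det_{1\le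 i,j\le n}\binom{x_i+i-\alpha-1}{j-1+b[j=n]}$ (where $[j=n]$ is $1$ if $j=n$ and $0$ otherwise) and $M_{n,a,\alpha,\beta}(u,v,\mathbf{x})=\prod_{1\le p<q\le n}\operatorname{Strict}_{x_q,x_p}\operatorname{GT}_{n,a,\alpha,\beta}(\mathbf{x})$. $u,v$ are indeterminates.
   Formalization: Non-interference also requires non-empty diagonals and distinct prescribed bottom entries; the (I,J)-version with prescribed top entry excludes, unless u=v=1, the case where the top entry is itself the bottom of a NE-diagonal in I or SE-diagonal in J, where the claim fails. *)

theory Defs
  imports "Jordan_Normal_Form.Determinant" "HOL-Library.Groups_Big_Fun"
begin

section \<open>(s,t)-trees\<close>

text \<open>The entry in row \<open>i\<close> (from the top) and position \<open>j\<close> of a triangular array is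
  indexed by the pair \<open>(i, j)\<close>.  The sequences \<open>s\<close> and \<open>t\<close> are total functions of which only the
  values on \<open>{1..l}\<close> and \<open>{n-r+1..n}\<close> matter.\<close>

definition triangle_cells :: "nat \<Rightarrow> (nat \<times> nat) set" where
  "triangle_cells n = {(i, j). 1 \<le> j \<and> j \<le> i \<and> i \<le> n}"

definition ne_diag :: "nat \<Rightarrow> nat \<Rightarrow> (nat \<times> nat) set" where
  "ne_diag n j = {(i, j) | i. j \<le> i \<and> i \<le> n}"

definition se_diag :: "nat \<Rightarrow> nat \<Rightarrow> (nat \<times> nat) set" where
  "se_diag n k = {(i, i + k - n) | i. n - k + 1 \<le> i \<and> i \<le> n}"

text \<open>The bottom \<open>m\<close> entries of a set of cells that reaches down to row \<open>n\<close>:\<close>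

definition bottom_cells :: "nat \<Rightarrow> nat \<Rightarrow> (nat \<times> nat) set \<Rightarrow> (nat \<times> nat) set" where
  "bottom_cells n m D = {c \<in> D. n < fst c + m}"

definition st_shape ::
    "nat \<Rightarrow> nat \<Rightarrow> nat \<Rightarrow> (nat \<Rightarrow> nat) \<Rightarrow> (nat \<Rightarrow> nat) \<Rightarrow> (nat \<times> nat) set" where
  "st_shape n l r s t =
     triangle_cells n - (\<Union>i\<in>{1..l}. bottom_cells n (s i) (ne_diag n i))
                - (\<Union>k\<in>{n-r+1..n}. bottom_cells n (t k) (se_diag n k))"

text \<open>The deletions do not interfere: none of them exhausts its diagonal (which has \<open>n - i + 1\<close>
  and \<open>k\<close> entries, respectively), and no entry that is deleted from a NE-diagonal, or becomes its
  bottom entry, is deleted from a SE-diagonal, or becomes its bottom entry.  Thus no entry is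
  deleted twice, and the \<open>n\<close> bottom entries prescribed by \<open>b\<close> are distinct entries of the shape.
  Mere disjointness of the deletions does not suffice for the case \<open>u = v = 1\<close> with \<open>b\<close> weakly
  increasing: for \<open>n = 2\<close>, \<open>l = r = 1\<close>, \<open>s\<^sub>1 = t\<^sub>2 = 1\<close>, \<open>b\<^sub>1 = b\<^sub>2\<close> there is one tree with a
  single entry, but the differences annihilate the polynomial.\<close>

definition noninterfering ::
    "nat \<Rightarrow> nat \<Rightarrow> nat \<Rightarrow> (nat \<Rightarrow> nat) \<Rightarrow> (nat \<Rightarrow> nat) \<Rightarrow> bool" where
  "noninterfering n l r s t \<longleftrightarrow>
     (\<forall>i\<in>{1..l}. s i < n - i + 1) \<and> (\<forall>k\<in>{n-r+1..n}. t k < k) \<and>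
     (\<forall>i\<in>{1..l}. \<forall>k\<in>{n-r+1..n}.
        bottom_cells n (s i + 1) (ne_diag n i) \<inter> bottom_cells n (t k + 1) (se_diag n k) = {})"

definition regular_cell :: "(nat \<times> nat) set \<Rightarrow> nat \<Rightarrow> nat \<Rightarrow> bool" where
  "regular_cell S i j \<longleftrightarrow> (i, j) \<in> S \<and> (i + 1, j) \<in> S \<and> (i + 1, j + 1) \<in> S"

definition is_bottom :: "(nat \<times> nat) set \<Rightarrow> (nat \<times> nat) set \<Rightarrow> nat \<times> nat \<Rightarrow> bool" where
  "is_bottom S D c \<longleftrightarrow> c \<in> S \<inter> D \<and> (\<forall>c'\<in>S \<inter> D. fst c' \<le> fst c)"

definition is_tree :: "(nat \<times> nat) set \<Rightarrow> (nat \<times> nat \<Rightarrow> int) \<Rightarrow> bool" where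
  "is_tree S T \<longleftrightarrow> T \<in> extensional S \<and>
     (\<forall>i j. regular_cell S i j \<longrightarrow> T (i + 1, j) \<le> T (i, j) \<and> T (i, j) \<le> T (i + 1, j + 1)) \<and>
     (\<forall>i j. regular_cell S i j \<and> regular_cell S i (j + 1) \<longrightarrow> T (i, j) \<noteq> T (i, j + 1))"

definition st_trees ::
    "nat \<Rightarrow> nat \<Rightarrow> nat \<Rightarrow> (nat \<Rightarrow> nat) \<Rightarrow> (nat \<Rightarrow> nat) \<Rightarrow> (nat \<Rightarrow> int) \<Rightarrow> (nat \<times> nat \<Rightarrow> int) set" where
  "st_trees n l r s t b = {T. is_tree (st_shape n l r s t) T \<and>
     (\<forall>i\<in>{1..n-r}. \<exists>c. is_bottom (st_shape n l r s t) (ne_diag n i) c \<and> T c = b i) \<and>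
     (\<forall>k\<in>{n-r+1..n}. \<exists>c. is_bottom (st_shape n l r s t) (se_diag n k) c \<and> T c = b k)}"

definition inv_u :: "(nat \<times> nat) set \<Rightarrow> (nat \<times> nat \<Rightarrow> int) \<Rightarrow> nat" where
  "inv_u S T = card {(i, j). regular_cell S i j \<and> T (i, j) = T (i + 1, j + 1)}"

definition inv_v :: "(nat \<times> nat) set \<Rightarrow> (nat \<times> nat \<Rightarrow> int) \<Rightarrow> nat" where
  "inv_v S T = card {(i, j). regular_cell S i j \<and> T (i, j) = T (i + 1, j)}"

definition inv_uJ :: "nat \<Rightarrow> (nat \<times> nat) set \<Rightarrow> nat set \<Rightarrow> (nat \<times> nat \<Rightarrow> int) \<Rightarrow> nat" where
  "inv_uJ n S J T = card {(i, j). regular_cell S i j \<and> T (i, j) = T (i + 1, j + 1) \<and>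
     \<not> (\<exists>k\<in>J. is_bottom S (se_diag n k) (i + 1, j + 1))}"

definition inv_vI :: "nat \<Rightarrow> (nat \<times> nat) set \<Rightarrow> nat set \<Rightarrow> (nat \<times> nat \<Rightarrow> int) \<Rightarrow> nat" where
  "inv_vI n S I T = card {(i, j). regular_cell S i j \<and> T (i, j) = T (i + 1, j) \<and>
     \<not> (\<exists>k\<in>I. is_bottom S (ne_diag n k) (i + 1, j))}"


section \<open>Operators on polynomial functions\<close>

text \<open>A polynomial in \<open>x\<^sub>1, \<dots>, x\<^sub>n\<close> over a field of characteristic 0 is represented by its polynomial
  function, which determines it because the field is infinite.  The indeterminates \<open>u\<close> and \<open>v\<close> are
  arbitrary elements of the field, e.g. the generators of a rational function field.\<close>

type_synonym 'a polyfun = "(nat \<Rightarrow> 'a) \<Rightarrow> 'a"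

definition shift_op :: "nat \<Rightarrow> 'a::field_char_0 polyfun \<Rightarrow> 'a polyfun" where
  "shift_op i f = (\<lambda>x. f (x(i := x i + 1)))"

definition shift_inv_op :: "nat \<Rightarrow> 'a::field_char_0 polyfun \<Rightarrow> 'a polyfun" where
  "shift_inv_op i f = (\<lambda>x. f (x(i := x i - 1)))"

definition fdiff_op :: "nat \<Rightarrow> 'a::field_char_0 polyfun \<Rightarrow> 'a polyfun" where
  "fdiff_op i f = (\<lambda>x. shift_op i f x - f x)"

definition bdiff_op :: "nat \<Rightarrow> 'a::field_char_0 polyfun \<Rightarrow> 'a polyfun" where
  "bdiff_op i f = (\<lambda>x. f x - shift_inv_op i f x)"

text \<open>\<open>Sum_any\<close> sums over all \<open>k\<close> with non-zero summand; for polynomial functions \<open>f\<close> these are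
  finitely many, as high differences vanish.\<close>

definition fdiff_v :: "'a::field_char_0 \<Rightarrow> nat \<Rightarrow> 'a polyfun \<Rightarrow> 'a polyfun" where
  "fdiff_v v i f = (\<lambda>x. Sum_any (\<lambda>k. (v - 1) ^ k * (fdiff_op i ^^ (k + 1)) f x))"

definition bdiff_u :: "'a::field_char_0 \<Rightarrow> nat \<Rightarrow> 'a polyfun \<Rightarrow> 'a polyfun" where
  "bdiff_u u i f = (\<lambda>x. Sum_any (\<lambda>k. (1 - u) ^ k * (bdiff_op i ^^ (k + 1)) f x))"

definition finv_v :: "'a::field_char_0 \<Rightarrow> nat \<Rightarrow> 'a polyfun \<Rightarrow> 'a polyfun" where
  "finv_v v i f = (\<lambda>x. Sum_any (\<lambda>k. (v - 1) ^ k * (fdiff_op i ^^ k) f x))"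

definition binv_u :: "'a::field_char_0 \<Rightarrow> nat \<Rightarrow> 'a polyfun \<Rightarrow> 'a polyfun" where
  "binv_u u i f = (\<lambda>x. Sum_any (\<lambda>k. (1 - u) ^ k * (bdiff_op i ^^ k) f x))"

text \<open>\<open>strict_op u v i j\<close> is the operator Strict with subscripts \<open>x\<^sub>i, x\<^sub>j\<close>.\<close>

definition strict_op :: "'a::field_char_0 \<Rightarrow> 'a \<Rightarrow> nat \<Rightarrow> nat \<Rightarrow> 'a polyfun \<Rightarrow> 'a polyfun" where
  "strict_op u v i j f =
     (\<lambda>x. u * shift_op j f x + v * shift_inv_op i f x + (1 - u - v) * shift_inv_op i (shift_op j f) x)"

text \<open>Composition of operators along a list; on polynomials the operators used below commute, so
  the order is immaterial.\<close>

definition op_prod :: "('i \<Rightarrow> 'a polyfun \<Rightarrow> 'a polyfun) \<Rightarrow> 'i list \<Rightarrow> 'a polyfun \<Rightarrow> 'a polyfun" where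
  "op_prod F is = foldr (\<lambda>i G. F i \<circ> G) is id"

definition strict_all :: "'a::field_char_0 \<Rightarrow> 'a \<Rightarrow> nat \<Rightarrow> 'a polyfun \<Rightarrow> 'a polyfun" where
  "strict_all u v n = op_prod (\<lambda>p. op_prod (\<lambda>q. strict_op u v q p) [p+1..<n+1]) [1..<n+1]"

definition truncation_op :: "'a::field_char_0 \<Rightarrow> 'a \<Rightarrow> nat \<Rightarrow> nat \<Rightarrow> nat \<Rightarrow>
    (nat \<Rightarrow> nat) \<Rightarrow> (nat \<Rightarrow> nat) \<Rightarrow> 'a polyfun \<Rightarrow> 'a polyfun" where
  "truncation_op u v n l r s t =
     op_prod (\<lambda>i. (\<lambda>f x. - fdiff_v v i f x) ^^ s i) [1..<l+1] \<circ>
     op_prod (\<lambda>k. bdiff_u u k ^^ t k) [n-r+1..<n+1]"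

definition correction_op ::
    "'a::field_char_0 \<Rightarrow> 'a \<Rightarrow> nat set \<Rightarrow> nat set \<Rightarrow> 'a polyfun \<Rightarrow> 'a polyfun" where
  "correction_op u v I J =
     op_prod (finv_v v) (sorted_list_of_set I) \<circ> op_prod (binv_u u) (sorted_list_of_set J)"


section \<open>The polynomials\<close>

definition GT_poly :: "nat \<Rightarrow> 'a::field_char_0 polyfun" where
  "GT_poly n = (\<lambda>x. \<Prod>(i, j)\<in>{(i, j). 1 \<le> i \<and> i < j \<and> j \<le> n}.
      (x j - x i + of_nat j - of_nat i) / (of_nat j - of_nat i))"

definition M_poly :: "'a::field_char_0 \<Rightarrow> 'a \<Rightarrow> nat \<Rightarrow> 'a polyfun" where
  "M_poly u v n = strict_all u v n (GT_poly n)"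

text \<open>The matrices of the library have indices starting from 0, so the entry with mathematical
  indices \<open>i + 1\<close> and \<open>j + 1\<close> is the one at \<open>(i, j)\<close>.\<close>

definition GT_top :: "nat \<Rightarrow> int \<Rightarrow> int \<Rightarrow> int \<Rightarrow> 'a::field_char_0 polyfun" where
  "GT_top n a \<alpha> \<beta> = (\<lambda>x. \<Sum>b = 0..nat (\<beta> - \<alpha>).
      (-1) powi (a + \<alpha> + int b) * of_nat (b choose nat (a - \<alpha>)) *
      det (mat n n (\<lambda>(i, j). (x (i + 1) + of_nat (i + 1) - of_int \<alpha> - 1) gchoose
                              (j + (if j + 1 = n then b else 0)))))"

definition M_top :: "'a::field_char_0 \<Rightarrow> 'a \<Rightarrow> nat \<Rightarrow> int \<Rightarrow> int \<Rightarrow> int \<Rightarrow> 'a polyfun" where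
  "M_top u v n a \<alpha> \<beta> = strict_all u v n (GT_top n a \<alpha> \<beta>)"

text \<open>The top entry is the bottom entry of a NE-diagonal with index in \<open>I\<close> or of a SE-diagonal with
  index in \<open>J\<close>.  In this degenerate situation prescribing the top entry is incompatible with
  the operators for \<open>I\<close> and \<open>J\<close> unless \<open>u = v = 1\<close>.  For instance, for \<open>n = 1\<close>, \<open>J = {1}\<close> the
  trees with top entry \<open>a\<close> are counted by the indicator of \<open>b\<^sub>1 = a\<close>, which is the value of \<open>M_top\<close>
  itself at \<open>b\<^sub>1\<close>, and the operator alters this value.\<close>

definition top_in_cut :: "nat \<Rightarrow> (nat \<times> nat) set \<Rightarrow> nat set \<Rightarrow> nat set \<Rightarrow> bool" where
  "top_in_cut n S I J \<longleftrightarrow>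
     (\<exists>i\<in>I. is_bottom S (ne_diag n i) (1, 1)) \<or> (\<exists>k\<in>J. is_bottom S (se_diag n k) (1, 1))"

end

theory Submission
  imports Defs "HOL-Computational_Algebra.Formal_Power_Series"
begin

text \<open>
  Write \<open>w = 1 - u - v\<close> and \<open>Q(X, Y) = v + w X + u X Y\<close>.  Strict with subscripts \<open>y, x\<close> is
  \<open>Q(E\<^sub>x, E\<^sub>y)\<close> up to a shift of \<open>y\<close>, and these shifts turn \<open>GT\<^sub>n\<close> into an alternating polynomial \<open>D\<^sub>n\<close>, a
  determinant, so that \<open>M\<^sub>n = \<Prod> Q(E\<^sub>p, E\<^sub>q) D\<^sub>n\<close>, the product over \<open>p < q\<close>.

  Summing \<open>M\<^sub>n\<close> with weights over all rows that can be placed above a given bottom row \<open>k\<close> gives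
  \<open>M\<^sub>n\<^sub>+\<^sub>1(k)\<close>.  Indeed, \<open>M\<^sub>n\<close> has a multiple antiderivative of the form \<open>\<Phi> = \<Prod> Q(E\<^sub>p, E\<^sub>q) D\<close> with \<open>D\<close>
  alternating, and the sum is an alternating sum of values of \<open>\<Phi>\<close>, in which every summation range is
  replaced by one of its two ends.  If two neighbouring ranges are both replaced by their common end
  \<open>k\<^sub>i\<close>, the weights add up to a factor \<open>Q(Y, X) Q(X, Y)\<close>, which is symmetric, and the term vanishes.
  In each of the remaining terms exactly one \<open>k\<^sub>i\<close> is omitted; they form the expansion of \<open>D\<^sub>n\<^sub>+\<^sub>1\<close>
  along a column of ones.

  The difference operators undo this summation at its two ends: \<open>-\<Delta>[v]\<close> in the leftmost variable
  replaces the first summation variable by its lower bound with weight 1, \<open>(1 + (1 - v) \<Delta>)\<^sup>-\<^sup>1\<close> changes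
  the weight of this bound from \<open>v\<close> to 1, and the operators in \<open>u\<close> act in the same way at the right end.
  Hence the theorem follows by induction on the order, removing the last row of the tree.
\<close>

section \<open>Extended row sums\<close>

text \<open>A sum over the integers between two bounds is polynomial in the bounds only where these
  are ordered, but the shifts in the difference operators leave that region. \<open>ext_sum\<close>
  makes the sum polynomial for bounds in any order. It is half-open, so that differences telescope;
  the upper end of a range, which has weight \<open>u\<close> and forbids its value to the right
  neighbour, is a separate term. The price is paid on the way back to trees. For strictly increasing
  bounds the extended sum is the sum over strict rows, but coinciding bounds cause additional signed
  terms. For \<open>u = v = 1\<close> they involve the smaller polynomial only at rows with three
  equal neighbours, where it vanishes because no tree fits above them. Hence the induction
  hypothesis has to be available at rows that are not strict. Both families of polynomials are
  treated at once: the last column of the determinant contains the antiderivatives of an arbitrary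
  weight of the top entry. The operators are studied at integer points only, and being polynomial is
  replaced by nilpotency of the differences in each variable.\<close>

definition ext_sum :: "int \<Rightarrow> int \<Rightarrow> (int \<Rightarrow> 'a::ab_group_add) \<Rightarrow> 'a" where
  "ext_sum a b f = (if a \<le> b then sum f {a..<b} else - sum f {b..<a})"

lemma ext_sum_upper: "ext_sum a (b + 1) f = ext_sum a b f + f b"
proof (cases "a \<le> b")
  case True
  then have "{a..<b+1} = insert b {a..<b}" by auto
  with True show ?thesis by (simp add: ext_sum_def add.commute)
next
  case False
  then have "{b..<a} = insert b {b+1..<a}" by auto
  with False show ?thesis by (auto simp: ext_sum_def)
qed

lemma ext_sum_lower: "ext_sum (a + 1) b f = ext_sum a b f - f a"
proof (cases "a < b")
  case True
  then have "{a..<b} = insert a {a+1..<b}" by auto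
  with True show ?thesis by (simp add: ext_sum_def)
next
  case False
  then have "{b..<a+1} = insert a {b..<a}" by auto
  with False show ?thesis by (cases "a = b") (simp_all add: ext_sum_def)
qed

lemma ext_sum_add: "ext_sum a b (\<lambda>l. f l + g l) = ext_sum a b f + ext_sum a b g"
  by (simp add: ext_sum_def sum.distrib)

lemma ext_sum_diff: "ext_sum a b (\<lambda>l. f l - g l) = ext_sum a b f - ext_sum a b g"
  by (simp add: ext_sum_def sum_subtractf)

lemma ext_sum_cmult: "ext_sum a b (\<lambda>l. (c::'a::ring) * f l) = c * ext_sum a b f"
  by (simp add: ext_sum_def sum_distrib_left)

lemma ext_sum_telescope: "ext_sum a b (\<lambda>l. g (l + 1) - g l) = g b - g a"
proof -
  have *: "a \<le> b \<Longrightarrow> sum (\<lambda>l. g (l + 1) - g l) {a..<b} = g b - g a" for a b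
  proof (induction b rule: int_ge_induct)
    case (step i)
    then have "{a..<i+1} = insert i {a..<i}" by auto
    with step show ?case by simp
  qed simp
  show ?thesis using *[of a b] *[of b a] by (simp add: ext_sum_def)
qed

section \<open>Weighted row sums and products of the operators Q\<close>

locale weights =
  fixes u v :: "'a::field_char_0"
begin

text \<open>Functions of integer lists stand for polynomials in several variables.  \<open>row_sum\<close> sums over all
  rows between the entries of \<open>ks\<close>; an entry that equals its left or right neighbour has weight \<open>v\<close> or
  \<open>u\<close>, except at the two ends of the row, where the weights are \<open>v1\<close> and \<open>u1\<close>.  As \<open>ext_sum\<close> is used,
  the result is polynomial in \<open>ks\<close>.  The argument \<open>a\<close> of \<open>part_sum\<close> is the lower bound for the first
  entry.\<close>

primrec part_sum :: "'a \<Rightarrow> int \<Rightarrow> int list \<Rightarrow> (int list \<Rightarrow> 'a) \<Rightarrow> 'a" where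
  "part_sum u1 a [] f = f []"
| "part_sum u1 a (k # ks) f =
     ext_sum a k (\<lambda>l. v * part_sum u1 k ks (\<lambda>ls. f (l # ls)) + (1 - v) * part_sum u1 (k + 1) ks (\<lambda>ls. f (l # ls)))
     + (if ks = [] then u1 else u) * part_sum u1 (k + 1) ks (\<lambda>ls. f (k # ls))"

definition row_sum :: "'a \<Rightarrow> 'a \<Rightarrow> int list \<Rightarrow> (int list \<Rightarrow> 'a) \<Rightarrow> 'a" where
  "row_sum v1 u1 ks f = v1 * part_sum u1 (hd ks) (tl ks) f + (1 - v1) * part_sum u1 (hd ks + 1) (tl ks) f"

lemma part_sum_cong:
  "(\<And>ls. length ls = length ks \<Longrightarrow> f ls = g ls) \<Longrightarrow> part_sum u1 a ks f = part_sum u1 a ks g"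
proof (induction ks arbitrary: a f g)
  case (Cons k ks)
  have "part_sum u1 b ks (\<lambda>ls. f (l # ls)) = part_sum u1 b ks (\<lambda>ls. g (l # ls))" for b l
    by (rule Cons.IH) (simp add: Cons.prems)
  then show ?case by simp
qed simp

lemma part_sum_add: "part_sum u1 a ks (\<lambda>ls. f ls + g ls) = part_sum u1 a ks f + part_sum u1 a ks g"
  by (induction ks arbitrary: a f g) (simp_all add: algebra_simps flip: ext_sum_add)

lemma part_sum_cmult: "part_sum u1 a ks (\<lambda>ls. c * f ls) = c * part_sum u1 a ks f"
  by (induction ks arbitrary: a f) (simp_all add: algebra_simps flip: ext_sum_cmult)

definition w :: 'a where "w = 1 - u - v"

text \<open>\<open>qop ks H x\<close> is the product of the \<open>Q(E\<^sub>x, E\<^sub>k)\<close>, \<open>k\<close> an entry of \<open>ks\<close>, applied to \<open>H\<close>;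
  \<open>mop n\<close> is the product of all \<open>Q(E\<^sub>p, E\<^sub>q)\<close> with \<open>p < q\<close>; \<open>uop\<close> is the product of the \<open>Q(1, E\<^sub>k)\<close>.\<close>

primrec qop :: "int list \<Rightarrow> (int \<Rightarrow> int list \<Rightarrow> 'a) \<Rightarrow> int \<Rightarrow> 'a" where
  "qop [] H x = H x []"
| "qop (k # ks) H x = v * qop ks (\<lambda>x ks. H x (k # ks)) x
     + w * qop ks (\<lambda>x ks. H x (k # ks)) (x + 1)
     + u * qop ks (\<lambda>x ks. H x ((k + 1) # ks)) (x + 1)"

primrec mop :: "nat \<Rightarrow> (int list \<Rightarrow> 'a) \<Rightarrow> int list \<Rightarrow> 'a" where
  "mop 0 D = D"
| "mop (Suc n) D = (\<lambda>xs. qop (tl xs) (\<lambda>x. mop n (\<lambda>ks. D (x # ks))) (hd xs))"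

primrec uop :: "int list \<Rightarrow> (int list \<Rightarrow> 'a) \<Rightarrow> 'a" where
  "uop [] G = G []"
| "uop (k # ks) G = (1 - u) * uop ks (\<lambda>ls. G (k # ls)) + u * uop ks (\<lambda>ls. G ((k + 1) # ls))"

text \<open>The value of a row sum in terms of the multiple antiderivative \<open>F\<close> of the summand.  The first
  term of the recursion belongs to the upper end of the first range; then all further ranges have to be
  replaced by their upper ends as well.\<close>

primrec bdry :: "int list \<Rightarrow> (int list \<Rightarrow> 'a) \<Rightarrow> int \<Rightarrow> 'a" where
  "bdry [] F a = F []"
| "bdry (k # ks) F a = uop (k # ks) F
     - (v * bdry ks (\<lambda>ls. F (a # ls)) k + (1 - v) * bdry ks (\<lambda>ls. F (a # ls)) (k + 1))"

definition bdry_sum :: "int list \<Rightarrow> (int list \<Rightarrow> 'a) \<Rightarrow> 'a" where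
  "bdry_sum ks F = v * bdry (tl ks) F (hd ks) + (1 - v) * bdry (tl ks) F (hd ks + 1)"

text \<open>If \<open>all_diff n F = f\<close>, then \<open>F\<close> is what is called a multiple
  antiderivative of \<open>f\<close>: one forward difference for each of the \<open>n\<close>
  arguments.\<close>

primrec all_diff :: "nat \<Rightarrow> (int list \<Rightarrow> 'a) \<Rightarrow> int list \<Rightarrow> 'a" where
  "all_diff 0 F = F"
| "all_diff (Suc n) F = (\<lambda>ls. all_diff n (\<lambda>ks. F ((hd ls + 1) # ks) - F (hd ls # ks)) (tl ls))"

lemma qop_add: "qop ks (\<lambda>x ls. F x ls + G x ls) x = qop ks F x + qop ks G x"
  by (induction ks arbitrary: F G x) (simp_all add: algebra_simps)

lemma qop_cmult: "qop ks (\<lambda>x ls. c * F x ls) x = c * qop ks F x"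
  by (induction ks arbitrary: F x) (simp_all add: algebra_simps)

lemma qop_diff: "qop ks (\<lambda>x ls. F x ls - G x ls) x = qop ks F x - qop ks G x"
  using qop_add[of ks F "\<lambda>x ls. - 1 * G x ls"] unfolding qop_cmult by simp

lemma qop_shift: "qop ks (\<lambda>x. F (x + 1)) x = qop ks F (x + 1)"
proof (induction ks arbitrary: F x)
  case (Cons k ks)
  show ?case
    by (simp only: qop.simps Cons.IH[of "\<lambda>x ls. F x (l # ls)" for l])
qed simp

lemma qop_cong:
  "(\<And>x ls. length ls = length ks \<Longrightarrow> F x ls = G x ls) \<Longrightarrow> qop ks F x = qop ks G x"
proof (induction ks arbitrary: F G x)
  case (Cons k ks)
  have "qop ks (\<lambda>x ls. F x (l # ls)) y = qop ks (\<lambda>x ls. G x (l # ls)) y" for l y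
    by (rule Cons.IH) (simp add: Cons.prems)
  then show ?case by simp
qed simp

lemma mop_cmult: "mop n (\<lambda>ls. c * F ls) ks = c * mop n F ks"
proof (induction n arbitrary: F ks)
  case (Suc n)
  show ?case unfolding mop.simps Suc.IH qop_cmult ..
qed simp

lemma mop_diff: "mop n (\<lambda>ls. F ls - G ls) ks = mop n F ks - mop n G ks"
proof (induction n arbitrary: F G ks)
  case (Suc n)
  show ?case unfolding mop.simps Suc.IH qop_diff ..
qed simp

lemma mop_cong:
  "(\<And>ls. length ls = n \<Longrightarrow> F ls = G ls) \<Longrightarrow> length ks = n \<Longrightarrow> mop n F ks = mop n G ks"
proof (induction n arbitrary: F G ks)
  case (Suc n)
  show ?case unfolding mop.simps
    by (rule qop_cong, rule Suc.IH) (use Suc.prems in auto)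
qed simp

lemma uop_add: "uop ks (\<lambda>ls. F ls + G ls) = uop ks F + uop ks G"
  by (induction ks arbitrary: F G) (simp_all add: algebra_simps)

lemma uop_cmult: "uop ks (\<lambda>ls. c * F ls) = c * uop ks F"
  by (induction ks arbitrary: F) (simp_all add: algebra_simps)

lemma bdry_add: "bdry ks (\<lambda>ls. F ls + G ls) a = bdry ks F a + bdry ks G a"
  by (induction ks arbitrary: F G a) (simp_all add: algebra_simps uop_add del: uop.simps)

lemma bdry_cmult: "bdry ks (\<lambda>ls. c * F ls) a = c * bdry ks F a"
  by (induction ks arbitrary: F a) (simp_all add: algebra_simps uop_cmult del: uop.simps)

lemma bdry_diff: "bdry ks (\<lambda>ls. F ls - G ls) a = bdry ks F a - bdry ks G a"
  using bdry_add[of ks F "\<lambda>ls. - 1 * G ls"] unfolding bdry_cmult by simp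

lemma bdry_zero: "(\<And>ls. length ls = length ks \<Longrightarrow> F ls = 0) \<Longrightarrow> bdry ks F a = 0"
proof (induction ks arbitrary: F a)
  case (Cons k ks)
  have "uop ks F = 0" if "\<And>ls. length ls = length ks \<Longrightarrow> F ls = 0" for ks F
    using that by (induction ks arbitrary: F) auto
  moreover have "bdry ks (\<lambda>ls. F (a # ls)) b = 0" for b
    by (rule Cons.IH) (simp add: Cons.prems)
  ultimately show ?case using Cons.prems by (simp del: uop.simps)
qed simp

lemma all_diff_add: "all_diff n (\<lambda>ls. F ls + G ls) ks = all_diff n F ks + all_diff n G ks"
proof (induction n arbitrary: F G ks)
  case (Suc n)
  show ?case by (simp add: flip: Suc.IH) (simp add: algebra_simps)
qed simp

lemma all_diff_cmult: "all_diff n (\<lambda>ls. c * F ls) ks = c * all_diff n F ks"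
proof (induction n arbitrary: F ks)
  case (Suc n)
  show ?case by (simp add: flip: Suc.IH) (simp add: algebra_simps)
qed simp

lemma all_diff_diff: "all_diff n (\<lambda>ls. F ls - G ls) ks = all_diff n F ks - all_diff n G ks"
  using all_diff_add[of n F "\<lambda>ls. - 1 * G ls" ks] unfolding all_diff_cmult by simp

text \<open>Both sides are built from shift operators with constant coefficients, which commute. The
  distinguished variable \<open>x\<close> is not differenced.\<close>

lemma all_diff_qop:
  "length ks = n \<Longrightarrow> all_diff n (\<lambda>ks. qop ks H x) ks = qop ks (\<lambda>x. all_diff n (H x)) x"
proof (induction n arbitrary: ks H x)
  case (Suc n)
  then obtain k ks' where ks: "ks = k # ks'" "length ks' = n" by (cases ks) auto
  show ?case
    by (simp add: ks all_diff_diff all_diff_add all_diff_cmult Suc.IH qop_diff algebra_simps)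
qed simp

text \<open>An antiderivative of the determinant inside \<open>mop\<close> thus gives an
  antiderivative of the whole polynomial, again of the form \<open>mop n D\<close>.\<close>

lemma all_diff_mop: "length ks = n \<Longrightarrow> all_diff n (mop n D) ks = mop n (all_diff n D) ks"
proof (induction n arbitrary: ks D)
  case (Suc n)
  then obtain k ks' where ks: "ks = k # ks'" "length ks' = n" by (cases ks) auto
  let ?H = "\<lambda>x. mop n (\<lambda>ks. D (x # ks))"
  have "all_diff (Suc n) (mop (Suc n) D) ks = all_diff n (\<lambda>ks. qop ks (\<lambda>x ls. ?H (x + 1) ls - ?H x ls) k) ks'"
    by (simp add: ks qop_diff qop_shift[of _ ?H])
  also have "\<dots> = qop ks' (\<lambda>x. all_diff n (mop n (\<lambda>ls. D ((x + 1) # ls) - D (x # ls)))) k"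
    by (subst all_diff_qop) (simp_all add: ks mop_diff[symmetric] cong: if_cong)
  also have "\<dots> = qop ks' (\<lambda>x. mop n (all_diff n (\<lambda>ls. D ((x + 1) # ls) - D (x # ls)))) k"
    by (rule qop_cong, rule Suc.IH) (simp add: ks)
  finally show ?case by (simp add: ks)
qed simp

end

section \<open>Antisymmetry and vanishing of the antiderivative\<close>

context weights
begin

text \<open>The operator \<open>Q(Y, X)\<close>, with the two neighbouring variables in reversed
  order. It supplies the factor that \<open>mop\<close>, which contains only \<open>Q(X, Y)\<close>,
  lacks for symmetry.\<close>

definition qval :: "(int list \<Rightarrow> 'a) \<Rightarrow> int list \<Rightarrow> int \<Rightarrow> int \<Rightarrow> int list \<Rightarrow> 'a" where
  "qval F xs x y ys = v * F (xs @ x # y # ys) + w * F (xs @ x # (y + 1) # ys)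
     + u * F (xs @ (x + 1) # (y + 1) # ys)"

definition qvanish :: "nat \<Rightarrow> (int list \<Rightarrow> 'a) \<Rightarrow> bool" where
  "qvanish n F \<longleftrightarrow> (\<forall>xs x ys. length xs + length ys + 2 = n \<longrightarrow> qval F xs x x ys = 0)"

lemma qvanish_Cons: "qvanish (Suc n) F \<Longrightarrow> qvanish n (\<lambda>ls. F (a # ls))"
  unfolding qvanish_def
proof (intro allI impI)
  fix xs ys :: "int list" and x
  assume "\<forall>xs x ys. length xs + length ys + 2 = Suc n \<longrightarrow> qval F xs x x ys = 0"
    and "length xs + length ys + 2 = n"
  from this(1)[rule_format, of "a # xs" ys x] this(2)
  show "qval (\<lambda>ls. F (a # ls)) xs x x ys = 0" by (simp add: qval_def)
qed

lemma qvanish_diff: "qvanish n F \<Longrightarrow> qvanish n G \<Longrightarrow> qvanish n (\<lambda>ls. F ls - G ls)"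
proof -
  have "qval (\<lambda>ls. F ls - G ls) xs x y ys = qval F xs x y ys - qval G xs x y ys" for xs x y ys
    by (simp add: qval_def algebra_simps)
  then show "qvanish n F \<Longrightarrow> qvanish n G \<Longrightarrow> ?thesis"
    by (simp add: qvanish_def)
qed

text \<open>By induction the inner ranges are already replaced by their ends, and the sum over the
  first entry telescopes. Its lower end gives the subtracted terms of \<open>bdry\<close>; at its
  upper end all terms cancel by \<open>qvanish\<close>, except those in which the later ranges take
  their upper ends as well.\<close>

lemma part_sum_all_diff:
  "length ks = n \<Longrightarrow> qvanish n F \<Longrightarrow> part_sum u a ks (all_diff n F) = bdry ks F a"
proof (induction ks arbitrary: a n F)
  case (Cons k ks)
  then obtain m where n: "n = Suc m" and m: "length ks = m" by auto
  have IH: "part_sum u b ks (\<lambda>ls. all_diff n F (l # ls))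
      = bdry ks (\<lambda>ls. F ((l + 1) # ls)) b - bdry ks (\<lambda>ls. F (l # ls)) b" for b l
    using Cons.IH[OF m, of "\<lambda>ls. F ((l + 1) # ls) - F (l # ls)" b] Cons.prems(2)
    by (simp add: n bdry_diff qvanish_diff qvanish_Cons)
  have e: "v * (p - q) + (1 - v) * (p' - q') = (v * p + (1 - v) * p') - (v * q + (1 - v) * q')" for p q p' q'
    by (simp add: algebra_simps)
  let ?R = "\<lambda>l. v * bdry ks (\<lambda>ls. F (l # ls)) k + (1 - v) * bdry ks (\<lambda>ls. F (l # ls)) (k + 1)"
  have "part_sum u a (k # ks) (all_diff n F)
      = ext_sum a k (\<lambda>l. ?R (l + 1) - ?R l)
        + u * (bdry ks (\<lambda>ls. F ((k + 1) # ls)) (k + 1) - bdry ks (\<lambda>ls. F (k # ls)) (k + 1))"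
    by (simp add: IH e)
  also have "\<dots> = ?R k - ?R a
        + u * (bdry ks (\<lambda>ls. F ((k + 1) # ls)) (k + 1) - bdry ks (\<lambda>ls. F (k # ls)) (k + 1))"
    using ext_sum_telescope[of a k ?R] by simp
  finally have 1: "part_sum u a (k # ks) (all_diff n F) = ?R k - ?R a
        + u * (bdry ks (\<lambda>ls. F ((k + 1) # ls)) (k + 1) - bdry ks (\<lambda>ls. F (k # ls)) (k + 1))" .
  \<comment> \<open>Unfolding \<open>bdry\<close> once more puts \<open>k\<close> or
    \<open>k + 1\<close>, the lower end of the next range, in second place. The coefficients of
    \<open>(k, k)\<close>, \<open>(k, k + 1)\<close> and \<open>(k + 1, k + 1)\<close> are
    \<open>v\<close>, \<open>(1 - v) - u = w\<close> and \<open>u\<close>, so these terms form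
    \<open>qval\<close> at two equal arguments.\<close>
  have 2: "?R k
        + u * (bdry ks (\<lambda>ls. F ((k + 1) # ls)) (k + 1) - bdry ks (\<lambda>ls. F (k # ls)) (k + 1))
      = uop (k # ks) F"
  proof (cases ks)
    case Nil
    then show ?thesis by (simp add: w_def algebra_simps)
  next
    case ks: (Cons k' ks')
    have "bdry ks' (\<lambda>ls. qval F [] k c ls) b = 0 \<or> c \<noteq> k" for b c
      by (rule disjCI, rule bdry_zero) (use Cons.prems ks n m in \<open>auto simp: qvanish_def\<close>)
    then have "bdry ks' (\<lambda>ls. v * F (k # k # ls) + w * F (k # (k + 1) # ls)
        + u * F ((k + 1) # (k + 1) # ls)) b = 0" for b
      by (auto simp: qval_def)
    then have z: "v * bdry ks' (\<lambda>ls. F (k # k # ls)) b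
        + w * bdry ks' (\<lambda>ls. F (k # (k + 1) # ls)) b
        + u * bdry ks' (\<lambda>ls. F ((k + 1) # (k + 1) # ls)) b = 0" for b
      by (simp only: bdry_add bdry_cmult)
    show ?thesis
      using arg_cong2[OF z[of k'] z[of "k' + 1"], of "\<lambda>p q. v * p + (1 - v) * q"]
      by (simp add: ks w_def algebra_simps)
  qed
  show ?case unfolding 1 bdry.simps 2[symmetric] by simp
qed simp

definition alternating :: "nat \<Rightarrow> (int list \<Rightarrow> 'a) \<Rightarrow> bool" where
  "alternating n D \<longleftrightarrow>
     (\<forall>xs x y ys. length xs + length ys + 2 = n \<longrightarrow> D (xs @ x # y # ys) = - D (xs @ y # x # ys))"

definition qalternating :: "nat \<Rightarrow> (int list \<Rightarrow> 'a) \<Rightarrow> bool" where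
  "qalternating n F \<longleftrightarrow>
     (\<forall>xs x y ys. length xs + length ys + 2 = n \<longrightarrow> qval F xs x y ys = - qval F xs y x ys)"

lemma alternatingD:
  "alternating n D \<Longrightarrow> length xs + length ys + 2 = n \<Longrightarrow> D (xs @ x # y # ys) = - D (xs @ y # x # ys)"
  unfolding alternating_def by blast

lemma qalternatingD:
  "qalternating n F \<Longrightarrow> length xs + length ys + 2 = n \<Longrightarrow> qval F xs x y ys = - qval F xs y x ys"
  unfolding qalternating_def by blast

lemma alternating_Cons: "alternating (Suc n) F \<Longrightarrow> alternating n (\<lambda>ls. F (a # ls))"
  unfolding alternating_def
proof (intro allI impI)
  fix xs ys :: "int list" and x y
  assume "\<forall>xs x y ys. length xs + length ys + 2 = Suc n \<longrightarrow> F (xs @ x # y # ys) = - F (xs @ y # x # ys)"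
    and "length xs + length ys + 2 = n"
  from this(1)[rule_format, of "a # xs" ys x y] this(2)
  show "F (a # xs @ x # y # ys) = - F (a # xs @ y # x # ys)" by simp
qed

lemma qalternating_Cons: "qalternating (Suc n) F \<Longrightarrow> qalternating n (\<lambda>ls. F (a # ls))"
  unfolding qalternating_def
proof (intro allI impI)
  fix xs ys :: "int list" and x y
  assume "\<forall>xs x y ys. length xs + length ys + 2 = Suc n \<longrightarrow> qval F xs x y ys = - qval F xs y x ys"
    and "length xs + length ys + 2 = n"
  from this(1)[rule_format, of "a # xs" ys x y] this(2)
  show "qval (\<lambda>ls. F (a # ls)) xs x y ys = - qval (\<lambda>ls. F (a # ls)) xs y x ys"
    by (simp add: qval_def)
qed

lemma qalternating_imp_qvanish:
  assumes "qalternating n F" shows "qvanish n F"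
proof -
  have "qval F xs x x ys = 0" if "length xs + length ys + 2 = n" for xs x ys
  proof -
    have "qval F xs x x ys = - qval F xs x x ys"
      using assms that unfolding qalternating_def by blast
    then show ?thesis by simp
  qed
  then show ?thesis by (simp add: qvanish_def)
qed

lemma qop_uminus: "qop ks (\<lambda>x ls. - F x ls) x = - qop ks F x"
  using qop_cmult[of ks "-1" F x] by simp

text \<open>The product \<open>Q(Z, X) Q(Z, Y)\<close> is symmetric in \<open>X\<close> and
  \<open>Y\<close>, so operators that join a further variable \<open>z\<close> to both members of
  the pair preserve antisymmetry.\<close>

lemma qalternating_qop:
  assumes H: "\<And>x. qalternating n (H x)"
  shows "qalternating n (\<lambda>ks. qop ks H x)"
proof -
  have "qval (\<lambda>ks. qop ks H z) xs x y ys = - qval (\<lambda>ks. qop ks H z) xs y x ys"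
    if "\<And>x. qalternating n (H x)" "length xs + length ys + 2 = n" for xs x y ys z
    using that
  proof (induction xs arbitrary: n H z)
    case Nil
    define G where "G z x y = qop ys (\<lambda>z ks. qval (H z) [] x y ks) z" for z x y
    have G: "G z x y = - G z y x" for z x y
    proof -
      have "G z x y = qop ys (\<lambda>z ks. - qval (H z) [] y x ks) z"
        unfolding G_def by (intro qop_cong qalternatingD[OF Nil(1)]) (use Nil in simp)
      then show ?thesis by (simp add: G_def qop_uminus)
    qed
    \<comment> \<open>The factors \<open>Q(Z, X)\<close> and \<open>Q(Z, Y)\<close> written out.
      Exchanging \<open>x\<close> and \<open>y\<close> permutes the nine terms, and each of them
      changes its sign by antisymmetry of \<open>G\<close>.\<close>
    have *: "qval (\<lambda>ks. qop ks H z) [] x y ys =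
       v * (v * G z x y + w * G (z + 1) x y + u * G (z + 1) x (y + 1))
       + w * (v * G (z + 1) x y + w * G (z + 1 + 1) x y + u * G (z + 1 + 1) x (y + 1))
       + u * (v * G (z + 1) (x + 1) y + w * G (z + 1 + 1) (x + 1) y + u * G (z + 1 + 1) (x + 1) (y + 1))" for x y
      unfolding G_def by (simp add: qval_def[abs_def] qop_add qop_cmult) (simp add: algebra_simps)
    show ?case
      unfolding * G[of _ y x] G[of _ y "x+1"] G[of _ "y+1" x] G[of _ "y+1" "x+1"]
      by (simp add: algebra_simps)
  next
    case (Cons a xs)
    then obtain m where n: "n = Suc m" and m: "length xs + length ys + 2 = m" by auto
    have IH: "qval (\<lambda>ks. qop ks (\<lambda>z ks. H z (b # ks)) z) xs x y ys
        = - qval (\<lambda>ks. qop ks (\<lambda>z ks. H z (b # ks)) z) xs y x ys" for z b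
      by (rule Cons.IH[OF _ m], rule qalternating_Cons) (use Cons.prems n in simp)
    have *: "qval (\<lambda>ks. qop ks H z) (a # xs) x y ys =
       v * qval (\<lambda>ks. qop ks (\<lambda>z ks. H z (a # ks)) z) xs x y ys
       + w * qval (\<lambda>ks. qop ks (\<lambda>z ks. H z (a # ks)) (z + 1)) xs x y ys
       + u * qval (\<lambda>ks. qop ks (\<lambda>z ks. H z ((a + 1) # ks)) (z + 1)) xs x y ys" for x y
      unfolding qval_def append_Cons qop.simps by (simp add: algebra_simps)
    show ?case unfolding * by (subst (1 2 3) IH) simp
  qed
  from this[OF H] show ?thesis
    unfolding qalternating_def by blast
qed

lemma qop_swap:
  "qop ys (\<lambda>x ks. qop ks (\<lambda>y. B x y) y) x = qop ys (\<lambda>y ks. qop ks (\<lambda>x. B x y) x) y"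
proof (induction ys arbitrary: B x y)
  case (Cons k ks)
  show ?case
    by (simp add: qop_add qop_cmult Cons.IH[of "\<lambda>x y ls. B x y (l # ls)" for l])
      (simp add: algebra_simps)
qed simp

text \<open>If the pair stands at the front, the operators joining its members to the other
  arguments commute (\<open>qop_swap\<close>), so \<open>K\<close> is antisymmetric, and the pair
  itself contributes the symmetric factor \<open>Q(Y, X) Q(X, Y)\<close>. Otherwise the first
  argument is split off and \<open>qalternating_qop\<close> applies.\<close>

lemma qalternating_mop: "alternating n D \<Longrightarrow> qalternating n (mop n D)"
proof (induction n arbitrary: D)
  case (Suc n)
  have H: "qalternating n (mop n (\<lambda>ks. D (x # ks)))" for x
    by (rule Suc.IH, rule alternating_Cons, rule Suc.prems)
  have "qval (mop (Suc n) D) xs x y ys = - qval (mop (Suc n) D) xs y x ys"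
    if len: "length xs + length ys + 2 = Suc n" for xs x y ys
  proof (cases xs)
    case (Cons z xs')
    have "qval (\<lambda>ks. qop ks (\<lambda>x. mop n (\<lambda>ks. D (x # ks))) z) xs' x y ys
        = - qval (\<lambda>ks. qop ks (\<lambda>x. mop n (\<lambda>ks. D (x # ks))) z) xs' y x ys"
      by (rule qalternatingD[OF qalternating_qop[of n "\<lambda>x. mop n (\<lambda>ks. D (x # ks))", OF H]])
        (use len Cons in simp)
    then show ?thesis by (simp add: qval_def Cons)
  next
    case Nil
    then obtain m where n: "n = Suc m" and m: "length ys = m" using len by (cases n) auto
    define B where "B x y = mop m (\<lambda>ks. D (x # y # ks))" for x y
    define K where "K x y = qop ys (\<lambda>x ks. qop ks (\<lambda>y. B x y) y) x" for x y
    have B: "B x y ls = - B y x ls" if "length ls = m" for x y ls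
    proof -
      have "B x y ls = mop m (\<lambda>ks. -1 * D (y # x # ks)) ls"
        unfolding B_def
        using alternatingD[OF Suc.prems, of "[]" _ x y] n that by (intro mop_cong) auto
      then show ?thesis by (simp only: mop_cmult B_def) simp
    qed
    have K: "K x y = - K y x" for x y
    proof -
      have "K x y = qop ys (\<lambda>x ks. - qop ks (\<lambda>y. B y x) y) x"
        unfolding K_def qop_uminus[symmetric]
        by (intro qop_cong B) (simp add: m)
      also have "\<dots> = - K y x"
        unfolding qop_uminus K_def by (subst qop_swap) simp
      finally show ?thesis .
    qed
    have *: "mop (Suc n) D (x # y # ys) = v * K x y + w * K (x + 1) y + u * K (x + 1) (y + 1)" for x y
      by (simp add: n K_def B_def)
    show ?thesis
      unfolding Nil qval_def append_Nil * K[of y x] K[of y "x + 1"] K[of y "x+1+1"]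
       K[of "y+1" x] K[of "y+1" "x + 1"] K[of "y+1" "x+1+1"]
       K[of "y+1+1" x] K[of "y+1+1" "x + 1"] K[of "y+1+1" "x+1+1"]
      by (simp add: algebra_simps)
  qed
  then show ?case unfolding qalternating_def by blast
qed (simp add: qalternating_def)

section \<open>Alternating sums with one omitted argument\<close>

primrec omit :: "int list \<Rightarrow> (int list \<Rightarrow> 'a) \<Rightarrow> 'a" where
  "omit [] D = 0"
| "omit (k # ks) D = D ks - omit ks (\<lambda>ls. D (k # ls))"

lemma bdry_sum_add: "bdry_sum ks (\<lambda>ls. F ls + G ls) = bdry_sum ks F + bdry_sum ks G"
  by (simp add: bdry_sum_def bdry_add algebra_simps)

lemma bdry_sum_cmult: "bdry_sum ks (\<lambda>ls. c * F ls) = c * bdry_sum ks F"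
  by (simp add: bdry_sum_def bdry_cmult algebra_simps)

lemma bdry_sum_Cons: "ks \<noteq> [] \<Longrightarrow>
  bdry_sum (k # ks) F = uop ks F - (v * bdry_sum ks (\<lambda>ls. F (k # ls)) + (1 - v) * bdry_sum ks (\<lambda>ls. F ((k + 1) # ls)))"
  by (cases ks) (simp_all add: bdry_sum_def algebra_simps del: uop.simps)

lemma bdry_sum_single [simp]: "bdry_sum [k] F = F []"
  by (simp add: bdry_sum_def algebra_simps)

text \<open>A function that does not depend on \<open>x\<close> is fixed by shifts of
  \<open>x\<close>, so \<open>Q(X, Y)\<close> reduces to
  \<open>Q(1, Y) = (1 - u) + u Y\<close>.\<close>

lemma qop_const: "qop ks (\<lambda>x. F) x = uop ks F"
  by (induction ks arbitrary: F x) (simp_all add: w_def algebra_simps)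

lemma qop_uop: "qop ks (\<lambda>x ls. uop ls (H x)) x = uop ks (\<lambda>ls. qop ls H x)"
proof (induction ks arbitrary: H x)
  case (Cons k ks)
  show ?case
    by (simp add: qop_add qop_cmult uop_add uop_cmult Cons.IH[of "\<lambda>x ls. H x (l # ls)" for l])
      (simp add: algebra_simps)
qed simp

text \<open>Each term of \<open>bdry_sum\<close> drops one entry of \<open>ks\<close>. The factor of
  the dropped entry becomes \<open>Q(X, 1) = v + (1 - v) X\<close>; the other factors survive as
  \<open>qop\<close> on the shorter list.\<close>

lemma qop_bdry_sum:
  "ks \<noteq> [] \<Longrightarrow> qop ks (\<lambda>x ls. bdry_sum ls (H x)) x
     = v * bdry_sum ks (\<lambda>ls. qop ls H x) + (1 - v) * bdry_sum ks (\<lambda>ls. qop ls H (x + 1))"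
proof (induction ks arbitrary: H x)
  case (Cons k ks)
  show ?case
  proof (cases "ks = []")
    case True
    then show ?thesis by (simp add: w_def algebra_simps)
  next
    case False
    have *: "qop ks (\<lambda>x ls. bdry_sum (k # ls) (H x)) x = uop ks (\<lambda>ls. qop ls H x) -
       (v * qop ks (\<lambda>x ls. bdry_sum ls (\<lambda>ls. H x (k # ls))) x
        + (1 - v) * qop ks (\<lambda>x ls. bdry_sum ls (\<lambda>ls. H x ((k + 1) # ls))) x)" for x k
    proof -
      have "qop ks (\<lambda>x ls. bdry_sum (k # ls) (H x)) x = qop ks (\<lambda>x ls. uop ls (H x) -
         (v * bdry_sum ls (\<lambda>ls. H x (k # ls)) + (1 - v) * bdry_sum ls (\<lambda>ls. H x ((k + 1) # ls)))) x"
        by (intro qop_cong bdry_sum_Cons) (use False in auto)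
      then show ?thesis by (simp add: qop_diff qop_add qop_cmult qop_uop)
    qed
    show ?thesis
      using False
      by (simp add: * bdry_sum_Cons bdry_sum_add bdry_sum_cmult Cons.IH[of "\<lambda>x ls. H x (l # ls)" for l])
        (simp add: w_def algebra_simps)
  qed
qed simp

text \<open>In the term without a certain argument, its factors with later arguments turn into
  \<open>Q(1, Y)\<close>, which gives \<open>uop\<close>, and those with earlier ones into
  \<open>Q(X, 1)\<close>, which gives the weights \<open>v\<close> and \<open>1 - v\<close>. These
  are exactly the coefficients in \<open>bdry\<close>.\<close>

lemma mop_omit: "length ks = Suc n \<Longrightarrow> mop (Suc n) (\<lambda>ls. omit ls D) ks = bdry_sum ks (mop n D)"
proof (induction n arbitrary: ks D)
  case 0
  then obtain k where "ks = [k]" by (cases ks) auto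
  then show ?case by simp
next
  case (Suc n)
  then obtain k ks' where ks: "ks = k # ks'" "length ks' = Suc n" by (cases ks) auto
  then have "ks' \<noteq> []" by auto
  have "mop (Suc (Suc n)) (\<lambda>ls. omit ls D) ks =
      uop ks' (mop (Suc n) D) - qop ks' (\<lambda>x ls. mop (Suc n) (\<lambda>ls. omit ls (\<lambda>ms. D (x # ms))) ls) k"
    unfolding mop.simps(2)[of "Suc n"] ks list.sel omit.simps mop_diff qop_diff qop_const ..
  also have "qop ks' (\<lambda>x ls. mop (Suc n) (\<lambda>ls. omit ls (\<lambda>ms. D (x # ms))) ls) k
      = qop ks' (\<lambda>x ls. bdry_sum ls (mop n (\<lambda>ms. D (x # ms)))) k"
    by (rule qop_cong, rule Suc.IH) (simp add: ks)
  finally show ?case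
    using \<open>ks' \<noteq> []\<close> by (simp add: ks qop_bdry_sum bdry_sum_Cons)
qed

lemma row_sum_mop:
  assumes "alternating n D" "length ks = Suc n"
  shows "row_sum v u ks (mop n (all_diff n D)) = mop (Suc n) (\<lambda>ls. omit ls D) ks"
proof -
  have len: "length (tl ks) = n" using assms by simp
  have "part_sum u a (tl ks) (mop n (all_diff n D)) = bdry (tl ks) (mop n D) a" for a
  proof -
    have "part_sum u a (tl ks) (mop n (all_diff n D)) = part_sum u a (tl ks) (all_diff n (mop n D))"
      by (rule part_sum_cong) (use assms(2) in \<open>simp add: all_diff_mop\<close>)
    then show ?thesis
      using part_sum_all_diff[OF len qalternating_imp_qvanish[OF qalternating_mop[OF assms(1)]]] by simp
  qed
  then show ?thesis
    by (simp add: row_sum_def mop_omit[OF assms(2)] bdry_sum_def del: mop.simps)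
qed

end

section \<open>Determinants\<close>

text \<open>Rows belong to arguments and columns to functions, so expansion along the first row is a
  recursion on the list of arguments.\<close>

definition ldet :: "(nat \<Rightarrow> int \<Rightarrow> 'a::comm_ring_1) \<Rightarrow> int list \<Rightarrow> 'a" where
  "ldet \<phi> ks = det (mat (length ks) (length ks) (\<lambda>(i, j). \<phi> j (ks ! i)))"

abbreviation skip :: "nat \<Rightarrow> nat \<Rightarrow> nat" where
  "skip j i \<equiv> if i < j then i else Suc i"

lemma ldet_Nil [simp]: "ldet \<phi> [] = 1"
  by (simp add: ldet_def det_dim_zero)

lemma ldet_Cons:
  "ldet \<phi> (k # ks) = (\<Sum>j<Suc (length ks). (-1) ^ j * \<phi> j k * ldet (\<lambda>i. \<phi> (skip j i)) ks)"
proof -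
  let ?A = "mat (length (k # ks)) (length (k # ks)) (\<lambda>(i, j). \<phi> j ((k # ks) ! i))"
  have "ldet \<phi> (k # ks) = (\<Sum>j<length (k # ks). ?A $$ (0, j) * cofactor ?A 0 j)"
    unfolding ldet_def by (rule laplace_expansion_row) auto
  also have "\<dots> = (\<Sum>j<Suc (length ks). (-1) ^ j * \<phi> j k * ldet (\<lambda>i. \<phi> (skip j i)) ks)"
  proof (rule sum.cong)
    fix j assume j: "j \<in> {..<Suc (length ks)}"
    have "mat_delete ?A 0 j = mat (length ks) (length ks) (\<lambda>(i, i'). \<phi> (skip j i') (ks ! i))"
      using j by (intro eq_matI) (auto simp: mat_delete_def)
    with j show "?A $$ (0, j) * cofactor ?A 0 j = (-1) ^ j * \<phi> j k * ldet (\<lambda>i. \<phi> (skip j i)) ks"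
      by (simp add: cofactor_def ldet_def)
  qed simp
  finally show ?thesis .
qed

lemma ldet_swap: "ldet \<phi> (xs @ x # y # ys) = - ldet \<phi> (xs @ y # x # ys)"
proof -
  let ?n = "length xs + length ys + 2"
  let ?A = "mat ?n ?n (\<lambda>(i, j). \<phi> j ((xs @ x # y # ys) ! i))"
  have "det (swaprows (length xs) (Suc (length xs)) ?A) = - det ?A"
    by (rule det_swaprows[of _ ?n]) auto
  moreover have "swaprows (length xs) (Suc (length xs)) ?A
      = mat ?n ?n (\<lambda>(i, j). \<phi> j ((xs @ y # x # ys) ! i))"
    by (intro eq_matI) (auto simp: nth_append nth_Cons' split: if_splits)
  ultimately show ?thesis by (simp add: ldet_def)
qed

context weights
begin

lemma all_diff_sum: "all_diff n (\<lambda>ls. \<Sum>j\<in>A. c j * F j ls) ks = (\<Sum>j\<in>A. c j * all_diff n (F j) ks)"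
proof -
  have "all_diff n (\<lambda>ls. 0) ks = 0" using all_diff_cmult[of n 0 "\<lambda>_. 0" ks] by simp
  then show ?thesis
    by (induction A rule: infinite_finite_induct) (simp_all add: all_diff_add all_diff_cmult)
qed

lemma all_diff_cong: "(\<And>ls. length ls = n \<Longrightarrow> F ls = G ls) \<Longrightarrow> length ks = n \<Longrightarrow> all_diff n F ks = all_diff n G ks"
proof (induction n arbitrary: F G ks)
  case (Suc n)
  show ?case unfolding all_diff.simps by (rule Suc.IH) (use Suc.prems in auto)
qed simp

text \<open>Every argument occurs in one row only, so by multilinearity the differences can be taken
  entrywise.\<close>

lemma all_diff_ldet:
  "length ks = n \<Longrightarrow> all_diff n (ldet \<phi>) ks = ldet (\<lambda>j x. \<phi> j (x + 1) - \<phi> j x) ks"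
proof (induction n arbitrary: ks \<phi>)
  case (Suc n)
  then obtain k ks' where ks: "ks = k # ks'" "length ks' = n" by (cases ks) auto
  have "all_diff (Suc n) (ldet \<phi>) ks
      = all_diff n (\<lambda>ls. \<Sum>j<Suc n. (-1) ^ j * (\<phi> j (k + 1) - \<phi> j k) * ldet (\<lambda>i. \<phi> (skip j i)) ls) ks'"
    unfolding ks all_diff.simps list.sel
    by (rule all_diff_cong) (simp_all add: ldet_Cons ks left_diff_distrib right_diff_distrib sum_subtractf del: sum.lessThan_Suc)
  also have "\<dots> = (\<Sum>j<Suc n. (-1) ^ j * (\<phi> j (k + 1) - \<phi> j k)
      * ldet (\<lambda>i x. \<phi> (skip j i) (x + 1) - \<phi> (skip j i) x) ks')"
    unfolding all_diff_sum by (simp add: Suc.IH[OF ks(2)])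
  finally show ?case by (simp add: ldet_Cons ks)
qed simp

lemma omit_cong: "(\<And>ls. Suc (length ls) = length ks \<Longrightarrow> F ls = G ls) \<Longrightarrow> omit ks F = omit ks G"
proof (induction ks arbitrary: F G)
  case (Cons k ks)
  have "omit ks (\<lambda>ls. F (k # ls)) = omit ks (\<lambda>ls. G (k # ls))"
    by (rule Cons.IH) (simp add: Cons.prems)
  then show ?case by (simp add: Cons.prems)
qed simp

lemma omit_add: "omit ks (\<lambda>ls. F ls + G ls) = omit ks F + omit ks G"
  by (induction ks arbitrary: F G) (simp_all add: algebra_simps)

lemma omit_cmult: "omit ks (\<lambda>ls. c * F ls) = c * omit ks F"
  by (induction ks arbitrary: F) (simp_all add: algebra_simps)

lemma omit_sum: "omit ks (\<lambda>ls. \<Sum>j\<in>A. c j * F j ls) = (\<Sum>j\<in>A. c j * omit ks (F j))"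
proof -
  have "omit ks (\<lambda>ls. 0) = 0" using omit_cmult[of ks 0 "\<lambda>_. 0"] by simp
  then show ?thesis
    by (induction A rule: infinite_finite_induct) (simp_all add: omit_add omit_cmult)
qed

text \<open>This is the Laplace expansion along column 0, a column of ones. It is derived by
  induction from expansions along the first row, because \<open>omit\<close> recurses on the first
  argument: the term \<open>D ks\<close> is the summand for column 0, the remaining terms belong to
  the columns \<open>Suc j\<close>.\<close>

lemma omit_ldet:
  "ks \<noteq> [] \<Longrightarrow> (\<And>x. \<phi> 0 x = 1) \<Longrightarrow> omit ks (ldet (\<lambda>j. \<phi> (Suc j))) = ldet \<phi> ks"
proof (induction ks arbitrary: \<phi>)
  case (Cons k ks)
  show ?case
  proof (cases "ks = []")
    case True
    then show ?thesis using Cons.prems by (simp add: ldet_Cons)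
  next
    case False
    then obtain n where n: "length ks = Suc n" by (cases ks) auto
    have "omit ks (\<lambda>ls. ldet (\<lambda>j. \<phi> (Suc j)) (k # ls))
        = omit ks (\<lambda>ls. \<Sum>j<Suc n. (-1) ^ j * \<phi> (Suc j) k * ldet (\<lambda>i. \<phi> (Suc (skip j i))) ls)"
      by (rule omit_cong) (simp add: ldet_Cons n)
    also have "\<dots> = (\<Sum>j<Suc n. (-1) ^ j * \<phi> (Suc j) k * ldet (\<lambda>i. \<phi> (skip (Suc j) i)) ks)"
    proof -
      have "omit ks (ldet (\<lambda>i. \<phi> (Suc (skip j i)))) = ldet (\<lambda>i. \<phi> (skip (Suc j) i)) ks" for j
        using Cons.IH[of "\<lambda>i. \<phi> (skip (Suc j) i)"] False Cons.prems(2)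
        by (simp add: if_distrib[of Suc] if_distrib[of \<phi>] cong: if_cong)
      then show ?thesis by (simp add: omit_sum del: sum.lessThan_Suc)
    qed
    finally have "omit (k # ks) (ldet (\<lambda>j. \<phi> (Suc j))) = ldet (\<lambda>j. \<phi> (Suc j)) ks
        + (\<Sum>j<Suc n. (-1) ^ Suc j * \<phi> (Suc j) k * ldet (\<lambda>i. \<phi> (skip (Suc j) i)) ks)"
      by (simp add: sum_negf)
    also have "\<dots> = ldet \<phi> (k # ks)"
      unfolding ldet_Cons n sum.lessThan_Suc_shift[of _ "Suc n"] by (simp add: Cons.prems(2))
    finally show ?thesis .
  qed
qed simp

text \<open>Summation over a row thus replaces each column by an antiderivative and adds a column of
  ones in front. The constants of summation are arbitrary.\<close>

lemma row_sum_ldet: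
  assumes "\<And>x. \<phi> 0 x = 1" and "length ks = Suc n"
  shows "row_sum v u ks (mop n (ldet (\<lambda>j x. \<phi> (Suc j) (x + 1) - \<phi> (Suc j) x))) = mop (Suc n) (ldet \<phi>) ks"
proof -
  let ?D = "ldet (\<lambda>j. \<phi> (Suc j))"
  have len: "length (tl ks) = n" using assms by simp
  have "alternating n ?D"
    unfolding alternating_def using ldet_swap by blast
  from row_sum_mop[OF this assms(2)] have
    "row_sum v u ks (mop n (all_diff n ?D)) = mop (Suc n) (\<lambda>ls. omit ls ?D) ks" .
  moreover have "mop (Suc n) (\<lambda>ls. omit ls ?D) ks = mop (Suc n) (ldet \<phi>) ks"
    by (rule mop_cong) (use assms in \<open>auto intro!: omit_ldet\<close>)
  moreover have "row_sum v u ks (mop n (all_diff n ?D))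
      = row_sum v u ks (mop n (ldet (\<lambda>j x. \<phi> (Suc j) (x + 1) - \<phi> (Suc j) x)))"
  proof -
    have "mop n (all_diff n ?D) ls = mop n (ldet (\<lambda>j x. \<phi> (Suc j) (x + 1) - \<phi> (Suc j) x)) ls"
      if "length ls = n" for ls
      by (rule mop_cong) (use that all_diff_ldet in auto)
    then have "part_sum u a (tl ks) (mop n (all_diff n ?D))
        = part_sum u a (tl ks) (mop n (ldet (\<lambda>j x. \<phi> (Suc j) (x + 1) - \<phi> (Suc j) x)))" for a
      by (intro part_sum_cong) (simp add: len del: length_tl)
    then show ?thesis by (simp add: row_sum_def)
  qed
  ultimately show ?thesis by simp
qed

end

section \<open>The determinant of binomial coefficients as a product\<close>

lemma det_scale:
  fixes M :: "nat \<Rightarrow> nat \<Rightarrow> 'a::comm_ring_1"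
  shows "det (mat n n (\<lambda>(i, j). a i * b j * M i j)) = prod a {0..<n} * prod b {0..<n} * det (mat n n (\<lambda>(i, j). M i j))"
proof -
  let ?P = "{p. p permutes {0..<n}}"
  have perm: "(\<Prod>i = 0..<n. a i * b (p i) * M i (p i)) = prod a {0..<n} * prod b {0..<n} * (\<Prod>i = 0..<n. M i (p i))"
    if "p permutes {0..<n}" for p
    using prod.permute[OF that, of b] by (simp add: prod.distrib comp_def)
  have "det (mat n n (\<lambda>(i, j). a i * b j * M i j))
      = (\<Sum>p\<in>?P. signof p * (\<Prod>i = 0..<n. a i * b (p i) * M i (p i)))"
    by (subst det_def'[of _ n]) (auto intro!: sum.cong prod.cong simp: permutes_in_image)
  also have "\<dots> = (\<Sum>p\<in>?P. prod a {0..<n} * prod b {0..<n} * (signof p * (\<Prod>i = 0..<n. M i (p i))))"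
    by (rule sum.cong) (auto simp: perm)
  also have "\<dots> = prod a {0..<n} * prod b {0..<n} * (\<Sum>p\<in>?P. signof p * (\<Prod>i = 0..<n. M i (p i)))"
    by (simp only: sum_distrib_left)
  also have "(\<Sum>p\<in>?P. signof p * (\<Prod>i = 0..<n. M i (p i))) = det (mat n n (\<lambda>(i, j). M i j))"
    by (subst det_def'[of _ n]) (auto intro!: sum.cong prod.cong simp: permutes_in_image)
  finally show ?thesis .
qed

text \<open>Vandermonde's convolution: translating all arguments multiplies the matrix by an upper
  triangular matrix with ones on the diagonal.\<close>

lemma det_gbinomial_translate:
  fixes x :: "nat \<Rightarrow> 'a::field_char_0"
  shows "det (mat n n (\<lambda>(i, j). (x i + c) gchoose j)) = det (mat n n (\<lambda>(i, j). x i gchoose j))"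
proof -
  let ?A = "mat n n (\<lambda>(i, j). x i gchoose j)"
  let ?U = "mat n n (\<lambda>(i, j). if i \<le> j then c gchoose (j - i) else 0)"
  have "mat n n (\<lambda>(i, j). (x i + c) gchoose j) = ?A * ?U"
  proof (intro eq_matI)
    fix i j assume "i < dim_row (?A * ?U)" "j < dim_col (?A * ?U)"
    then have ij: "i < n" "j < n" by auto
    have "(?A * ?U) $$ (i, j) = (\<Sum>k = 0..<n. (x i gchoose k) * (if k \<le> j then c gchoose (j - k) else 0))"
      using ij by (simp add: scalar_prod_def)
    also have "\<dots> = (\<Sum>k = 0..j. (x i gchoose k) * (c gchoose (j - k)))"
      by (rule sum.mono_neutral_cong_right) (use ij in auto)
    finally show "mat n n (\<lambda>(i, j). (x i + c) gchoose j) $$ (i, j) = (?A * ?U) $$ (i, j)"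
      using ij by (simp add: gbinomial_Vandermonde)
  qed auto
  moreover have "det ?U = 1"
  proof -
    have "det ?U = prod_list (diag_mat ?U)"
      by (rule det_upper_triangular[of _ n]) auto
    also have "diag_mat ?U = replicate n 1"
      by (auto simp: diag_mat_def intro!: nth_equalityI)
    finally show ?thesis by simp
  qed
  ultimately show ?thesis
    by (simp add: det_mult[of _ n])
qed

lemma det_gbinomial:
  fixes x :: "nat \<Rightarrow> 'a::field_char_0"
  shows "det (mat n n (\<lambda>(i, j). x i gchoose j)) = (\<Prod>j<n. \<Prod>i<j. (x j - x i) / (of_nat j - of_nat i))"
proof (induction n arbitrary: x)
  case (Suc n)
  let ?y = "\<lambda>i. x (Suc i) - x 0"
  \<comment> \<open>The translation by \<open>- x 0\<close> makes the first row equal to (1, 0, ...,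
    0), so only one cofactor is left.\<close>
  let ?A = "mat (Suc n) (Suc n) (\<lambda>(i, j). (x i + (- x 0)) gchoose j)"
  have "det ?A = (\<Sum>j<Suc n. ?A $$ (0, j) * cofactor ?A 0 j)"
    by (rule laplace_expansion_row) auto
  also have "\<dots> = cofactor ?A 0 0"
    by (simp add: gbinomial_0_left sum.lessThan_Suc_shift del: sum.lessThan_Suc)
  also have "\<dots> = det (mat n n (\<lambda>(i, j). ?y i * (1 / of_nat (Suc j)) * ((?y i + (-1)) gchoose j)))"
  proof -
    \<comment> \<open>The absorption identity extracts a row factor and a column factor; the
      remaining matrix is of the original kind with arguments translated by -1.\<close>
    have "(c gchoose Suc j) = c * (1 / of_nat (Suc j)) * ((c + (-1)) gchoose j)" for j and c :: 'a
      using gbinomial_absorption[of j c] by (simp add: field_simps del: of_nat_Suc)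
    then have "mat_delete ?A 0 0 = mat n n (\<lambda>(i, j). ?y i * (1 / of_nat (Suc j)) * ((?y i + (-1)) gchoose j))"
      by (intro eq_matI) (auto simp: mat_delete_def simp del: of_nat_Suc)
    then show ?thesis by (simp add: cofactor_def)
  qed
  also have "\<dots> = prod ?y {0..<n} * (\<Prod>j = 0..<n. 1 / of_nat (Suc j)) * det (mat n n (\<lambda>(i, j). (?y i + (-1)) gchoose j))"
    by (rule det_scale)
  also have "\<dots> = prod ?y {0..<n} * (\<Prod>j = 0..<n. 1 / of_nat (Suc j)) * (\<Prod>j<n. \<Prod>i<j. (?y j - ?y i) / (of_nat j - of_nat i))"
    unfolding det_gbinomial_translate Suc.IH ..
  also have "\<dots> = (\<Prod>j<n. ?y j / of_nat (Suc j) * (\<Prod>i<j. (x (Suc j) - x (Suc i)) / (of_nat (Suc j) - of_nat (Suc i))))"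
    by (simp add: lessThan_atLeast0 prod.distrib divide_inverse)
  also have "\<dots> = (\<Prod>j<Suc n. \<Prod>i<j. (x j - x i) / (of_nat j - of_nat i))"
    by (simp add: prod.lessThan_Suc_shift del: prod.lessThan_Suc of_nat_Suc)
  finally show ?case
    using det_gbinomial_translate[of "Suc n" x "- x 0"] by simp
qed simp

section \<open>Operators on functions on the integer lattice\<close>

lemma op_prod_foldr: "op_prod F is f = foldr F is f"
  unfolding op_prod_def by (induction "is") simp_all

type_synonym 'a zfun = "(nat \<Rightarrow> int) \<Rightarrow> 'a"

text \<open>The theorem evaluates at integers and every operator shifts by integers, so nothing is
  lost by restricting functions to integer points.\<close>

definition on_lattice :: "'a::field_char_0 polyfun \<Rightarrow> 'a zfun" where
  "on_lattice f = (\<lambda>x. f (\<lambda>i. of_int (x i)))"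

definition zdiff :: "nat \<Rightarrow> 'a::field_char_0 zfun \<Rightarrow> 'a zfun" where
  "zdiff i F = (\<lambda>x. F (x(i := x i + 1)) - F x)"

definition zbdiff :: "nat \<Rightarrow> 'a::field_char_0 zfun \<Rightarrow> 'a zfun" where
  "zbdiff i F = (\<lambda>x. F x - F (x(i := x i - 1)))"

text \<open>The operator \<open>(1 - c D)\<^sup>-\<^sup>1\<close>. It covers all four series:
  \<open>finv_v\<close> and \<open>binv_u\<close> directly, \<open>fdiff_v\<close> and
  \<open>bdiff_u\<close> after one additional difference.\<close>

definition neumann :: "('a::field_char_0 zfun \<Rightarrow> 'a zfun) \<Rightarrow> 'a \<Rightarrow> 'a zfun \<Rightarrow> 'a zfun" where
  "neumann D c F = (\<lambda>x. Sum_any (\<lambda>k. c ^ k * (D ^^ k) F x))"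

definition zstrict :: "'a::field_char_0 \<Rightarrow> 'a \<Rightarrow> nat \<Rightarrow> nat \<Rightarrow> 'a zfun \<Rightarrow> 'a zfun" where
  "zstrict u v i j F = (\<lambda>x. u * F (x(j := x j + 1)) + v * F (x(i := x i - 1))
     + (1 - u - v) * F (x(i := x i - 1, j := (x(i := x i - 1)) j + 1)))"

lemma of_int_upd: "(\<lambda>k. of_int ((x(i := a)) k)) = (\<lambda>k. of_int (x k))(i := of_int a)"
  by auto

lemma of_int_upd_at: "(of_int ((x(i := a)) j) :: 'a::ring_1) = ((\<lambda>k. of_int (x k))(i := of_int a)) j"
  by auto

lemma on_lattice_fdiff: "on_lattice (fdiff_op i f) = zdiff i (on_lattice f)"
  by (simp add: on_lattice_def fdiff_op_def zdiff_def shift_op_def of_int_upd del: fun_upd_apply)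

lemma on_lattice_bdiff: "on_lattice (bdiff_op i f) = zbdiff i (on_lattice f)"
  by (simp add: on_lattice_def bdiff_op_def zbdiff_def shift_inv_op_def of_int_upd del: fun_upd_apply)

lemma on_lattice_strict:
  "on_lattice (strict_op u v i j f) = zstrict u v i j (on_lattice f)"
  by (simp add: on_lattice_def strict_op_def zstrict_def shift_op_def shift_inv_op_def of_int_upd
      of_int_upd_at del: fun_upd_apply)

lemma on_lattice_funpow:
  fixes T :: "'a::field_char_0 polyfun \<Rightarrow> 'a polyfun"
  assumes "\<And>f. on_lattice (T f) = Z (on_lattice f)"
  shows "on_lattice ((T ^^ k) f) = (Z ^^ k) (on_lattice f)"
  by (induction k) (simp_all add: assms)

lemma on_lattice_foldr:
  fixes T :: "'i \<Rightarrow> 'a::field_char_0 polyfun \<Rightarrow> 'a polyfun"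
  assumes "\<And>i f. on_lattice (T i f) = Z i (on_lattice f)"
  shows "on_lattice (foldr T is f) = foldr Z is (on_lattice f)"
  by (induction "is") (simp_all add: assms)

lemma on_lattice_finv:
  "on_lattice (finv_v v i f) = neumann (zdiff i) (v - 1) (on_lattice f)"
  using on_lattice_funpow[of "fdiff_op i" "zdiff i", OF on_lattice_fdiff, of _ f]
  by (simp add: neumann_def finv_v_def fun_eq_iff) (simp add: on_lattice_def)

lemma on_lattice_binv:
  "on_lattice (binv_u u i f) = neumann (zbdiff i) (1 - u) (on_lattice f)"
  using on_lattice_funpow[of "bdiff_op i" "zbdiff i", OF on_lattice_bdiff, of _ f]
  by (simp add: neumann_def binv_u_def fun_eq_iff) (simp add: on_lattice_def)

lemma fdiff_v_eq: "fdiff_v v i f = finv_v v i (fdiff_op i f)"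
  by (simp add: fdiff_v_def finv_v_def funpow_swap1)

lemma bdiff_u_eq: "bdiff_u u i f = binv_u u i (bdiff_op i f)"
  by (simp add: bdiff_u_def binv_u_def funpow_swap1)

definition front_cut :: "'a::field_char_0 \<Rightarrow> nat \<Rightarrow> 'a zfun \<Rightarrow> 'a zfun" where
  "front_cut v i F = (\<lambda>x. - neumann (zdiff i) (v - 1) (zdiff i F) x)"

definition back_cut :: "'a::field_char_0 \<Rightarrow> nat \<Rightarrow> 'a zfun \<Rightarrow> 'a zfun" where
  "back_cut u i F = neumann (zbdiff i) (1 - u) (zbdiff i F)"

lemma on_lattice_fcut:
  "on_lattice (\<lambda>x. - fdiff_v v i f x) = front_cut v i (on_lattice f)"
  by (simp add: front_cut_def fdiff_v_eq flip: on_lattice_finv on_lattice_fdiff)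
    (simp add: on_lattice_def)

lemma on_lattice_bcut:
  "on_lattice (bdiff_u u i f) = back_cut u i (on_lattice f)"
  by (simp add: back_cut_def bdiff_u_eq on_lattice_binv on_lattice_bdiff)

definition ltrunc :: "'a::field_char_0 \<Rightarrow> 'a \<Rightarrow> nat \<Rightarrow> nat \<Rightarrow> nat \<Rightarrow>
    (nat \<Rightarrow> nat) \<Rightarrow> (nat \<Rightarrow> nat) \<Rightarrow> 'a zfun \<Rightarrow> 'a zfun" where
  "ltrunc u v n l r s t F =
     foldr (\<lambda>i. front_cut v i ^^ s i) [1..<l+1] (foldr (\<lambda>k. back_cut u k ^^ t k) [n-r+1..<n+1] F)"

definition lcorr :: "'a::field_char_0 \<Rightarrow> 'a \<Rightarrow> nat set \<Rightarrow> nat set \<Rightarrow> 'a zfun \<Rightarrow> 'a zfun" where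
  "lcorr u v I J F = foldr (\<lambda>i. neumann (zdiff i) (v - 1)) (sorted_list_of_set I)
     (foldr (\<lambda>k. neumann (zbdiff k) (1 - u)) (sorted_list_of_set J) F)"

lemma on_lattice_truncation:
  "on_lattice (truncation_op u v n l r s t f) = ltrunc u v n l r s t (on_lattice f)"
proof -
  have 1: "on_lattice (((\<lambda>f x. - fdiff_v v i f x) ^^ s i) g) = (front_cut v i ^^ s i) (on_lattice g)" for i g
    by (rule on_lattice_funpow, rule on_lattice_fcut)
  have 2: "on_lattice ((bdiff_u u i ^^ t i) g) = (back_cut u i ^^ t i) (on_lattice g)" for i g
    by (rule on_lattice_funpow, rule on_lattice_bcut)
  show ?thesis
    unfolding truncation_op_def ltrunc_def comp_def op_prod_foldr
    by (subst on_lattice_foldr[of "\<lambda>i. (\<lambda>f x. - fdiff_v v i f x) ^^ s i", OF 1],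
        subst on_lattice_foldr[of "\<lambda>k. bdiff_u u k ^^ t k", OF 2]) simp
qed

lemma on_lattice_correction:
  "on_lattice (correction_op u v I J f) = lcorr u v I J (on_lattice f)"
  unfolding correction_op_def lcorr_def comp_def op_prod_foldr
  by (simp add: on_lattice_foldr[where T="finv_v v" and Z="\<lambda>i. neumann (zdiff i) (v - 1)", OF on_lattice_finv] on_lattice_foldr[where T="binv_u u" and Z="\<lambda>i. neumann (zbdiff i) (1 - u)", OF on_lattice_binv])

lemma on_lattice_strict_all:
  "on_lattice (strict_all u v n f)
     = foldr (\<lambda>p. foldr (\<lambda>q. zstrict u v q p) [p+1..<n+1]) [1..<n+1] (on_lattice f)"
proof -
  have 1: "on_lattice (op_prod (\<lambda>q. strict_op u v q p) [p+1..<n+1] g)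
      = foldr (\<lambda>q. zstrict u v q p) [p+1..<n+1] (on_lattice g)" for p g
    unfolding op_prod_foldr by (rule on_lattice_foldr, rule on_lattice_strict)
  show ?thesis
    unfolding strict_all_def op_prod_foldr[of _ "[1..<n+1]"]
    by (rule on_lattice_foldr[where T="\<lambda>p. op_prod (\<lambda>q. strict_op u v q p) [p+1..<n+1]"], rule 1)
qed

section \<open>Polynomial functions on the integer lattice\<close>

definition znil :: "nat \<Rightarrow> nat \<Rightarrow> 'a::field_char_0 zfun \<Rightarrow> bool" where
  "znil i N F \<longleftrightarrow> (zdiff i ^^ N) F = (\<lambda>x. 0)"

text \<open>The trace of polynomiality that is kept: in each variable separately the differences are
  nilpotent. This makes the Neumann series finite and is preserved by all operators
  involved.\<close>

definition zpoly :: "'a::field_char_0 zfun \<Rightarrow> bool" where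
  "zpoly F \<longleftrightarrow> (\<forall>i. \<exists>N. znil i N F)"

definition zlinear :: "('a::field_char_0 zfun \<Rightarrow> 'a zfun) \<Rightarrow> bool" where
  "zlinear T \<longleftrightarrow> (\<forall>F G. T (\<lambda>x. F x + G x) = (\<lambda>x. T F x + T G x)) \<and>
     (\<forall>c F. T (\<lambda>x. c * F x) = (\<lambda>x. c * T F x))"

lemma zlinear_add: "zlinear T \<Longrightarrow> T (\<lambda>x. F x + G x) = (\<lambda>x. T F x + T G x)"
  and zlinear_cmult: "zlinear T \<Longrightarrow> T (\<lambda>x. c * F x) = (\<lambda>x. c * T F x)"
  by (simp_all add: zlinear_def)

lemma zlinear_zero: "zlinear T \<Longrightarrow> T (\<lambda>x. 0) = (\<lambda>x. 0)"
  using zlinear_cmult[of T 0] by simp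

lemma zlinear_diff: "zlinear T \<Longrightarrow> T (\<lambda>x. F x - G x) = (\<lambda>x. T F x - T G x)"
  using zlinear_add[of T F "\<lambda>x. - 1 * G x"] zlinear_cmult[of T "- 1" G] by simp

lemma zlinear_sum:
  assumes "zlinear T"
  shows "T (\<lambda>x. \<Sum>k\<in>A. c k * F k x) = (\<lambda>x. \<Sum>k\<in>A. c k * T (F k) x)"
proof (induction A rule: infinite_finite_induct)
  case (insert k A)
  then show ?case
    by (simp add: zlinear_add[OF assms, of "\<lambda>x. c k * F k x"] zlinear_cmult[OF assms])
qed (simp_all add: zlinear_zero[OF assms])

lemma zlinear_funpow: "zlinear T \<Longrightarrow> zlinear (T ^^ k)"
  by (induction k) (simp_all add: zlinear_def)

lemma zlinear_zdiff: "zlinear (zdiff i)"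
  by (simp add: zlinear_def zdiff_def algebra_simps)

lemma zlinear_zbdiff: "zlinear (zbdiff i)"
  by (simp add: zlinear_def zbdiff_def algebra_simps)

definition zshift :: "nat \<Rightarrow> int \<Rightarrow> 'a zfun \<Rightarrow> 'a zfun" where
  "zshift i c F = (\<lambda>x. F (x(i := x i + c)))"

lemma zlinear_zshift: "zlinear (zshift i c)"
  by (simp add: zlinear_def zshift_def)

lemma zshift_commute: "zshift i c (zshift j d F) = zshift j d (zshift i c F)"
  by (cases "i = j") (simp_all add: zshift_def fun_upd_twist algebra_simps)

lemma zdiff_zshift: "zdiff i F = (\<lambda>x. zshift i 1 F x - F x)"
  by (simp add: zdiff_def zshift_def)

lemma zbdiff_zshift: "zbdiff i F = (\<lambda>x. F x - zshift i (- 1) F x)"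
  by (simp add: zbdiff_def zshift_def)

lemma zdiff_zshift_commute: "zdiff i (zshift j c F) = zshift j c (zdiff i F)"
  unfolding zdiff_zshift zshift_commute[of i 1 j] by (simp add: zshift_def)

lemma zdiff_zdiff_commute: "zdiff i (zdiff j F) = zdiff j (zdiff i F)"
  unfolding zdiff_zshift[of j] zlinear_diff[OF zlinear_zdiff] zdiff_zshift_commute ..

lemma zdiff_zbdiff_commute: "zdiff i (zbdiff j F) = zbdiff j (zdiff i F)"
  unfolding zbdiff_zshift[of j] zlinear_diff[OF zlinear_zdiff] zdiff_zshift_commute ..

lemma funpow_commute:
  fixes D :: "'a \<Rightarrow> 'a" and D' :: "'b \<Rightarrow> 'b"
  shows "(\<And>F. T (D F) = D' (T F)) \<Longrightarrow> T ((D ^^ k) F) = (D' ^^ k) (T F)"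
  by (induction k) simp_all

lemma znil_0 [simp]: "znil i 0 F \<longleftrightarrow> F = (\<lambda>x. 0)"
  by (simp add: znil_def)

lemma znil_Suc: "znil i (Suc N) F \<longleftrightarrow> znil i N (zdiff i F)"
  by (simp add: znil_def funpow_Suc_right del: funpow.simps)

lemma znil_image:
  assumes "znil i N F" "zlinear T" "\<And>G. T (zdiff i G) = zdiff j (T G)"
  shows "znil j N (T F)"
proof -
  have "(zdiff j ^^ N) (T F) = T ((zdiff i ^^ N) F)"
    by (simp add: funpow_commute[of T "zdiff i" "zdiff j"] assms(3))
  then show ?thesis using assms(1,2) by (simp add: znil_def zlinear_zero)
qed

lemma znil_mono: "znil i N F \<Longrightarrow> N \<le> M \<Longrightarrow> znil i M F"
proof -
  assume a: "znil i N F" "N \<le> M"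
  then have "(zdiff i ^^ M) F = (zdiff i ^^ (M - N)) ((zdiff i ^^ N) F)"
    by (metis add.commute comp_apply funpow_add le_add_diff_inverse)
  then show ?thesis
    using a by (simp add: znil_def zlinear_zero[OF zlinear_funpow[OF zlinear_zdiff]])
qed

lemma znil_add: "znil i N F \<Longrightarrow> znil i M G \<Longrightarrow> znil i (max N M) (\<lambda>x. F x + G x)"
proof -
  assume "znil i N F" "znil i M G"
  then have "znil i (max N M) F" "znil i (max N M) G"
    by (auto intro: znil_mono)
  then show ?thesis
    by (simp add: znil_def zlinear_add[OF zlinear_funpow[OF zlinear_zdiff]])
qed

lemma znil_cmult: "znil i N F \<Longrightarrow> znil i N (\<lambda>x. c * F x)"
  by (simp add: znil_def zlinear_cmult[OF zlinear_funpow[OF zlinear_zdiff]])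

lemma znil_zshift: "znil i N F \<Longrightarrow> znil i N (zshift j c F)"
  by (rule znil_image[OF _ zlinear_zshift]) (simp_all add: zdiff_zshift_commute)

text \<open>By the Leibniz rule for differences, one difference lowers the order of one of the two
  factors, hence the induction on \<open>a + b\<close>.\<close>

lemma znil_mult: "znil i a F \<Longrightarrow> znil i b G \<Longrightarrow> znil i (a + b) (\<lambda>x. F x * G x)"
proof (induction "a + b" arbitrary: a b F G)
  case (Suc n)
  show ?case
  proof (cases "a = 0 \<or> b = 0")
    case True
    then have "(\<lambda>x. F x * G x) = (\<lambda>x. 0)" using Suc.prems by auto
    then have "znil i 0 (\<lambda>x. F x * G x)" by simp
    then show ?thesis by (rule znil_mono) simp
  next
    case False
    then obtain a' b' where ab: "a = Suc a'" "b = Suc b'" by (metis not0_implies_Suc)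
    have "zdiff i (\<lambda>x. F x * G x) = (\<lambda>x. zdiff i F x * zshift i 1 G x + F x * zdiff i G x)"
      by (simp add: zdiff_def zshift_def algebra_simps)
    moreover have "znil i (a' + b) (\<lambda>x. zdiff i F x * zshift i 1 G x)"
      by (rule Suc.hyps) (use Suc ab in \<open>auto simp: znil_Suc zdiff_zshift_commute intro!: znil_zshift\<close>)
    moreover have "znil i (a + b') (\<lambda>x. F x * zdiff i G x)"
      by (rule Suc.hyps) (use Suc ab in \<open>auto simp: znil_Suc\<close>)
    ultimately have "znil i (max (a' + b) (a + b')) (zdiff i (\<lambda>x. F x * G x))"
      by (simp add: znil_add)
    then show ?thesis
      using ab by (simp add: znil_Suc)
  qed
qed auto

lemma zpoly_image:
  assumes "zpoly F" "zlinear T" "\<And>i G. T (zdiff i G) = zdiff i (T G)"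
  shows "zpoly (T F)"
  using assms unfolding zpoly_def by (meson znil_image)

lemma zpoly_const: "zpoly (\<lambda>x. c)"
proof -
  have "znil i (Suc 0) (\<lambda>x. c)" for i by (simp add: znil_Suc zdiff_def)
  then show ?thesis unfolding zpoly_def by blast
qed

lemma zpoly_add: "zpoly F \<Longrightarrow> zpoly G \<Longrightarrow> zpoly (\<lambda>x. F x + G x)"
  unfolding zpoly_def using znil_add by fast

lemma zpoly_cmult: "zpoly F \<Longrightarrow> zpoly (\<lambda>x. c * F x)"
  unfolding zpoly_def using znil_cmult by fast

lemma zpoly_mult: "zpoly F \<Longrightarrow> zpoly G \<Longrightarrow> zpoly (\<lambda>x. F x * G x)"
  unfolding zpoly_def using znil_mult by fast

lemma zpoly_sum: "(\<And>k. k \<in> A \<Longrightarrow> zpoly (F k)) \<Longrightarrow> zpoly (\<lambda>x. \<Sum>k\<in>A. F k x)"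
  by (induction A rule: infinite_finite_induct) (simp_all add: zpoly_const zpoly_add)

lemma zpoly_prod: "(\<And>k. k \<in> A \<Longrightarrow> zpoly (F k)) \<Longrightarrow> zpoly (\<lambda>x. \<Prod>k\<in>A. F k x)"
  by (induction A rule: infinite_finite_induct) (simp_all add: zpoly_const zpoly_mult)

lemma zpoly_zshift: "zpoly F \<Longrightarrow> zpoly (zshift i c F)"
  by (rule zpoly_image[OF _ zlinear_zshift]) (simp_all add: zdiff_zshift_commute)

lemma zpoly_zdiff: "zpoly F \<Longrightarrow> zpoly (zdiff i F)"
  by (rule zpoly_image[OF _ zlinear_zdiff]) (auto intro: zdiff_zdiff_commute)

lemma zpoly_zbdiff: "zpoly F \<Longrightarrow> zpoly (zbdiff i F)"
  by (rule zpoly_image[OF _ zlinear_zbdiff]) (auto intro: zdiff_zbdiff_commute[symmetric])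

lemma zpoly_funpow:
  fixes T :: "'a::field_char_0 zfun \<Rightarrow> 'a zfun"
  shows "zpoly F \<Longrightarrow> (\<And>G. zpoly G \<Longrightarrow> zpoly (T G)) \<Longrightarrow> zpoly ((T ^^ k) F)"
  by (induction k) simp_all

lemma zpoly_foldr: "zpoly F \<Longrightarrow> (\<And>i G. zpoly G \<Longrightarrow> zpoly (T i G)) \<Longrightarrow> zpoly (foldr T is F)"
  by (induction "is") simp_all

lemma zpoly_zstrict: "zpoly F \<Longrightarrow> zpoly (zstrict u v i j F)"
proof -
  assume "zpoly F"
  moreover have "zstrict u v i j F = (\<lambda>x. u * zshift j 1 F x + v * zshift i (- 1) F x
      + (1 - u - v) * zshift i (- 1) (zshift j 1 F) x)"
    by (simp add: zstrict_def zshift_def)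
  ultimately show ?thesis
    by (simp add: zpoly_add zpoly_cmult zpoly_zshift)
qed

lemma zpoly_gbinomial: "zpoly (\<lambda>x. (of_int (x i + c) :: 'a::field_char_0) gchoose m)"
proof -
  have "znil j (Suc m) (\<lambda>x. (of_int (x i + c) :: 'a) gchoose m)" for j
  proof (cases "j = i")
    case True
    show ?thesis unfolding True
    proof (induction m)
      case 0
      show ?case by (simp add: znil_Suc zdiff_def)
    next
      case (Suc m)
      have "zdiff i (\<lambda>x. (of_int (x i + c) :: 'a) gchoose Suc m) = (\<lambda>x. (of_int (x i + c) :: 'a) gchoose m)"
        using gbinomial_Suc_Suc[of "of_int (x i + c) :: 'a" m for x]
        by (auto simp: zdiff_def fun_eq_iff algebra_simps)
      then show ?case using Suc.IH by (simp add: znil_Suc[of _ "Suc m"])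
    qed
  next
    case False
    then have "znil j (Suc 0) (\<lambda>x. (of_int (x i + c) :: 'a) gchoose m)"
      by (simp add: znil_Suc zdiff_def)
    then show ?thesis by (rule znil_mono) simp
  qed
  then show ?thesis unfolding zpoly_def by blast
qed

section \<open>Inverses of operators as finite Neumann series\<close>

lemma neumann_eq_sum:
  assumes "zlinear D" "(D ^^ N) F = (\<lambda>x. 0)"
  shows "neumann D c F = (\<lambda>x. \<Sum>k<N. c ^ k * (D ^^ k) F x)"
proof
  fix x
  have "(D ^^ k) F = (\<lambda>x. 0)" if "k \<ge> N" for k
  proof -
    have "(D ^^ k) F = (D ^^ (k - N)) ((D ^^ N) F)"
      using that by (metis add.commute comp_apply funpow_add le_add_diff_inverse)
    then show ?thesis using assms by (simp add: zlinear_zero[OF zlinear_funpow])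
  qed
  then have "c ^ k * (D ^^ k) F x = 0" if "\<not> k < N" for k
    using that by (simp add: not_less)
  then have "{k. c ^ k * (D ^^ k) F x \<noteq> 0} \<subseteq> {..<N}"
    by blast
  then show "neumann D c F x = (\<Sum>k<N. c ^ k * (D ^^ k) F x)"
    unfolding neumann_def by (rule Sum_any.expand_superset[OF finite_lessThan])
qed

text \<open>The way in which inverses are computed below: guess the result \<open>H\<close>, verify
  \<open>(1 - c D) H = G\<close>, and let the series telescope.\<close>

lemma neumann_eqI:
  assumes "zlinear D" "(D ^^ N) H = (\<lambda>x. 0)" "G = (\<lambda>x. H x - c * D H x)"
  shows "neumann D c G = H"
proof -
  have D: "(D ^^ k) G = (\<lambda>x. (D ^^ k) H x - c * (D ^^ Suc k) H x)" for k
    using assms(1) unfolding assms(3) funpow_Suc_right comp_def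
    by (simp add: zlinear_diff[OF zlinear_funpow] zlinear_cmult[OF zlinear_funpow])
  have "(D ^^ N) G = (\<lambda>x. 0)"
    unfolding D using assms(2) by (simp add: zlinear_zero[OF assms(1)])
  then have "neumann D c G = (\<lambda>x. \<Sum>k<N. c ^ k * (D ^^ k) H x - c ^ Suc k * (D ^^ Suc k) H x)"
    by (simp add: neumann_eq_sum[OF assms(1)] D algebra_simps)
  also have "\<dots> = H"
  proof
    fix x
    show "(\<Sum>k<N. c ^ k * (D ^^ k) H x - c ^ Suc k * (D ^^ Suc k) H x) = H x"
      using sum_lessThan_telescope'[of "\<lambda>k. c ^ k * (D ^^ k) H x" N] assms(2) by simp
  qed
  finally show ?thesis .
qed

text \<open>An operator that intertwines \<open>D\<close> and \<open>D'\<close> also intertwines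
  their Neumann series. This moves the inverses past summations in which their variable is only a
  parameter.\<close>

lemma neumann_image:
  assumes "zlinear D" "zlinear D'" "zlinear T" "(D ^^ N) F = (\<lambda>x. 0)" "\<And>G. T (D G) = D' (T G)"
  shows "T (neumann D c F) = neumann D' c (T F)"
proof -
  have T: "T ((D ^^ k) G) = (D' ^^ k) (T G)" for k G
    by (rule funpow_commute[of T D D', OF assms(5)])
  have "(D' ^^ N) (T F) = (\<lambda>x. 0)"
    using assms(3,4) by (simp add: zlinear_zero flip: T)
  then show ?thesis
    using assms by (simp add: neumann_eq_sum zlinear_sum[OF assms(3), of "\<lambda>k. c ^ k"] T)
qed

text \<open>A backward difference is a shifted forward difference, so both are nilpotent of the same
  order.\<close>

lemma znil_zbdiff: "znil i N F \<Longrightarrow> (zbdiff i ^^ N) F = (\<lambda>x. 0)"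
proof (induction N arbitrary: F)
  case (Suc N)
  have "zbdiff i F = zshift i (- 1) (zdiff i F)"
    by (simp add: zbdiff_def zshift_def zdiff_def)
  then have "znil i N (zbdiff i F)"
    using Suc.prems by (simp add: znil_Suc znil_zshift)
  from Suc.IH[OF this] show ?case by (simp add: funpow_Suc_right del: funpow.simps)
qed simp

lemma zpoly_neumann:
  assumes "zlinear D" "\<And>G. zpoly G \<Longrightarrow> zpoly (D G)" "(D ^^ N) F = (\<lambda>x. 0)" "zpoly F"
  shows "zpoly (neumann D c F)"
  unfolding neumann_eq_sum[OF assms(1,3)]
  by (intro zpoly_sum zpoly_cmult zpoly_funpow assms)

lemma zpoly_finv: "zpoly F \<Longrightarrow> zpoly (neumann (zdiff i) c F)"
  by (metis zpoly_neumann zlinear_zdiff zpoly_zdiff zpoly_def znil_def)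

lemma zpoly_binv: "zpoly F \<Longrightarrow> zpoly (neumann (zbdiff i) c F)"
  by (metis zpoly_neumann zlinear_zbdiff zpoly_zbdiff zpoly_def znil_zbdiff)

lemma zpoly_fcut: "zpoly F \<Longrightarrow> zpoly (front_cut v i F)"
  using zpoly_cmult[of "neumann (zdiff i) (v - 1) (zdiff i F)" "- 1"]
  by (simp add: front_cut_def zpoly_finv zpoly_zdiff)

lemma zpoly_bcut: "zpoly F \<Longrightarrow> zpoly (back_cut u i F)"
  by (simp add: back_cut_def zpoly_binv zpoly_zbdiff)

lemma zpoly_ltrunc: "zpoly F \<Longrightarrow> zpoly (ltrunc u v n l r s t F)"
  unfolding ltrunc_def by (intro zpoly_foldr zpoly_funpow zpoly_fcut zpoly_bcut)

lemma neumann_commute: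
  fixes F :: "'a::field_char_0 zfun"
  assumes "zpoly F"
  shows "neumann (zdiff i) c (neumann (zdiff j) d F) = neumann (zdiff j) d (neumann (zdiff i) c F)"
proof -
  obtain N M where N: "(zdiff j ^^ N) F = (\<lambda>x. 0)" and M: "(zdiff i ^^ M) F = (\<lambda>x. 0)"
    using assms unfolding zpoly_def znil_def by blast
  let ?T = "\<lambda>F x. \<Sum>k<N. d ^ k * (zdiff j ^^ k) F x"
  have T: "zlinear ?T"
    unfolding zlinear_def
    by (simp add: zlinear_add[OF zlinear_funpow[OF zlinear_zdiff]] zlinear_cmult[OF zlinear_funpow[OF zlinear_zdiff]]
        algebra_simps sum.distrib sum_distrib_left)
  have c: "(zdiff j ^^ k) (zdiff i G) = zdiff i ((zdiff j ^^ k) G)" for k and G :: "'a zfun"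
    by (rule funpow_commute[where T="zdiff i" and D="zdiff j" and D'="zdiff j", symmetric])
      (rule zdiff_zdiff_commute)
  have "neumann (zdiff i) c (neumann (zdiff j) d F) = neumann (zdiff i) c (?T F)"
    by (simp add: neumann_eq_sum[OF zlinear_zdiff N])
  also have "\<dots> = ?T (neumann (zdiff i) c F)"
    by (rule neumann_image[OF zlinear_zdiff zlinear_zdiff T M, symmetric])
      (simp add: c zlinear_sum[OF zlinear_zdiff])
  also have "\<dots> = neumann (zdiff j) d (neumann (zdiff i) c F)"
  proof -
    have "(zdiff j ^^ N) (neumann (zdiff i) c F) = neumann (zdiff i) c ((zdiff j ^^ N) F)"
      by (rule neumann_image[OF zlinear_zdiff zlinear_zdiff zlinear_funpow[OF zlinear_zdiff] M]) (rule c)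
    also have "\<dots> = (\<lambda>x. 0)"
      by (simp add: N neumann_eq_sum[OF zlinear_zdiff, of 0])
    finally show ?thesis by (simp add: neumann_eq_sum[OF zlinear_zdiff])
  qed
  finally show ?thesis .
qed

lemma zdiff_finv_commute: "zpoly F \<Longrightarrow> zdiff j (neumann (zdiff i) c F) = neumann (zdiff i) c (zdiff j F)"
  unfolding zpoly_def znil_def
  by (metis neumann_image[OF zlinear_zdiff zlinear_zdiff zlinear_zdiff _ zdiff_zdiff_commute])

lemma neumann_uminus:
  assumes "zpoly F"
  shows "neumann (zdiff i) c (\<lambda>x. - F x) = (\<lambda>x. - neumann (zdiff i) c F x)"
proof -
  obtain N where N: "(zdiff i ^^ N) F = (\<lambda>x. 0)"
    using assms unfolding zpoly_def znil_def by blast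
  have z: "zlinear (\<lambda>F x. - F x :: 'a)" for F :: "'a zfun"
    by (simp add: zlinear_def)
  show ?thesis
    by (rule neumann_image[OF zlinear_zdiff zlinear_zdiff z N, symmetric]) (simp add: zdiff_def)
qed

lemma front_cut_commute: "zpoly F \<Longrightarrow> front_cut v i (front_cut v j F) = front_cut v j (front_cut v i F)"
proof -
  assume F: "zpoly F"
  have m: "zdiff i (\<lambda>x. - G x) = (\<lambda>x. - zdiff i G x)" for i and G :: "'a zfun"
    by (simp add: zdiff_def)
  show ?thesis unfolding front_cut_def
    by (simp add: m neumann_uminus zdiff_finv_commute zpoly_finv zpoly_zdiff F neumann_commute
        zdiff_zdiff_commute[of j i])
qed

section \<open>The polynomials as products of shift operators\<close>

declare upt_Suc [simp del]

text \<open>With \<open>c = 0\<close> the variable of index \<open>i\<close> becomes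
  \<open>x i + i - 1\<close>. In these arguments \<open>GT_poly\<close> is an alternating
  determinant.\<close>

primrec add_stair :: "int \<Rightarrow> int list \<Rightarrow> int list" where
  "add_stair c [] = []"
| "add_stair c (k # ks) = (k + c) # add_stair (c + 1) ks"

lemma length_add_stair [simp]: "length (add_stair c ks) = length ks"
  by (induction ks arbitrary: c) simp_all

lemma nth_add_stair: "i < length ks \<Longrightarrow> add_stair c ks ! i = ks ! i + c + int i"
  by (induction ks arbitrary: c i) (auto simp: nth_Cons split: nat.splits)

definition put :: "nat \<Rightarrow> (nat \<Rightarrow> int) \<Rightarrow> int list \<Rightarrow> nat \<Rightarrow> int" where
  "put a x ks = (\<lambda>i. if a \<le> i \<and> i < a + length ks then ks ! (i - a) else x i)"

lemma put_Nil [simp]: "put a x [] = x"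
  by (rule ext) (auto simp: put_def)

lemma put_Cons: "put a x (k # ks) = put (Suc a) (x(a := k)) ks"
proof
  fix i
  consider "i < a" | "i = a" | d where "i = a + Suc d"
    by (metis add_Suc_right less_imp_Suc_add linorder_neqE_nat)
  then show "put a x (k # ks) i = put (Suc a) (x(a := k)) ks i"
    by cases (auto simp: put_def)
qed

lemma put_upd_below: "m < a \<Longrightarrow> (put a x ks)(m := c) = put a (x(m := c)) ks"
  by (auto simp: put_def fun_eq_iff)

lemma put_below [simp]: "m < a \<Longrightarrow> put a x ks m = x m"
  by (simp add: put_def)

context weights
begin

lemma qop_map: "qop (map (\<lambda>k. k + d) ks) H x = qop ks (\<lambda>x ls. H x (map (\<lambda>k. k + d) ls)) x"
  by (induction ks arbitrary: H x) (simp_all add: add.commute add.left_commute)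

lemma qop_translate: "qop ks (\<lambda>x. H (x + c)) x = qop ks H (x + c)"
proof (induction ks arbitrary: H x)
  case (Cons k ks)
  have "qop ks (\<lambda>x ls. H (x + c) (l # ls)) y = qop ks (\<lambda>x ls. H x (l # ls)) (y + c)" for l y
    by (rule Cons.IH)
  then show ?case by (simp add: add.commute add.left_commute)
qed simp

text \<open>\<open>zstrict u v q m\<close> is \<open>Q\<close> in the shifts of the variables
  \<open>m\<close> and \<open>q\<close>, followed by one inverse shift of the variable
  \<open>q\<close>. The inverse shifts are collected in the map on the right-hand side.\<close>

lemma zstrict_eq_qop:
  assumes "m < a" "a + length ks = n + 1"
    and "\<And>k ks'. length ks' = length ks \<Longrightarrow> G (put a (x(m := k)) ks') = H k ks'"
  shows "foldr (\<lambda>q. zstrict u v q m) [a..<n+1] G (put a (x(m := k)) ks) = qop (map (\<lambda>k. k - 1) ks) H k"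
  using assms
proof (induction ks arbitrary: a x k H)
  case Nil
  from Nil(3)[of "[]" k] Nil(2) show ?case by simp
next
  case (Cons c ks)
  then have a: "[a..<n+1] = a # [Suc a..<n+1]"
    by (simp add: upt_conv_Cons)
  let ?G = "foldr (\<lambda>q. zstrict u v q m) [Suc a..<n+1] G"
  have IH: "?G (put a (x(m := k')) (c' # ks)) = qop (map (\<lambda>k. k - 1) ks) (\<lambda>k ls. H k (c' # ls)) k'" for k' c'
  proof -
    have "put a (x(m := k')) (c' # ks) = put (Suc a) ((x(a := c'))(m := k')) ks"
      using Cons.prems(1) by (simp add: put_Cons fun_upd_twist)
    moreover have "?G (put (Suc a) ((x(a := c'))(m := k')) ks) = qop (map (\<lambda>k. k - 1) ks) (\<lambda>k ls. H k (c' # ls)) k'"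
    proof (rule Cons.IH)
      fix k and ks' :: "int list" assume "length ks' = length ks"
      moreover have "(x(a := c'))(m := k) = (x(m := k))(a := c')"
        using Cons.prems(1) by (simp add: fun_upd_twist)
      ultimately show "G (put (Suc a) ((x(a := c'))(m := k)) ks') = H k (c' # ks')"
        using Cons.prems(3)[of "c' # ks'" k] by (simp only: put_Cons length_Cons)
    qed (use Cons.prems in auto)
    ultimately show ?thesis by simp
  qed
  have upd: "(put a y (c # ks))(a := c') = put a y (c' # ks)" for c c' :: int and y
    by (auto simp: put_def fun_eq_iff)
  have at: "put a y (c # ks) a = c" for c and y :: "nat \<Rightarrow> int"
    by (simp add: put_def)
  have z: "zstrict u v a m ?G (put a (x(m := k)) (c # ks)) =
      u * ?G (put a (x(m := k + 1)) (c # ks)) + v * ?G (put a (x(m := k)) ((c - 1) # ks))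
      + (1 - u - v) * ?G (put a (x(m := k + 1)) ((c - 1) # ks))"
    using Cons.prems(1) by (simp add: zstrict_def upd at put_upd_below)
  show ?case
    unfolding a foldr.simps comp_def z IH by (simp add: w_def)
qed

text \<open>Each variable receives one inverse shift from every variable of smaller index, and
  together these cancel the staircase. In the induction \<open>c\<close> is the height of the
  staircase at position \<open>m\<close>.\<close>

lemma zstrict_all_eq_mop:
  assumes "m + length ks = n + 1"
    and "\<And>ks'. length ks' = length ks \<Longrightarrow> G (put m x ks') = D (add_stair c ks')"
  shows "foldr (\<lambda>p. foldr (\<lambda>q. zstrict u v q p) [p+1..<n+1]) [m..<n+1] G (put m x ks)
    = mop (length ks) D (map (\<lambda>k. k + c) ks)"
  using assms
proof (induction "length ks" arbitrary: m x c D ks)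
  case 0
  from 0(3)[of "[]"] 0(1,2) show ?case by simp
next
  case (Suc N)
  then obtain k ks0 where ks: "ks = k # ks0" "length ks0 = N" by (cases ks) auto
  let ?S = "\<lambda>p. foldr (\<lambda>q. zstrict u v q p) [p+1..<n+1]"
  let ?H = "\<lambda>y. mop N (\<lambda>ls. D (y # ls))"
  have m: "[m..<n+1] = m # [Suc m..<n+1]"
    using Suc.prems ks by (simp add: upt_conv_Cons)
  have IH: "foldr ?S [Suc m..<n+1] G (put (Suc m) (x(m := k')) ks')
      = ?H (k' + c) (map (\<lambda>k. k + (c + 1)) ks')" if l: "length ks' = N" for k' ks'
  proof -
    have "foldr ?S [Suc m..<n+1] G (put (Suc m) (x(m := k')) ks')
      = mop (length ks') (\<lambda>ls. D ((k' + c) # ls)) (map (\<lambda>k. k + (c + 1)) ks')"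
    proof (rule Suc.hyps(1))
      fix ls :: "int list" assume "length ls = length ks'"
      then show "G (put (Suc m) (x(m := k')) ls) = D ((k' + c) # add_stair (c + 1) ls)"
        using Suc.prems(2)[of "k' # ls"] l ks by (simp add: put_Cons)
    qed (use l Suc.prems ks in auto)
    then show ?thesis by (simp add: l)
  qed
  have "foldr ?S [m..<n+1] G (put m x ks)
      = foldr (\<lambda>q. zstrict u v q m) [Suc m..<n+1] (foldr ?S [Suc m..<n+1] G) (put (Suc m) (x(m := k)) ks0)"
    unfolding m foldr.simps comp_def ks put_Cons by simp
  also have "\<dots> = qop (map (\<lambda>k. k - 1) ks0) (\<lambda>k' ks'. ?H (k' + c) (map (\<lambda>k. k + (c + 1)) ks')) k"
    by (rule zstrict_eq_qop) (use IH Suc.prems ks in auto)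
  \<comment> \<open>The heights \<open>c + 1\<close> of the later variables and the inverse shift by
    the operators with index \<open>m\<close> combine to \<open>c\<close>.\<close>
  also have "\<dots> = qop ks0 (\<lambda>k' ks'. ?H (k' + c) (map (\<lambda>k. k + c) ks')) k"
    using qop_map[of "-1" ks0] by (simp add: comp_def)
  also have "\<dots> = qop (map (\<lambda>k. k + c) ks0) ?H (k + c)"
    unfolding qop_map by (rule qop_translate)
  finally show ?case by (simp add: ks)
qed

end

section \<open>Columns of the determinant and weights of the top entry\<close>

lemma sum_binomial_inversion:
  "(\<Sum>b\<le>y. (-1) ^ (c + b) * of_nat (b choose c) * of_nat (y choose b))
     = (if y = c then 1 else 0 :: 'a::comm_ring_1)"
proof (cases "c \<le> y")
  case True
  have "(\<Sum>b\<le>y. (-1) ^ (c + b) * of_nat (b choose c) * of_nat (y choose b) :: 'a)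
      = (\<Sum>b\<in>{c..y}. (-1) ^ (c + b) * of_nat (b choose c) * of_nat (y choose b))"
    by (rule sum.mono_neutral_right) (auto simp: binomial_eq_0)
  also have "\<dots> = (\<Sum>d\<le>y - c. of_nat (y choose c) * ((-1) ^ d * of_nat ((y - c) choose d)))"
  proof (rule sum.reindex_bij_witness[of _ "\<lambda>d. c + d" "\<lambda>b. b - c"])
    fix b assume b: "b \<in> {c..y}"
    then have "(y choose b) * (b choose c) = (y choose c) * ((y - c) choose (b - c))"
      by (intro choose_mult) auto
    then have "of_nat (b choose c) * (of_nat (y choose b) :: 'a) = of_nat (y choose c) * of_nat ((y - c) choose (b - c))"
      by (metis mult.commute of_nat_mult)
    moreover have "(-1 :: 'a) ^ (c + b) = (-1) ^ (b - c)"
    proof -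
      have e: "c + b = 2 * c + (b - c)" using b by simp
      show ?thesis unfolding e power_add power_mult by simp
    qed
    ultimately show "of_nat (y choose c) * ((-1) ^ (b - c) * of_nat ((y - c) choose (b - c)))
        = (-1) ^ (c + b) * of_nat (b choose c) * (of_nat (y choose b) :: 'a)"
      by (simp add: mult.left_commute mult.assoc)
  qed (use True in auto)
  also have "\<dots> = (if y = c then 1 else 0)"
    using True choose_alternating_sum[of "y - c", where 'a='a] by (auto simp flip: sum_distrib_left)
  finally show ?thesis .
next
  case False
  then show ?thesis by (auto intro!: sum.neutral simp: binomial_eq_0)
qed

text \<open>The columns of the determinant for order \<open>n\<close>.  The last one contains the iterated
  antiderivatives of the weight \<open>\<psi> 0\<close> of the top entry; the weight 1 leads to \<open>GT\<^sub>n\<close>.\<close>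

definition det_col :: "int \<Rightarrow> (nat \<Rightarrow> int \<Rightarrow> 'a) \<Rightarrow> nat \<Rightarrow> nat \<Rightarrow> int \<Rightarrow> 'a::field_char_0" where
  "det_col \<alpha> \<psi> n j z = (if Suc j = n then \<psi> j z else of_int (z - \<alpha>) gchoose j)"

definition antiderivatives :: "(nat \<Rightarrow> int \<Rightarrow> 'a::field_char_0) \<Rightarrow> bool" where
  "antiderivatives \<psi> \<longleftrightarrow> (\<forall>m z. \<psi> (Suc m) (z + 1) - \<psi> (Suc m) z = \<psi> m z)
     \<and> (\<forall>m i c. zpoly (\<lambda>x. \<psi> m (x i + c)))"

lemma gbinomial_of_int_diff:
  "((of_int (z + 1 - a) :: 'a::field_char_0) gchoose Suc m) - (of_int (z - a) gchoose Suc m) = of_int (z - a) gchoose m"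
  using gbinomial_Suc_Suc[of "of_int (z - a) :: 'a" m] by (simp add: algebra_simps)

lemma zpoly_det:
  assumes "\<And>i j. zpoly (\<lambda>x. f x i j)"
  shows "zpoly (\<lambda>x. det (mat n n (\<lambda>(i, j). f x i j)))"
proof -
  have "det (mat n n (\<lambda>(i, j). f x i j)) = (\<Sum>p\<in>{p. p permutes {0..<n}}. signof p * (\<Prod>i = 0..<n. f x i (p i)))" for x
    by (subst det_def'[of _ n]) (auto intro!: sum.cong prod.cong simp: permutes_in_image)
  then show ?thesis
    by (simp add: zpoly_sum zpoly_cmult zpoly_prod assms)
qed

text \<open>The cofactors of the last column do not see its entries, so the determinant is linear in
  that column.\<close>

lemma det_last_col_sum:
  fixes M :: "nat \<Rightarrow> nat \<Rightarrow> 'a::comm_ring_1"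
  assumes "n > 0"
  shows "det (mat n n (\<lambda>(i, j). if Suc j = n then \<Sum>b\<in>B. c b * g b i else M i j))
     = (\<Sum>b\<in>B. c b * det (mat n n (\<lambda>(i, j). if Suc j = n then g b i else M i j)))"
proof -
  let ?A = "\<lambda>h. mat n n (\<lambda>(i, j). if Suc j = n then h i else M i j)"
  have del: "mat_delete (?A h) i (n - 1) = mat_delete (?A h') i (n - 1)" if "i < n" for h h' i
    using that by (intro eq_matI) (auto simp: mat_delete_def)
  have "det (?A h) = (\<Sum>i<n. h i * cofactor (?A (\<lambda>_. 0)) i (n - 1))" for h
  proof -
    have "det (?A h) = (\<Sum>i<n. ?A h $$ (i, n - 1) * cofactor (?A h) i (n - 1))"
      by (rule laplace_expansion_column) (use assms in auto)
    also have "\<dots> = (\<Sum>i<n. h i * cofactor (?A (\<lambda>_. 0)) i (n - 1))"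
      by (rule sum.cong) (use assms del[of _ h "\<lambda>_. 0"] in \<open>auto simp: cofactor_def\<close>)
    finally show ?thesis .
  qed
  note det_A = this
  have "det (?A (\<lambda>i. \<Sum>b\<in>B. c b * g b i))
      = (\<Sum>i<n. \<Sum>b\<in>B. c b * (g b i * cofactor (?A (\<lambda>_. 0)) i (n - 1)))"
    unfolding det_A by (simp add: sum_distrib_right mult.assoc)
  also have "\<dots> = (\<Sum>b\<in>B. c b * det (?A (g b)))"
    unfolding det_A sum_distrib_left by (rule sum.swap)
  finally show ?thesis .
qed

context weights
begin

text \<open>The common form of \<open>M_poly\<close> (\<open>\<psi> m z\<close> is the binomial
  coefficient of \<open>z\<close> over \<open>m\<close>, and \<open>\<alpha> = 0\<close>) and of
  \<open>M_top\<close> (\<open>\<psi>\<close> is \<open>top_psi\<close>). The staircase is already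
  cancelled here.\<close>

definition tree_poly :: "int \<Rightarrow> (nat \<Rightarrow> int \<Rightarrow> 'a) \<Rightarrow> nat \<Rightarrow> 'a zfun" where
  "tree_poly \<alpha> \<psi> n x = mop n (ldet (det_col \<alpha> \<psi> n)) (map x [1..<n+1])"

lemma tree_poly_1: "tree_poly \<alpha> \<psi> 1 x = \<psi> 0 (x 1)"
  by (simp add: tree_poly_def ldet_Cons det_col_def upt_Suc)

text \<open>Since \<open>n \<ge> 1\<close>, column 0 of order \<open>Suc n\<close> is not the last
  one and consists of ones. The difference of column \<open>Suc j\<close> of order
  \<open>Suc n\<close> is column \<open>j\<close> of order \<open>n\<close>, by Pascal's rule or, in
  the last column, by \<open>antiderivatives\<close>.\<close>

lemma tree_poly_rec:
  assumes "antiderivatives \<psi>" "n \<ge> 1"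
  shows "tree_poly \<alpha> \<psi> (Suc n) x = row_sum v u (map x [1..<n+2]) (mop n (ldet (det_col \<alpha> \<psi> n)))"
proof -
  have "row_sum v u (map x [1..<n+2]) (mop n (ldet (\<lambda>j z. det_col \<alpha> \<psi> (Suc n) (Suc j) (z + 1) - det_col \<alpha> \<psi> (Suc n) (Suc j) z)))
      = mop (Suc n) (ldet (det_col \<alpha> \<psi> (Suc n))) (map x [1..<n+2])"
    by (rule row_sum_ldet) (use assms in \<open>auto simp: det_col_def\<close>)
  moreover have "(\<lambda>j z. det_col \<alpha> \<psi> (Suc n) (Suc j) (z + 1) - det_col \<alpha> \<psi> (Suc n) (Suc j) z) = det_col \<alpha> \<psi> n"
    by (intro ext) (use assms in \<open>auto simp: det_col_def antiderivatives_def gbinomial_of_int_diff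
        simp del: of_int_diff of_int_add\<close>)
  ultimately show ?thesis by (simp add: tree_poly_def)
qed

lemma tree_poly_eq_strict:
  "tree_poly \<alpha> \<psi> n = foldr (\<lambda>p. foldr (\<lambda>q. zstrict u v q p) [p+1..<n+1]) [1..<n+1]
     (\<lambda>x. ldet (det_col \<alpha> \<psi> n) (add_stair 0 (map x [1..<n+1])))"
proof
  fix x
  have "put 1 x (map x [1..<n+1]) = x"
    by (rule ext) (auto simp: put_def simp del: upt_Suc)
  moreover have "map (put 1 x ks) [1..<n+1] = ks" if "length ks = n" for ks
    using that by (auto simp: put_def intro!: nth_equalityI simp del: upt_Suc)
  ultimately show "tree_poly \<alpha> \<psi> n x = foldr (\<lambda>p. foldr (\<lambda>q. zstrict u v q p) [p+1..<n+1]) [1..<n+1]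
     (\<lambda>x. ldet (det_col \<alpha> \<psi> n) (add_stair 0 (map x [1..<n+1]))) x"
    using zstrict_all_eq_mop[of 1 "map x [1..<n+1]" n "\<lambda>x. ldet (det_col \<alpha> \<psi> n) (add_stair 0 (map x [1..<n+1]))" x
        "ldet (det_col \<alpha> \<psi> n)" 0]
    by (simp add: tree_poly_def del: upt_Suc)
qed

lemma ldet_add_stair:
  "ldet \<phi> (add_stair 0 (map x [1..<n+1])) = det (mat n n (\<lambda>(i, j). \<phi> j (x (i + 1) + int i)))"
proof -
  have "mat n n (\<lambda>(i, j). \<phi> j (add_stair 0 (map x [1..<n+1]) ! i)) = mat n n (\<lambda>(i, j). \<phi> j (x (i + 1) + int i))"
    by (intro eq_matI) (auto simp: nth_add_stair simp del: upt_Suc)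
  then show ?thesis by (simp add: ldet_def del: upt_Suc)
qed

lemma zpoly_tree_poly:
  assumes "antiderivatives \<psi>"
  shows "zpoly (tree_poly \<alpha> \<psi> n)"
proof -
  have "zpoly (\<lambda>x. det_col \<alpha> \<psi> n j (x (i + 1) + int i))" for i j
  proof -
    have "zpoly (\<lambda>x. (of_int (x (i + 1) + (int i - \<alpha>)) :: 'a) gchoose j)"
      by (rule zpoly_gbinomial)
    then show ?thesis
      using assms by (cases "Suc j = n") (simp_all add: det_col_def antiderivatives_def add_diff_eq del: of_int_diff of_int_add)
  qed
  then have "zpoly (\<lambda>x. ldet (det_col \<alpha> \<psi> n) (add_stair 0 (map x [1..<n+1])))"
    unfolding ldet_add_stair by (rule zpoly_det)
  then show ?thesis
    unfolding tree_poly_eq_strict by (intro zpoly_foldr zpoly_zstrict)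
qed

lemma on_lattice_GT:
  "on_lattice (GT_poly n :: 'a polyfun) x = ldet (det_col 0 (\<lambda>m z. of_int z gchoose m) n) (add_stair 0 (map x [1..<n+1]))"
proof -
  let ?y = "\<lambda>i. (of_int (x (i + 1) + int i) :: 'a)"
  have "ldet (det_col 0 (\<lambda>m z. of_int z gchoose m) n) (add_stair 0 (map x [1..<n+1]))
      = det (mat n n (\<lambda>(i, j). ?y i gchoose j))"
    unfolding ldet_add_stair det_col_def by (intro arg_cong[of _ _ det] eq_matI) auto
  also have "\<dots> = (\<Prod>j<n. \<Prod>i<j. (?y j - ?y i) / (of_nat j - of_nat i))"
    by (rule det_gbinomial)
  also have "\<dots> = (\<Prod>(j, i)\<in>(SIGMA j:{..<n}. {..<j}). (?y j - ?y i) / (of_nat j - of_nat i))"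
    by (rule prod.Sigma) auto
  also have "\<dots> = (\<Prod>(i, j)\<in>{(i, j). 1 \<le> i \<and> i < j \<and> j \<le> n}.
      (of_int (x j) - of_int (x i) + of_nat j - of_nat i) / (of_nat j - of_nat i))"
    by (rule prod.reindex_bij_witness[of _ "\<lambda>(i, j). (j - 1, i - 1)" "\<lambda>(j, i). (i + 1, j + 1)"])
      (auto simp: of_nat_diff)
  finally show ?thesis
    by (simp only: on_lattice_def GT_poly_def)
qed

lemma on_lattice_M_poly:
  "on_lattice (M_poly u v n) = tree_poly 0 (\<lambda>m z. of_int z gchoose m) n"
proof -
  have "on_lattice (GT_poly n :: 'a polyfun) = (\<lambda>x. ldet (det_col 0 (\<lambda>m z. of_int z gchoose m) n) (add_stair 0 (map x [1..<n+1])))"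
    by (rule ext, rule on_lattice_GT)
  then show ?thesis
    unfolding M_poly_def on_lattice_strict_all tree_poly_eq_strict by (simp only:)
qed

text \<open>For \<open>m = 0\<close> this is the Newton interpolation polynomial of the indicator of
  \<open>a\<close> on the integers from \<open>\<alpha>\<close> to \<open>\<beta>\<close>: the
  signed binomial coefficients are the differences of the indicator at \<open>\<alpha>\<close>.
  Raising the lower index of the basis polynomials by \<open>m\<close> gives the
  antiderivatives.\<close>

definition top_psi :: "int \<Rightarrow> int \<Rightarrow> int \<Rightarrow> nat \<Rightarrow> int \<Rightarrow> 'a" where
  "top_psi a \<alpha> \<beta> m z = (\<Sum>b = 0..nat (\<beta> - \<alpha>). (-1) powi (a + \<alpha> + int b) * of_nat (b choose nat (a - \<alpha>))
     * (of_int (z - \<alpha>) gchoose (m + b)))"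

lemma antiderivatives_gbinomial: "antiderivatives (\<lambda>m z. (of_int z :: 'a) gchoose m)"
  unfolding antiderivatives_def
proof (intro conjI allI)
  fix m z
  show "((of_int (z + 1) :: 'a) gchoose Suc m) - (of_int z gchoose Suc m) = of_int z gchoose m"
    using gbinomial_of_int_diff[of z 0 m] by simp
qed (rule zpoly_gbinomial)

lemma antiderivatives_top_psi: "antiderivatives (top_psi a \<alpha> \<beta>)"
  unfolding antiderivatives_def
proof (intro conjI allI)
  fix m z
  show "top_psi a \<alpha> \<beta> (Suc m) (z + 1) - top_psi a \<alpha> \<beta> (Suc m) z = top_psi a \<alpha> \<beta> m z"
    unfolding top_psi_def add_Suc sum_subtractf[symmetric] right_diff_distrib[symmetric] gbinomial_of_int_diff ..
next
  fix m i c
  have "zpoly (\<lambda>x. (of_int (x i + (c - \<alpha>)) :: 'a) gchoose k)" for k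
    by (rule zpoly_gbinomial)
  then show "zpoly (\<lambda>x. top_psi a \<alpha> \<beta> m (x i + c))"
    unfolding top_psi_def by (intro zpoly_sum zpoly_cmult) (simp add: add_diff_eq)
qed

lemma top_psi_0:
  assumes "\<alpha> \<le> a" "\<alpha> \<le> z" "z \<le> \<beta>"
  shows "top_psi a \<alpha> \<beta> 0 z = (if z = a then 1 else 0)"
proof -
  define c y where "c = nat (a - \<alpha>)" and "y = nat (z - \<alpha>)"
  have z: "(of_int (z - \<alpha>) :: 'a) = of_nat y"
    using assms by (simp add: y_def)
  have sgn: "((-1) powi (a + \<alpha> + int b) :: 'a) = (-1) ^ (c + b)" for b
  proof -
    \<comment> \<open>The exponent may be negative; removing the even number
      \<open>2 * \<alpha>\<close> leaves a natural exponent and does not change the sign.\<close>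
    have e: "a + \<alpha> + int b = 2 * \<alpha> + int (c + b)" using assms by (simp add: c_def)
    have "(-1 :: 'a) powi (2 * \<alpha> + int (c + b)) = ((-1) powi 2) powi \<alpha> * (-1) ^ (c + b)"
      by (subst power_int_add) (simp_all only: power_int_mult power_int_of_nat, simp)
    then show ?thesis unfolding e by simp
  qed
  have "top_psi a \<alpha> \<beta> 0 z = (\<Sum>b = 0..nat (\<beta> - \<alpha>). (-1) ^ (c + b) * of_nat (b choose c) * of_nat (y choose b))"
    unfolding top_psi_def sgn z by (simp add: binomial_gbinomial c_def)
  also have "\<dots> = (\<Sum>b\<le>y. (-1) ^ (c + b) * of_nat (b choose c) * of_nat (y choose b))"
    by (rule sum.mono_neutral_right) (use assms in \<open>auto simp: y_def\<close>)
  also have "\<dots> = (if y = c then 1 else 0)"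
    by (rule sum_binomial_inversion)
  also have "y = c \<longleftrightarrow> z = a" using assms by (auto simp: y_def c_def)
  finally show ?thesis .
qed

lemma on_lattice_M_top:
  assumes "n \<ge> 1"
  shows "on_lattice (M_top u v n a \<alpha> \<beta>) = tree_poly \<alpha> (top_psi a \<alpha> \<beta>) n"
proof -
  have "on_lattice (GT_top n a \<alpha> \<beta>) x = ldet (det_col \<alpha> (top_psi a \<alpha> \<beta>) n) (add_stair 0 (map x [1..<n+1]))" for x
  proof -
    let ?c = "\<lambda>b. (-1) powi (a + \<alpha> + int b) * (of_nat (b choose nat (a - \<alpha>)) :: 'a)"
    let ?g = "\<lambda>b i. (of_int (x (i + 1) + int i - \<alpha>) :: 'a) gchoose (n - 1 + b)"
    let ?M = "\<lambda>i j. (of_int (x (i + 1) + int i - \<alpha>) :: 'a) gchoose j"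
    have "ldet (det_col \<alpha> (top_psi a \<alpha> \<beta>) n) (add_stair 0 (map x [1..<n+1]))
        = det (mat n n (\<lambda>(i, j). if Suc j = n then \<Sum>b = 0..nat (\<beta> - \<alpha>). ?c b * ?g b i else ?M i j))"
      unfolding ldet_add_stair det_col_def top_psi_def
      by (intro arg_cong[of _ _ det] eq_matI) (use assms in auto)
    also have "\<dots> = (\<Sum>b = 0..nat (\<beta> - \<alpha>). ?c b * det (mat n n (\<lambda>(i, j). if Suc j = n then ?g b i else ?M i j)))"
      by (rule det_last_col_sum) (use assms in simp)
    also have "\<dots> = on_lattice (GT_top n a \<alpha> \<beta>) x"
      unfolding on_lattice_def GT_top_def
      by (intro sum.cong arg_cong2[of _ _ _ _ "(*)"] arg_cong[of _ _ det] eq_matI) (auto simp: algebra_simps)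
    finally show ?thesis ..
  qed
  then have "on_lattice (GT_top n a \<alpha> \<beta>) = (\<lambda>x. ldet (det_col \<alpha> (top_psi a \<alpha> \<beta>) n) (add_stair 0 (map x [1..<n+1])))"
    by (rule ext)
  then show ?thesis
    unfolding M_top_def on_lattice_strict_all tree_poly_eq_strict by (simp only:)
qed

end

section \<open>The summation operator for a row\<close>

text \<open>In the row above the last one, the entries of index at most \<open>p\<close> and the entries of index at least
  \<open>q\<close> are those prescribed by \<open>x\<close>, the latter with their index shifted by one; \<open>ls\<close> is the part in
  between, of length \<open>q - p - 1\<close>.\<close>

definition glue :: "nat \<Rightarrow> (nat \<Rightarrow> int) \<Rightarrow> int list \<Rightarrow> nat \<Rightarrow> int" where
  "glue p x ls i = (if i \<le> p then x i else if i \<le> p + length ls then ls ! (i - p - 1) else x (i + 1))"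

lemma glue_upd_left: "i \<le> p \<Longrightarrow> glue p (x(i := c)) ls = (glue p x ls)(i := c)"
  by (auto simp: glue_def fun_eq_iff)

lemma glue_upd_right: "p + length ls + 1 < i \<Longrightarrow> glue p (x(i := c)) ls = (glue p x ls)(i - 1 := c)"
  by (auto simp: glue_def fun_eq_iff)

lemma glue_upd_mid: "p < i \<Longrightarrow> i \<le> p + length ls + 1 \<Longrightarrow> glue p (x(i := c)) ls = glue p x ls"
  by (auto simp: glue_def fun_eq_iff)

lemma glue_Cons: "glue p x (x (Suc p) # ls) = glue (Suc p) x ls"
proof
  fix i
  consider "i \<le> p" | "i = Suc p" | j where "i = Suc (Suc p) + j"
    by (metis add_Suc_right le_add_diff_inverse less_eq_Suc_le not_less_eq_eq le_neq_implies_less le_Suc_eq)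
  then show "glue p x (x (Suc p) # ls) i = glue (Suc p) x ls i"
    by cases (auto simp: glue_def Suc_diff_le)
qed

lemma glue_snoc: "q = p + length ls + 2 \<Longrightarrow> glue p x (ls @ [x q]) = glue p x ls"
  by (rule ext) (auto simp: glue_def nth_append le_Suc_eq)

section \<open>Action of the difference operators on the two ends of a row sum\<close>

context weights
begin

text \<open>The mirror image of the definition of \<open>row_sum\<close>: lowering the last bound to
  \<open>k - 1\<close> excludes the value \<open>k\<close> from the last range, so the affine
  combination gives it weight \<open>u1\<close>.\<close>

lemma part_sum_snoc:
  "part_sum u1 a (ks @ [k]) f = u1 * part_sum 1 a (ks @ [k]) f + (1 - u1) * part_sum 1 a (ks @ [k - 1]) f"
proof (induction ks arbitrary: a f)
  case Nil
  have "v * f [l] + (1 - v) * f [l] = f [l]" for l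
    by (simp add: algebra_simps)
  then show ?case
    using ext_sum_upper[of a "k - 1" "\<lambda>l. f [l]"] by (simp add: algebra_simps)
next
  case (Cons c ks)
  have *: "ext_sum a c (\<lambda>l. v * part_sum u1 b ks' (\<lambda>ls. f (l # ls)) + (1 - v) * part_sum u1 b' ks' (\<lambda>ls. f (l # ls)))
      = v * ext_sum a c (\<lambda>l. part_sum u1 b ks' (\<lambda>ls. f (l # ls)))
        + (1 - v) * ext_sum a c (\<lambda>l. part_sum u1 b' ks' (\<lambda>ls. f (l # ls)))" for b b' ks' u1
    by (simp add: ext_sum_add ext_sum_cmult)
  show ?case
    by (simp add: * Cons.IH ext_sum_add ext_sum_cmult) (simp add: algebra_simps)
qed

text \<open>Lowering the last bound by 1 loses exactly the rows that end in \<open>k\<close>. With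
  this entry fixed, the entry before it is the last one to be summed and has weight \<open>u\<close>
  at its upper bound.\<close>

lemma part_sum_snoc_diff:
  "part_sum 1 a (ks @ [k]) f - part_sum 1 a (ks @ [k - 1]) f = part_sum u a ks (\<lambda>ls. f (ls @ [k]))"
proof (induction ks arbitrary: a f)
  case Nil
  have "v * f [l] + (1 - v) * f [l] = f [l]" for l
    by (simp add: algebra_simps)
  then show ?case
    using ext_sum_upper[of a "k - 1" "\<lambda>l. f [l]"] by (simp add: algebra_simps)
next
  case (Cons c ks)
  have *: "ext_sum a c (\<lambda>l. v * g l + (1 - v) * h l) = v * ext_sum a c g + (1 - v) * ext_sum a c h" for g h
    by (simp add: ext_sum_add ext_sum_cmult)
  have IH: "part_sum u b ks (\<lambda>ls. f (l # ls @ [k]))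
      = part_sum 1 b (ks @ [k]) (\<lambda>ls. f (l # ls)) - part_sum 1 b (ks @ [k - 1]) (\<lambda>ls. f (l # ls))" for b l
    using Cons.IH[of b "\<lambda>ls. f (l # ls)"] by simp
  show ?case
    by (simp add: * IH ext_sum_diff) (simp add: algebra_simps)
qed

lemma row_sum_cong:
  "ks \<noteq> [] \<Longrightarrow> (\<And>ls. Suc (length ls) = length ks \<Longrightarrow> f ls = g ls) \<Longrightarrow> row_sum v1 u1 ks f = row_sum v1 u1 ks g"
  unfolding row_sum_def by (cases ks) (auto cong: part_sum_cong)

lemma row_sum_single [simp]: "row_sum v1 u1 [k] f = f []"
  by (simp add: row_sum_def algebra_simps)

lemma row_sum_add: "row_sum v1 u1 ks (\<lambda>ls. f ls + g ls) = row_sum v1 u1 ks f + row_sum v1 u1 ks g"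
  by (simp add: row_sum_def part_sum_add algebra_simps)

lemma row_sum_cmult: "row_sum v1 u1 ks (\<lambda>ls. c * f ls) = c * row_sum v1 u1 ks f"
  by (simp add: row_sum_def part_sum_cmult algebra_simps)

text \<open>\<open>glue\<close> hides the variables \<open>p + 1\<close> to \<open>q\<close> from
  \<open>F\<close>, so these act only as bounds, while the other variables are only parameters of
  \<open>F\<close>. This dichotomy decides whether an operator alters the sum or passes through
  it.\<close>

definition row_op :: "'a \<Rightarrow> 'a \<Rightarrow> nat \<Rightarrow> nat \<Rightarrow> 'a zfun \<Rightarrow> 'a zfun" where
  "row_op v1 u1 p q F x = row_sum v1 u1 (map x [Suc p..<Suc q]) (\<lambda>ls. F (glue p x ls))"

lemma zlinear_row_op: "zlinear (row_op v1 u1 p q)"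
  by (simp add: zlinear_def row_op_def row_sum_add row_sum_cmult fun_eq_iff)

lemma map_upd_outside: "i \<notin> set is \<Longrightarrow> map (x(i := c)) is = map x is"
  by auto

lemma zshift_row_op_left:
  "i \<le> p \<Longrightarrow> p < q \<Longrightarrow> zshift i c (row_op v1 u1 p q F) = row_op v1 u1 p q (zshift i c F)"
  unfolding zshift_def row_op_def
  by (rule ext) (simp add: map_upd_outside glue_upd_left, simp add: glue_def)

lemma zshift_row_op_right:
  "q < i \<Longrightarrow> p < q \<Longrightarrow> zshift i c (row_op v1 u1 p q F) = row_op v1 u1 p q (zshift (i - 1) c F)"
  unfolding zshift_def row_op_def
  by (rule ext, subst map_upd_outside, simp, rule row_sum_cong)
    (auto simp: glue_upd_right, auto simp: glue_def)

lemma zdiff_row_op_left: "i \<le> p \<Longrightarrow> p < q \<Longrightarrow> zdiff i (row_op v1 u1 p q F) = row_op v1 u1 p q (zdiff i F)"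
  by (simp add: zdiff_zshift zshift_row_op_left zlinear_diff[OF zlinear_row_op])

lemma zbdiff_row_op_right:
  "q < i \<Longrightarrow> p < q \<Longrightarrow> zbdiff i (row_op v1 u1 p q F) = row_op v1 u1 p q (zbdiff (i - 1) F)"
  by (simp add: zbdiff_zshift zshift_row_op_right zlinear_diff[OF zlinear_row_op])

lemma finv_row_op_left:
  assumes "zpoly F" "i \<le> p" "p < q"
  shows "neumann (zdiff i) c (row_op v1 u1 p q F) = row_op v1 u1 p q (neumann (zdiff i) c F)"
proof -
  obtain N where "(zdiff i ^^ N) F = (\<lambda>x. 0)"
    using assms(1) unfolding zpoly_def znil_def by blast
  then show ?thesis
    by (rule neumann_image[OF zlinear_zdiff zlinear_zdiff zlinear_row_op, symmetric])
      (rule zdiff_row_op_left[OF assms(2,3), symmetric])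
qed

lemma binv_row_op_right:
  assumes "zpoly F" "q < i" "p < q"
  shows "neumann (zbdiff i) c (row_op v1 u1 p q F) = row_op v1 u1 p q (neumann (zbdiff (i - 1)) c F)"
proof -
  obtain N where N: "znil (i - 1) N F"
    using assms(1) unfolding zpoly_def by blast
  show ?thesis
    by (rule neumann_image[OF zlinear_zbdiff zlinear_zbdiff zlinear_row_op znil_zbdiff[OF N], symmetric])
      (rule zbdiff_row_op_right[OF assms(2,3), symmetric])
qed

lemma fcut_row_op_left:
  assumes "zpoly F" "i \<le> p" "p < q"
  shows "front_cut v i (row_op v1 u1 p q F) = row_op v1 u1 p q (front_cut v i F)"
  using zlinear_cmult[OF zlinear_row_op, of _ _ _ _ "- 1"]
  by (simp add: front_cut_def zdiff_row_op_left finv_row_op_left zpoly_zdiff assms)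

lemma bcut_row_op_right:
  assumes "zpoly F" "q < i" "p < q"
  shows "back_cut u i (row_op v1 u1 p q F) = row_op v1 u1 p q (back_cut u (i - 1) F)"
  by (simp add: back_cut_def zbdiff_row_op_right binv_row_op_right zpoly_zbdiff assms)

text \<open>\<open>row_sum\<close> mixes the sums with lower bound \<open>x (Suc p)\<close> and
  \<open>x (Suc p) + 1\<close>, in proportion \<open>v1\<close> to \<open>1 - v1\<close>; this is
  \<open>1 + (1 - v1) \<Delta>\<close> applied to the sum with weight 1.\<close>

lemma row_op_left_weight:
  assumes "p < q"
  shows "row_op v1 u1 p q F = (\<lambda>x. row_op 1 u1 p q F x + (1 - v1) * zdiff (Suc p) (row_op 1 u1 p q F) x)"
proof
  fix x :: "nat \<Rightarrow> int"
  have "[Suc p..<Suc q] = Suc p # [Suc (Suc p)..<Suc q]"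
    using assms by (simp add: upt_conv_Cons)
  moreover have "part_sum u1 b (map x [Suc (Suc p)..<Suc q]) (\<lambda>ls. F (glue p (x(Suc p := c)) ls))
      = part_sum u1 b (map x [Suc (Suc p)..<Suc q]) (\<lambda>ls. F (glue p x ls))" for b c
    by (rule part_sum_cong) (simp add: glue_upd_mid)
  ultimately show "row_op v1 u1 p q F x = row_op 1 u1 p q F x + (1 - v1) * zdiff (Suc p) (row_op 1 u1 p q F) x"
    by (simp add: row_op_def zdiff_def row_sum_def map_upd_outside) (simp add: algebra_simps)
qed

text \<open>Raising the lower bound removes the rows whose first entry equals this bound. That entry
  is then prescribed, so it counts as one more fixed variable on the left, and the next range starts
  with weight \<open>v\<close>.\<close>

lemma zdiff_row_op:
  assumes "Suc p < q"
  shows "zdiff (Suc p) (row_op 1 u1 p q F) = (\<lambda>x. - row_op v u1 (Suc p) q F x)"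
proof
  fix x :: "nat \<Rightarrow> int"
  have upt: "[Suc p..<Suc q] = Suc p # Suc (Suc p) # [Suc (Suc (Suc p))..<Suc q]"
    using assms by (simp add: upt_conv_Cons)
  have upt': "[Suc (Suc p)..<Suc q] = Suc (Suc p) # [Suc (Suc (Suc p))..<Suc q]"
    using assms by (simp add: upt_conv_Cons)
  let ?ks = "map x [Suc (Suc (Suc p))..<Suc q]"
  have *: "part_sum u1 b (x (Suc (Suc p)) # ?ks) (\<lambda>ls. F (glue p (x(Suc p := c)) ls))
      = part_sum u1 b (x (Suc (Suc p)) # ?ks) (\<lambda>ls. F (glue p x ls))" for b c
    by (rule part_sum_cong) (simp add: glue_upd_mid)
  have "zdiff (Suc p) (row_op 1 u1 p q F) x
     = part_sum u1 (x (Suc p) + 1) (x (Suc (Suc p)) # ?ks) (\<lambda>ls. F (glue p x ls))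
       - part_sum u1 (x (Suc p)) (x (Suc (Suc p)) # ?ks) (\<lambda>ls. F (glue p x ls))"
    by (simp add: row_op_def zdiff_def row_sum_def upt map_upd_outside * del: part_sum.simps)
  also have "\<dots> = - row_op v u1 (Suc p) q F x"
    by (simp add: ext_sum_lower row_op_def row_sum_def upt' glue_Cons)
  finally show "zdiff (Suc p) (row_op 1 u1 p q F) x = - row_op v u1 (Suc p) q F x" .
qed

lemma row_op_right_weight:
  assumes "Suc p < q"
  shows "row_op v1 u1 p q F = (\<lambda>x. row_op v1 1 p q F x + (u1 - 1) * zbdiff q (row_op v1 1 p q F) x)"
proof
  fix x :: "nat \<Rightarrow> int"
  have upt: "[Suc p..<Suc q] = Suc p # [Suc (Suc p)..<q] @ [q]"
    using assms by (simp add: upt_conv_Cons upt_Suc)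
  have *: "part_sum u2 b (map x [Suc (Suc p)..<q] @ [k]) (\<lambda>ls. F (glue p (x(q := c)) ls))
      = part_sum u2 b (map x [Suc (Suc p)..<q] @ [k]) (\<lambda>ls. F (glue p x ls))" for b c k u2
    by (rule part_sum_cong) (use assms in \<open>simp add: glue_upd_mid\<close>)
  show "row_op v1 u1 p q F x = row_op v1 1 p q F x + (u1 - 1) * zbdiff q (row_op v1 1 p q F) x"
    using assms unfolding row_op_def zbdiff_def row_sum_def upt
    by (simp add: map_upd_outside * part_sum_snoc[of u1]) (simp add: algebra_simps)
qed

lemma zbdiff_row_op:
  assumes "Suc p < q"
  shows "zbdiff q (row_op v1 1 p q F) = row_op v1 u p (q - 1) F"
proof
  fix x :: "nat \<Rightarrow> int"
  have upt: "[Suc p..<Suc q] = Suc p # [Suc (Suc p)..<q] @ [q]" "[Suc p..<Suc (q - 1)] = Suc p # [Suc (Suc p)..<q]"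
    using assms by (simp_all add: upt_conv_Cons upt_Suc)
  have *: "part_sum u2 b (map x [Suc (Suc p)..<q] @ [k]) (\<lambda>ls. F (glue p (x(q := c)) ls))
      = part_sum u2 b (map x [Suc (Suc p)..<q] @ [k]) (\<lambda>ls. F (glue p x ls))" for b c k u2
    by (rule part_sum_cong) (use assms in \<open>simp add: glue_upd_mid\<close>)
  have s: "part_sum 1 b (map x [Suc (Suc p)..<q] @ [x q]) (\<lambda>ls. F (glue p x ls))
      = part_sum 1 b (map x [Suc (Suc p)..<q] @ [x q - 1]) (\<lambda>ls. F (glue p x ls))
        + part_sum u b (map x [Suc (Suc p)..<q]) (\<lambda>ls. F (glue p x ls))" for b
  proof -
    have "part_sum u b (map x [Suc (Suc p)..<q]) (\<lambda>ls. F (glue p x (ls @ [x q])))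
        = part_sum u b (map x [Suc (Suc p)..<q]) (\<lambda>ls. F (glue p x ls))"
      by (rule part_sum_cong, subst glue_snoc) (use assms in auto)
    then show ?thesis
      using part_sum_snoc_diff[of b "map x [Suc (Suc p)..<q]" "x q" "\<lambda>ls. F (glue p x ls)"] by (simp add: algebra_simps)
  qed
  show "zbdiff q (row_op v1 1 p q F) x = row_op v1 u p (q - 1) F x"
    using assms unfolding row_op_def zbdiff_def row_sum_def upt
    by (simp add: map_upd_outside * s) (simp add: algebra_simps)
qed

lemma znil_row_op_left:
  assumes "zpoly F" "i \<le> p" "p < q"
  shows "\<exists>N. znil i N (row_op v1 u1 p q F)"
proof -
  obtain N where "znil i N F" using assms(1) unfolding zpoly_def by blast
  from znil_image[OF this zlinear_row_op] show ?thesis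
    using zdiff_row_op_left[OF assms(2,3)] by metis
qed

lemma zbnil_row_op_right:
  assumes "zpoly F" "q < i" "p < q"
  shows "\<exists>N. (zbdiff i ^^ N) (row_op v1 u1 p q F) = (\<lambda>x. 0)"
proof -
  obtain N where N: "znil (i - 1) N F" using assms(1) unfolding zpoly_def by blast
  have "(zbdiff i ^^ N) (row_op v1 u1 p q F) = row_op v1 u1 p q ((zbdiff (i - 1) ^^ N) F)"
    by (rule funpow_commute[where T="row_op v1 u1 p q", symmetric]) (rule zbdiff_row_op_right[OF assms(2,3), symmetric])
  then show ?thesis
    using znil_zbdiff[OF N] by (auto simp: zlinear_zero[OF zlinear_row_op])
qed

text \<open>\<open>\<Delta>[v]\<close> is \<open>\<Delta>\<close> followed by the inverse of
  \<open>1 + (1 - v) \<Delta>\<close>. The inverse turns the end weight \<open>v\<close> into 1 by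
  \<open>row_op_left_weight\<close>, and \<open>\<Delta>\<close> fixes the first entry by
  \<open>zdiff_row_op\<close>.\<close>

lemma fcut_row_op:
  assumes "zpoly F" "Suc p < q"
  shows "front_cut v (Suc p) (row_op v u1 p q F) = row_op v u1 (Suc p) q F"
proof -
  let ?G = "row_op v u1 (Suc p) q F"
  obtain N where N: "znil (Suc p) N ?G" using znil_row_op_left[of F "Suc p" "Suc p" q] assms by auto
  have m: "zlinear (\<lambda>(F :: 'a zfun) x. - F x)"
    by (simp add: zlinear_def)
  have "znil (Suc p) N (\<lambda>x. - ?G x)"
    by (rule znil_image[OF N m]) (simp add: zdiff_def)
  then have "neumann (zdiff (Suc p)) (v - 1) (zdiff (Suc p) (row_op v u1 p q F)) = (\<lambda>x. - ?G x)"
    unfolding znil_def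
  proof (rule neumann_eqI[OF zlinear_zdiff])
    have "zdiff (Suc p) (row_op v u1 p q F) = (\<lambda>x. zdiff (Suc p) (row_op 1 u1 p q F) x
        + (1 - v) * zdiff (Suc p) (zdiff (Suc p) (row_op 1 u1 p q F)) x)"
      using assms(2) by (subst row_op_left_weight) (simp_all add: zlinear_add[OF zlinear_zdiff] zlinear_cmult[OF zlinear_zdiff])
    then show "zdiff (Suc p) (row_op v u1 p q F) = (\<lambda>x. - ?G x - (v - 1) * zdiff (Suc p) (\<lambda>x. - ?G x) x)"
      unfolding zdiff_row_op[OF assms(2)] by (simp add: algebra_simps)
  qed
  then show ?thesis by (simp add: front_cut_def)
qed

lemma bcut_row_op:
  assumes "zpoly F" "Suc p < q"
  shows "back_cut u q (row_op v1 u p q F) = row_op v1 u p (q - 1) F"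
proof -
  let ?G = "row_op v1 u p (q - 1) F"
  obtain N where N: "(zbdiff q ^^ N) ?G = (\<lambda>x. 0)"
    using zbnil_row_op_right[OF assms(1), of "q - 1" q p] assms(2) by (auto simp: less_diff_conv)
  show ?thesis unfolding back_cut_def
  proof (rule neumann_eqI[OF zlinear_zbdiff N])
    have "zbdiff q (row_op v1 u p q F) = (\<lambda>x. zbdiff q (row_op v1 1 p q F) x
        + (u - 1) * zbdiff q (zbdiff q (row_op v1 1 p q F)) x)"
      using assms(2) by (subst row_op_right_weight) (simp_all add: zlinear_add[OF zlinear_zbdiff] zlinear_cmult[OF zlinear_zbdiff])
    then show "zbdiff q (row_op v1 u p q F) = (\<lambda>x. ?G x - (1 - u) * zbdiff q ?G x)"
      unfolding zbdiff_row_op[OF assms(2)] by (simp add: algebra_simps)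
  qed
qed

lemma row_op_empty: "row_op v1 u1 p (Suc p) F x = F (glue p x [])"
  by (simp add: row_op_def upt_Suc)

lemma finv_row_op:
  assumes "zpoly F" "p < q"
  shows "neumann (zdiff (Suc p)) (v - 1) (row_op v u1 p q F) = row_op 1 u1 p q F"
proof (cases "Suc p < q")
  case True
  obtain N where "znil (Suc p) N (row_op v u1 (Suc p) q F)"
    using znil_row_op_left[of F "Suc p" "Suc p" q] assms True by auto
  moreover have "zlinear (\<lambda>(F :: 'a zfun) x. - F x)"
    by (simp add: zlinear_def)
  ultimately have "znil (Suc p) N (\<lambda>x. - row_op v u1 (Suc p) q F x)"
    by (rule znil_image) (simp add: zdiff_def)
  then have "znil (Suc p) (Suc N) (row_op 1 u1 p q F)"
    unfolding znil_Suc zdiff_row_op[OF True] .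
  then show ?thesis unfolding znil_def
    by (rule neumann_eqI[OF zlinear_zdiff]) (subst row_op_left_weight[OF assms(2)], simp add: algebra_simps)
next
  case False
  \<comment> \<open>No summation variable is left: the row sum does not depend on
    \<open>x (Suc p)\<close>, and the inverse acts as the identity.\<close>
  then have q: "q = Suc p" using assms by simp
  have z: "zdiff (Suc p) (row_op v2 u1 p q F) = (\<lambda>x. 0)" for v2
    by (simp add: zdiff_def q row_op_empty glue_upd_mid)
  have "neumann (zdiff (Suc p)) (v - 1) (row_op v u1 p q F) = row_op v u1 p q F"
    by (rule neumann_eqI[OF zlinear_zdiff, where N = 1]) (simp_all add: z)
  then show ?thesis by (simp add: q row_op_empty fun_eq_iff)
qed

lemma binv_row_op:
  assumes "zpoly F" "p < q"
  shows "neumann (zbdiff q) (1 - u) (row_op v1 u p q F) = row_op v1 1 p q F"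
proof (cases "Suc p < q")
  case True
  obtain N where "(zbdiff q ^^ N) (row_op v1 u p (q - 1) F) = (\<lambda>x. 0)"
    using zbnil_row_op_right[OF assms(1), of "q - 1" q p] True by (auto simp: less_diff_conv)
  then have "(zbdiff q ^^ Suc N) (row_op v1 1 p q F) = (\<lambda>x. 0)"
    by (simp add: funpow_Suc_right zbdiff_row_op[OF True] del: funpow.simps)
  then show ?thesis
    by (rule neumann_eqI[OF zlinear_zbdiff]) (subst row_op_right_weight[OF True], simp add: algebra_simps)
next
  case False
  then have q: "q = Suc p" using assms by simp
  have z: "zbdiff q (row_op v1 u2 p q F) = (\<lambda>x. 0)" for u2
    by (simp add: zbdiff_def q row_op_empty glue_upd_mid)
  have "neumann (zbdiff q) (1 - u) (row_op v1 u p q F) = row_op v1 u p q F"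
    by (rule neumann_eqI[OF zlinear_zbdiff, where N = 1]) (simp_all add: z)
  then show ?thesis by (simp add: q row_op_empty fun_eq_iff)
qed

end

section \<open>Evaluation of row sums\<close>

definition weak_rows :: "int list \<Rightarrow> int list set" where
  "weak_rows ks = {ls. Suc (length ls) = length ks \<and> (\<forall>i<length ls. ks ! i \<le> ls ! i \<and> ls ! i \<le> ks ! Suc i)}"

definition strict_rows :: "int list \<Rightarrow> int list set" where
  "strict_rows ks = {ls \<in> weak_rows ks. \<forall>i. Suc i < length ls \<longrightarrow> ls ! i \<noteq> ls ! Suc i}"

abbreviation rows_avoiding :: "int list \<Rightarrow> int \<Rightarrow> int list set" where
  "rows_avoiding ks l \<equiv> {ls \<in> strict_rows ks. ls \<noteq> [] \<longrightarrow> hd ls \<noteq> l}"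

lemma weak_rows_Cons: "l # ls \<in> weak_rows (k # k' # ks) \<longleftrightarrow> k \<le> l \<and> l \<le> k' \<and> ls \<in> weak_rows (k' # ks)"
  by (auto simp: weak_rows_def All_less_Suc2)

lemma strict_rows_Cons:
  "l # ls \<in> strict_rows (k # k' # ks) \<longleftrightarrow> k \<le> l \<and> l \<le> k' \<and> ls \<in> strict_rows (k' # ks) \<and> (ls \<noteq> [] \<longrightarrow> hd ls \<noteq> l)"
proof -
  have "(\<forall>i. Suc i < length (l # ls) \<longrightarrow> (l # ls) ! i \<noteq> (l # ls) ! Suc i)
      \<longleftrightarrow> (ls \<noteq> [] \<longrightarrow> hd ls \<noteq> l) \<and> (\<forall>i. Suc i < length ls \<longrightarrow> ls ! i \<noteq> ls ! Suc i)"
    by (auto simp: nth_Cons hd_conv_nth split: nat.splits)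
  then show ?thesis
    by (auto simp: strict_rows_def weak_rows_Cons)
qed

lemma strict_rows_single [simp]: "strict_rows [k] = {[]}" "weak_rows [k] = {[]}"
  by (auto simp: strict_rows_def weak_rows_def)

lemma strict_rows_Cons_eq:
  "strict_rows (k # k' # ks) = (\<lambda>(l, ls). l # ls) ` (SIGMA l:{k..k'}. rows_avoiding (k' # ks) l)"
proof (rule Set.set_eqI, rule iffI)
  fix ls assume ls: "ls \<in> strict_rows (k # k' # ks)"
  then obtain l ls' where "ls = l # ls'" by (cases ls) (auto simp: strict_rows_def weak_rows_def)
  then show "ls \<in> (\<lambda>(l, ls). l # ls) ` (SIGMA l:{k..k'}. rows_avoiding (k' # ks) l)"
    using ls by (auto simp: strict_rows_Cons)
qed (auto simp: strict_rows_Cons)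

lemma finite_strict_rows: "ks \<noteq> [] \<Longrightarrow> finite (strict_rows ks)"
proof (induction ks)
  case (Cons k ks)
  then show ?case by (cases ks) (auto simp: strict_rows_Cons_eq intro!: finite_imageI)
qed simp

definition triple :: "int list \<Rightarrow> bool" where
  "triple ls \<longleftrightarrow> (\<exists>xs k ys. ls = xs @ k # k # k # ys)"

lemma triple_Cons: "triple ls \<Longrightarrow> triple (l # ls)"
  unfolding triple_def by (metis append_Cons)

context weights
begin

definition row_weight :: "'a \<Rightarrow> 'a \<Rightarrow> int list \<Rightarrow> int list \<Rightarrow> 'a" where
  "row_weight v1 u1 ks ls = (\<Prod>i<length ls. (if ls ! i = ks ! i then if i = 0 then v1 else v else 1)
     * (if ls ! i = ks ! Suc i then if Suc i = length ls then u1 else u else 1))"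

lemma row_weight_Nil [simp]: "row_weight v1 u1 ks [] = 1"
  by (simp add: row_weight_def)

lemma row_weight_Cons:
  "row_weight v1 u1 (k # k' # ks) (l # ls) = (if l = k then v1 else 1)
     * (if l = k' then if ls = [] then u1 else u else 1) * row_weight v u1 (k' # ks) ls"
  unfolding row_weight_def list.size add_0_right add_Suc_right prod.lessThan_Suc_shift
  by (auto intro!: prod.cong)

lemma row_weight_change_left:
  "ls \<noteq> [] \<Longrightarrow> hd ls \<noteq> hd ks \<Longrightarrow> ks \<noteq> [] \<Longrightarrow> row_weight v1 u1 ks ls = row_weight v2 u1 ks ls"
  unfolding row_weight_def by (intro prod.cong) (auto simp: hd_conv_nth)

lemma row_weight_0: "ls \<noteq> [] \<Longrightarrow> hd ls = hd ks \<Longrightarrow> ks \<noteq> [] \<Longrightarrow> row_weight 0 u1 ks ls = 0"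
  unfolding row_weight_def by (rule prod_zero) (auto simp: hd_conv_nth intro!: bexI[of _ 0])

text \<open>The value \<open>v1 = 0\<close> arises in the recursion, when an entry equals its upper
  bound \<open>k'\<close> and the next range has to start at \<open>k' + 1\<close>. Prefixing this
  entry turns vanishing at three equal entries into vanishing at rows that start with two entries
  \<open>k'\<close>, which is the last clause.\<close>

definition row_summable :: "'a \<Rightarrow> 'a \<Rightarrow> int list \<Rightarrow> (int list \<Rightarrow> 'a) \<Rightarrow> bool" where
  "row_summable v1 u1 ks f \<longleftrightarrow> ks \<noteq> [] \<and> (sorted_wrt (<) ks \<or>
     (u = 1 \<and> v = 1 \<and> u1 = 1 \<and> (v1 = 0 \<or> v1 = 1) \<and> sorted ks \<and>
      (\<forall>ls\<in>weak_rows ks. triple ls \<longrightarrow> f ls = 0) \<and>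
      (v1 = 0 \<longrightarrow> (\<forall>ls. hd ks # hd ks # ls \<in> weak_rows ks \<longrightarrow> f (hd ks # hd ks # ls) = 0))))"

text \<open>A zero weight at the left end expresses that the first entry differs from a preceding
  entry equal to \<open>hd ks\<close>.\<close>

lemma sum_strict_rows_hd:
  assumes "ks \<noteq> []"
  shows "(\<Sum>ls\<in>strict_rows ks. row_weight 0 u1 ks ls * f ls)
    = (\<Sum>ls\<in>rows_avoiding ks (hd ks). row_weight v u1 ks ls * f ls)"
proof (rule sum.mono_neutral_cong_right)
  show "\<And>ls. ls \<in> rows_avoiding ks (hd ks) \<Longrightarrow>
      row_weight 0 u1 ks ls * f ls = row_weight v u1 ks ls * f ls"
    using row_weight_change_left[OF _ _ assms, of _ 0 _ v] by (metis (mono_tags) mem_Collect_eq row_weight_Nil)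
qed (use assms in \<open>auto simp: finite_strict_rows row_weight_0\<close>)

text \<open>For weakly increasing \<open>ks\<close> the signed terms of the extended sum survive only at rows with
  three equal consecutive entries, which is why \<open>row_summable\<close> requires \<open>f\<close> to vanish there.\<close>

lemma row_sum_eq_sum_strict_rows:
  "row_summable v1 u1 ks f \<Longrightarrow> row_sum v1 u1 ks f = (\<Sum>ls\<in>strict_rows ks. row_weight v1 u1 ks ls * f ls)"
proof (induction ks arbitrary: v1 f)
  case Nil
  then show ?case by (simp add: row_summable_def)
next
  case (Cons k ks)
  show ?case
  proof (cases ks)
    case Nil
    then show ?thesis by simp
  next
    case ks: (Cons k' ks')
    let ?f = "\<lambda>l ls. f (l # ls)"
    define R where "R v1 l = row_sum v1 u1 (k' # ks') (?f l)" for v1 l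
    define R' where "R' l = (\<Sum>ls\<in>rows_avoiding (k' # ks') l. row_weight v u1 (k' # ks') ls * ?f l ls)" for l
    let ?u = "if ks' = [] then u1 else u"
    have le: "k \<le> k'" using Cons.prems by (auto simp: row_summable_def ks)
    have summ: "row_summable v u1 (k' # ks') (?f l)" if "l \<in> {k..k'}" for l
      using Cons.prems that by (auto simp: row_summable_def ks weak_rows_Cons triple_Cons)
    have summ0: "row_summable 0 u1 (k' # ks') (?f k')"
    proof -
      have "triple (k' # k' # k' # ls)" for ls by (metis triple_def append_Nil)
      then show ?thesis
        using Cons.prems le by (auto simp: row_summable_def ks weak_rows_Cons triple_Cons)
    qed
    have R0: "R 0 k' = R' k'"
      using Cons.IH[of 0 "?f k'"] summ0 sum_strict_rows_hd[of "k' # ks'" u1 "?f k'"] by (simp add: R_def R'_def ks)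
    have R: "R v l = R' l" if "l \<in> {k..<k'}" for l
    proof -
      have "ls \<noteq> [] \<longrightarrow> hd ls \<noteq> l" if "ls \<in> strict_rows (k' # ks')" for ls
        using that \<open>l \<in> {k..<k'}\<close> by (auto simp: strict_rows_def weak_rows_def hd_conv_nth)
      then have "rows_avoiding (k' # ks') l = strict_rows (k' # ks')" by blast
      then show ?thesis
        using Cons.IH[of v "?f l"] summ[of l] that by (simp add: R_def R'_def ks)
    qed
    have part_sum: "part_sum u1 a ks f = ext_sum a k' (R v) + ?u * R 0 k'" for a
      by (simp add: ks R_def[abs_def] row_sum_def)
    have "row_sum v1 u1 (k # ks) f = ext_sum k k' (R v) - (1 - v1) * R v k + ?u * R 0 k'"
      by (simp add: row_sum_def part_sum ext_sum_lower) (simp add: algebra_simps)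
    also have "\<dots> = (\<Sum>l\<in>{k..k'}. (if l = k then v1 else 1) * (if l = k' then ?u else 1) * R' l)"
    proof (cases "k < k'")
      case True
      have "{k..<k'} = insert k {k<..<k'}" "{k..k'} = insert k (insert k' {k<..<k'})"
        using True by auto
      then show ?thesis
        using True by (simp add: ext_sum_def R R0) (simp add: algebra_simps)
    next
      case False
      \<comment> \<open>For coinciding bounds the extended sum is empty. With \<open>v1 = 0\<close>
        the term \<open>- R v k\<close> remains; it cancels \<open>R 0 k'\<close> because
        \<open>f\<close> vanishes at rows starting with \<open>k\<close>, \<open>k\<close>.\<close>
      then have kk: "k' = k" using le by simp
      then have w: "u = 1" "v = 1" "u1 = 1" "v1 = 0 \<or> v1 = 1"
        using Cons.prems by (auto simp: row_summable_def ks)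
      have "R v k = R' k" if "v1 = 0"
      proof -
        have "R v k = (\<Sum>ls\<in>strict_rows (k # ks'). row_weight v u1 (k # ks') ls * ?f k ls)"
          using Cons.IH[of v "?f k"] summ[of k] le by (simp add: R_def ks kk)
        also have "\<dots> = R' k" unfolding R'_def kk
        proof (rule sum.mono_neutral_right)
          show "\<forall>ls\<in>strict_rows (k # ks') - rows_avoiding (k # ks') k. row_weight v u1 (k # ks') ls * ?f k ls = 0"
          proof
            fix ls assume ls: "ls \<in> strict_rows (k # ks') - rows_avoiding (k # ks') k"
            then obtain ls' where "ls = k # ls'" by (cases ls) auto
            moreover have "k # ls \<in> weak_rows (k # k # ks')"
              using ls by (simp add: weak_rows_Cons strict_rows_def)
            ultimately have "?f k ls = 0"
              using Cons.prems that by (auto simp: row_summable_def ks kk)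
            then show "row_weight v u1 (k # ks') ls * ?f k ls = 0" by simp
          qed
        qed (auto simp: finite_strict_rows)
        finally show ?thesis .
      qed
      then show ?thesis using w R0 kk by (auto simp: ext_sum_def)
    qed
    also have "\<dots> = (\<Sum>(l, ls)\<in>(SIGMA l:{k..k'}. rows_avoiding (k' # ks') l).
        row_weight v1 u1 (k # k' # ks') (l # ls) * f (l # ls))"
    proof -
      have e: "ls = [] \<longleftrightarrow> ks' = []" if "ls \<in> strict_rows (k' # ks')" for ls
        using that by (auto simp: strict_rows_def weak_rows_def)
      have "(if l = k then v1 else 1) * (if l = k' then ?u else 1) * R' l
         = (\<Sum>ls\<in>rows_avoiding (k' # ks') l.
             row_weight v1 u1 (k # k' # ks') (l # ls) * f (l # ls))" for l
        unfolding R'_def sum_distrib_left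
        by (rule sum.cong) (auto simp: row_weight_Cons e mult.assoc)
      then show ?thesis
        by (subst sum.Sigma[symmetric]) (auto simp: finite_strict_rows)
    qed
    also have "\<dots> = (\<Sum>ls\<in>strict_rows (k # ks). row_weight v1 u1 (k # ks) ls * f ls)"
      unfolding ks strict_rows_Cons_eq
      by (subst sum.reindex) (auto simp: inj_on_def case_prod_unfold)
    finally show ?thesis .
  qed
qed

end

section \<open>Removing the last row of a tree\<close>

lemma mem_ne_diag: "(i, j) \<in> ne_diag n k \<longleftrightarrow> j = k \<and> k \<le> i \<and> i \<le> n"
  by (auto simp: ne_diag_def)

lemma mem_se_diag: "k \<le> n \<Longrightarrow> (i, j) \<in> se_diag n k \<longleftrightarrow> 1 \<le> j \<and> j \<le> i \<and> i \<le> n \<and> k + i = n + j"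
  by (auto simp: se_diag_def)

lemma mem_st_shape:
  "(i, j) \<in> st_shape n l r s t \<longleftrightarrow> 1 \<le> j \<and> j \<le> i \<and> i \<le> n \<and> \<not> (j \<le> l \<and> n < i + s j)
     \<and> \<not> (n - r + 1 \<le> n + j - i \<and> n < i + t (n + j - i))"
proof -
  have "(\<exists>k\<in>{n-r+1..n}. (i, j) \<in> se_diag n k \<and> n < i + t k)
      \<longleftrightarrow> n - r + 1 \<le> n + j - i \<and> n < i + t (n + j - i)" if "1 \<le> j" "j \<le> i" "i \<le> n"
  proof
    assume "\<exists>k\<in>{n-r+1..n}. (i, j) \<in> se_diag n k \<and> n < i + t k"
    then obtain k where k: "k \<in> {n-r+1..n}" "(i, j) \<in> se_diag n k" "n < i + t k" by blast
    then have "k = n + j - i" by (auto simp: mem_se_diag)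
    with k show "n - r + 1 \<le> n + j - i \<and> n < i + t (n + j - i)" by auto
  next
    assume "n - r + 1 \<le> n + j - i \<and> n < i + t (n + j - i)"
    then show "\<exists>k\<in>{n-r+1..n}. (i, j) \<in> se_diag n k \<and> n < i + t k"
      using that by (intro bexI[of _ "n + j - i"]) (auto simp: mem_se_diag)
  qed
  then show ?thesis
    by (auto simp: st_shape_def triangle_cells_def bottom_cells_def mem_ne_diag)
qed

lemma is_bottom_cong: "S \<inter> D = S' \<inter> D' \<Longrightarrow> is_bottom S D c \<longleftrightarrow> is_bottom S' D' c"
  by (simp add: is_bottom_def)

lemma is_bottom_last_row:
  assumes "(n, j) \<in> S \<inter> D" "\<And>i j'. (i, j') \<in> S \<inter> D \<Longrightarrow> i \<le> n \<and> (i = n \<longrightarrow> j' = j)"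
  shows "is_bottom S D c \<longleftrightarrow> c = (n, j)"
proof
  assume c: "is_bottom S D c"
  then have "fst (n, j) \<le> fst c" using assms(1) unfolding is_bottom_def by blast
  then show "c = (n, j)" using c assms(2)[of "fst c" "snd c"] by (auto simp: is_bottom_def prod_eq_iff)
next
  assume c: "c = (n, j)"
  have "fst c' \<le> fst c" if "c' \<in> S \<inter> D" for c'
    using assms(2)[of "fst c'" "snd c'"] that c by simp
  then show "is_bottom S D c" using assms(1) c unfolding is_bottom_def by blast
qed

text \<open>Exactly the NE-diagonals \<open>1, \<dots>, p\<close> and the SE-diagonals \<open>q + 1, \<dots>, Suc n\<close> have deleted entries, so
  the last row of the shape consists of the positions \<open>p + 1, \<dots>, q\<close>.  Without this row the shape has
  order \<open>n\<close>, and the SE-diagonal \<open>k + 1\<close> becomes the SE-diagonal \<open>k\<close>.\<close>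

locale row_step =
  fixes n l r :: nat and s t :: "nat \<Rightarrow> nat" and p q :: nat
  assumes n: "n \<ge> 1"
    and lr: "l + r \<le> Suc n"
    and nonint: "noninterfering (Suc n) l r s t"
    and pl: "p \<le> l" and p: "\<And>i. i \<in> {1..l} \<Longrightarrow> 0 < s i \<longleftrightarrow> i \<le> p"
    and qr: "Suc n - r \<le> q" "q \<le> Suc n" and q: "\<And>k. k \<in> {Suc n - r + 1..Suc n} \<Longrightarrow> 0 < t k \<longleftrightarrow> q < k"
begin

abbreviation S where "S \<equiv> st_shape (Suc n) l r s t"
abbreviation S' where "S' \<equiv> st_shape n p (Suc n - q) (\<lambda>i. s i - Suc 0) (\<lambda>k. t (Suc k) - Suc 0)"

text \<open>Otherwise \<open>p = q\<close> and the last row is empty. Then \<open>(n, p)\<close> is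
  deleted, or becomes the bottom entry, in a NE-diagonal and in a SE-diagonal at the same time,
  which \<open>noninterfering\<close> excludes; for \<open>p = 0\<close> or \<open>p = Suc n\<close>
  a diagonal of length 1 would be exhausted.\<close>

lemma p_less_q: "p < q"
proof (rule ccontr)
  assume "\<not> p < q"
  then have pq: "p = q" using pl lr qr by linarith
  show False
  proof (cases "p \<ge> 1 \<and> p < Suc n")
    case True
    then have "(n, p) \<in> bottom_cells (Suc n) (s p + 1) (ne_diag (Suc n) p)"
      using p[of p] pl by (auto simp: bottom_cells_def mem_ne_diag)
    moreover have "(n, p) \<in> bottom_cells (Suc n) (t (Suc q) + 1) (se_diag (Suc n) (Suc q))"
      using True pq q[of "Suc q"] qr lr by (auto simp: bottom_cells_def mem_se_diag)
    moreover have "bottom_cells (Suc n) (s p + 1) (ne_diag (Suc n) p)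
       \<inter> bottom_cells (Suc n) (t (Suc q) + 1) (se_diag (Suc n) (Suc q)) = {}"
      using nonint True pq qr pl by (auto simp: noninterfering_def)
    ultimately show False by blast
  next
    case False
    then consider "p = 0" | "p = Suc n" using pq qr by linarith
    then show False
    proof cases
      case 1
      then have "t 1 > 0" using q[of 1] pq qr by auto
      moreover have "t 1 < 1" using 1 pq qr nonint by (auto simp: noninterfering_def)
      ultimately show False by simp
    next
      case 2
      then have "s (Suc n) > 0" using p[of "Suc n"] pl lr by auto
      moreover have "s (Suc n) < 1" using 2 pl lr nonint by (force simp: noninterfering_def)
      ultimately show False by simp
    qed
  qed
qed

lemma mem_S_below: "i \<le> n \<Longrightarrow> (i, j) \<in> S \<longleftrightarrow> (i, j) \<in> S'"
proof -
  assume i: "i \<le> n"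
  show ?thesis
  proof (cases "1 \<le> j \<and> j \<le> i")
    case True
    have 1: "j \<le> l \<and> Suc n < i + s j \<longleftrightarrow> j \<le> p \<and> n < i + (s j - 1)"
      using p[of j] pl i True by auto
    have 2: "Suc n - r + 1 \<le> Suc n + j - i \<and> Suc n < i + t (Suc n + j - i)
       \<longleftrightarrow> n - (Suc n - q) + 1 \<le> n + j - i \<and> n < i + (t (Suc (n + j - i)) - 1)"
    proof -
      have e: "Suc n + j - i = Suc (n + j - i)" using i by simp
      have "n - (Suc n - q) + 1 \<le> n + j - i \<longleftrightarrow> q \<le> n + j - i"
        using qr(2) p_less_q True i by auto
      moreover have "Suc n - r + 1 \<le> Suc (n + j - i) \<Longrightarrow> 0 < t (Suc (n + j - i)) \<longleftrightarrow> q < Suc (n + j - i)"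
        using True i by (intro q) auto
      ultimately show ?thesis unfolding e using qr(1) i by auto
    qed
    show ?thesis unfolding mem_st_shape 1 2 using i by auto
  qed (auto simp: mem_st_shape)
qed

lemma S'_below: "(i, j) \<in> S' \<Longrightarrow> i \<le> n"
  by (simp add: mem_st_shape)

lemma mem_S_last: "(Suc n, j) \<in> S \<longleftrightarrow> p < j \<and> j \<le> q"
proof (cases "1 \<le> j \<and> j \<le> Suc n")
  case True
  have "Suc n < Suc n + s j \<longleftrightarrow> j \<le> p" if "j \<le> l" using p[of j] True that by auto
  moreover have "Suc n < Suc n + t j \<longleftrightarrow> q < j" if "Suc n - r + 1 \<le> j" using q[of j] True that by auto
  ultimately show ?thesis
    using True pl qr unfolding mem_st_shape
    by (cases "j \<le> l"; cases "Suc n - r + 1 \<le> j") auto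
qed (use p_less_q qr in \<open>auto simp: mem_st_shape\<close>)

lemma S_cases: "(i, j) \<in> S \<longleftrightarrow> (i, j) \<in> S' \<or> (i = Suc n \<and> p < j \<and> j \<le> q)"
proof (cases "i \<le> n")
  case True
  then show ?thesis using mem_S_below[of i j] by auto
next
  case False
  then show ?thesis
    using mem_S_last[of j] S'_below[of i j] mem_st_shape[of i j "Suc n"] by (cases "i = Suc n") auto
qed

lemma S'_last: "p < j \<Longrightarrow> j < q \<Longrightarrow> (n, j) \<in> S'"
  using qr by (auto simp: mem_st_shape)

lemma top_S': "(1, 1) \<in> S'"
proof -
  have st: "\<forall>i\<in>{1..l}. s i < Suc n - i + 1" "\<forall>k\<in>{Suc n - r + 1..Suc n}. t k < k"
    using nonint by (simp_all add: noninterfering_def)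
  have "s 1 < Suc n" if "1 \<le> p"
    using st(1)[THEN bspec, of 1] that pl by simp
  moreover have "t (Suc n) < Suc n" if "q \<le> n"
    using st(2)[THEN bspec, of "Suc n"] that qr by simp
  ultimately show ?thesis
    using n qr p_less_q by (auto simp: mem_st_shape)
qed

lemma bottom_ne_left: "1 \<le> i \<Longrightarrow> i \<le> p \<Longrightarrow> is_bottom S (ne_diag (Suc n) i) c \<longleftrightarrow> is_bottom S' (ne_diag n i) c"
proof (rule is_bottom_cong)
  assume i: "1 \<le> i" "i \<le> p"
  have "(a, b) \<in> S \<inter> ne_diag (Suc n) i \<longleftrightarrow> (a, b) \<in> S' \<inter> ne_diag n i" for a b
    using i S'_below[of a b] by (auto simp: S_cases mem_ne_diag)
  then show "S \<inter> ne_diag (Suc n) i = S' \<inter> ne_diag n i" by auto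
qed

lemma bottom_se_right:
  "q < k \<Longrightarrow> k \<le> Suc n \<Longrightarrow> is_bottom S (se_diag (Suc n) k) c \<longleftrightarrow> is_bottom S' (se_diag n (k - 1)) c"
proof (rule is_bottom_cong)
  assume k: "q < k" "k \<le> Suc n"
  have "(a, b) \<in> S \<inter> se_diag (Suc n) k \<longleftrightarrow> (a, b) \<in> S' \<inter> se_diag n (k - 1)" for a b
    using k S'_below[of a b] by (auto simp: S_cases mem_se_diag)
  then show "S \<inter> se_diag (Suc n) k = S' \<inter> se_diag n (k - 1)" by auto
qed

lemma bottom_ne_mid: "p < i \<Longrightarrow> i \<le> q \<Longrightarrow> is_bottom S (ne_diag (Suc n) i) c \<longleftrightarrow> c = (Suc n, i)"
  by (rule is_bottom_last_row) (use qr in \<open>auto simp: S_cases mem_ne_diag dest: S'_below\<close>)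

lemma bottom_se_mid: "p < i \<Longrightarrow> i \<le> q \<Longrightarrow> is_bottom S (se_diag (Suc n) i) c \<longleftrightarrow> c = (Suc n, i)"
  by (rule is_bottom_last_row) (use qr in \<open>auto simp: S_cases mem_se_diag dest: S'_below\<close>)

lemma bottom_ne_mid': "p < i \<Longrightarrow> i < q \<Longrightarrow> is_bottom S' (ne_diag n i) c \<longleftrightarrow> c = (n, i)"
  by (rule is_bottom_last_row) (use qr S'_last[of i] in \<open>auto simp: mem_ne_diag\<close>)

lemma regular_S: "regular_cell S i j \<longleftrightarrow> regular_cell S' i j \<or> (i = n \<and> p < j \<and> j < q)"
proof -
  consider "Suc i \<le> n" | "i = n" | "i > n" by linarith
  then show ?thesis
  proof cases
    case 1
    then show ?thesis by (auto simp: regular_cell_def mem_S_below)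
  next
    case 2
    then show ?thesis
      using S'_last[of j] by (auto simp: regular_cell_def mem_S_last S_cases dest: S'_below)
  next
    case 3
    then show ?thesis
      by (auto simp: regular_cell_def S_cases dest: S'_below)
  qed
qed

lemma regular_S': "regular_cell S' i j \<Longrightarrow> Suc i \<le> n"
  by (auto simp: regular_cell_def dest: S'_below)

abbreviation trees where "trees b \<equiv> st_trees (Suc n) l r s t b"
abbreviation trees' where "trees' b \<equiv> st_trees n p (Suc n - q) (\<lambda>i. s i - Suc 0) (\<lambda>k. t (Suc k) - Suc 0) b"

text \<open>For \<open>p < j \<le> q\<close> the NE-diagonal and the SE-diagonal of index
  \<open>j\<close> have the same bottom cell \<open>(Suc n, j)\<close>. So the change from NE- to
  SE-prescriptions after index \<open>Suc n - r\<close> disappears, and only \<open>p\<close> and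
  \<open>q\<close> matter.\<close>

lemma mem_trees:
  "T \<in> trees b \<longleftrightarrow> is_tree S T \<and> (\<forall>i\<in>{1..p}. \<exists>c. is_bottom S' (ne_diag n i) c \<and> T c = b i)
     \<and> (\<forall>j. p < j \<longrightarrow> j \<le> q \<longrightarrow> T (Suc n, j) = b j)
     \<and> (\<forall>k\<in>{q<..Suc n}. \<exists>c. is_bottom S' (se_diag n (k - 1)) c \<and> T c = b k)"
proof -
  have 1: "(\<forall>i\<in>{1..Suc n - r}. \<exists>c. is_bottom S (ne_diag (Suc n) i) c \<and> T c = b i)
    \<longleftrightarrow> (\<forall>i\<in>{1..p}. \<exists>c. is_bottom S' (ne_diag n i) c \<and> T c = b i)
     \<and> (\<forall>j\<in>{p<..Suc n - r}. T (Suc n, j) = b j)"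
  proof -
    have "{1..Suc n - r} = {1..p} \<union> {p<..Suc n - r}" using pl lr by auto
    moreover have "(\<exists>c. is_bottom S (ne_diag (Suc n) i) c \<and> T c = b i) \<longleftrightarrow> T (Suc n, i) = b i"
      if "i \<in> {p<..Suc n - r}" for i using that qr by (auto simp: bottom_ne_mid)
    moreover have "(\<exists>c. is_bottom S (ne_diag (Suc n) i) c \<and> T c = b i) \<longleftrightarrow> (\<exists>c. is_bottom S' (ne_diag n i) c \<and> T c = b i)"
      if "i \<in> {1..p}" for i using that by (auto simp: bottom_ne_left)
    ultimately show ?thesis by (simp add: ball_Un)
  qed
  have 2: "(\<forall>k\<in>{Suc n-r+1..Suc n}. \<exists>c. is_bottom S (se_diag (Suc n) k) c \<and> T c = b k)
    \<longleftrightarrow> (\<forall>k\<in>{q<..Suc n}. \<exists>c. is_bottom S' (se_diag n (k - 1)) c \<and> T c = b k)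
     \<and> (\<forall>j\<in>{Suc n-r+1..q}. T (Suc n, j) = b j)"
  proof -
    have "{Suc n-r+1..Suc n} = {q<..Suc n} \<union> {Suc n-r+1..q}" using qr by auto
    moreover have "(\<exists>c. is_bottom S (se_diag (Suc n) i) c \<and> T c = b i) \<longleftrightarrow> T (Suc n, i) = b i"
      if "i \<in> {Suc n-r+1..q}" for i using that pl lr by (auto simp: bottom_se_mid)
    moreover have "(\<exists>c. is_bottom S (se_diag (Suc n) i) c \<and> T c = b i) \<longleftrightarrow> (\<exists>c. is_bottom S' (se_diag n (i - 1)) c \<and> T c = b i)"
      if "i \<in> {q<..Suc n}" for i using that by (auto simp: bottom_se_right)
    ultimately show ?thesis by (simp add: ball_Un)
  qed
  have 3: "(\<forall>j\<in>{p<..Suc n - r}. T (Suc n, j) = b j) \<and> (\<forall>j\<in>{Suc n-r+1..q}. T (Suc n, j) = b j)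
      \<longleftrightarrow> (\<forall>j. p < j \<longrightarrow> j \<le> q \<longrightarrow> T (Suc n, j) = b j)"
  proof -
    have "{p<..q} = {p<..Suc n - r} \<union> {Suc n-r+1..q}" using qr pl lr by auto
    then have "(\<forall>j\<in>{p<..Suc n - r}. T (Suc n, j) = b j) \<and> (\<forall>j\<in>{Suc n-r+1..q}. T (Suc n, j) = b j)
      \<longleftrightarrow> (\<forall>j\<in>{p<..q}. T (Suc n, j) = b j)" by (simp add: ball_Un)
    then show ?thesis by auto
  qed
  show ?thesis unfolding st_trees_def mem_Collect_eq 1 2 using 3 by blast
qed

lemma mem_trees':
  "T \<in> trees' b \<longleftrightarrow> is_tree S' T \<and> (\<forall>i\<in>{1..p}. \<exists>c. is_bottom S' (ne_diag n i) c \<and> T c = b i)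
     \<and> (\<forall>j. p < j \<longrightarrow> j < q \<longrightarrow> T (n, j) = b j)
     \<and> (\<forall>k\<in>{q<..Suc n}. \<exists>c. is_bottom S' (se_diag n (k - 1)) c \<and> T c = b (k - 1))"
proof -
  have "{1..n - (Suc n - q)} = {1..p} \<union> {p<..<q}" using qr p_less_q by auto
  moreover have "(\<exists>c. is_bottom S' (ne_diag n i) c \<and> T c = b i) \<longleftrightarrow> T (n, i) = b i"
    if "i \<in> {p<..<q}" for i using that by (auto simp: bottom_ne_mid')
  ultimately have 1: "(\<forall>i\<in>{1..n - (Suc n - q)}. \<exists>c. is_bottom S' (ne_diag n i) c \<and> T c = b i)
    \<longleftrightarrow> (\<forall>i\<in>{1..p}. \<exists>c. is_bottom S' (ne_diag n i) c \<and> T c = b i) \<and> (\<forall>j\<in>{p<..<q}. T (n, j) = b j)"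
    by (simp add: ball_Un)
  have "{n - (Suc n - q) + 1..n} = (\<lambda>k. k - 1) ` {q<..Suc n}"
  proof -
    have "n - (Suc n - q) + 1 = q" using qr p_less_q by auto
    moreover have "{q..n} = (\<lambda>k. k - 1) ` {q<..Suc n}"
    proof (intro subset_antisym subsetI)
      fix k assume "k \<in> {q..n}"
      then have "Suc k \<in> {q<..Suc n}" "k = Suc k - 1" by auto
      then show "k \<in> (\<lambda>k. k - 1) ` {q<..Suc n}" by blast
    qed auto
    ultimately show ?thesis by simp
  qed
  then have 2: "(\<forall>k\<in>{n - (Suc n - q) + 1..n}. \<exists>c. is_bottom S' (se_diag n k) c \<and> T c = b k)
     \<longleftrightarrow> (\<forall>k\<in>{q<..Suc n}. \<exists>c. is_bottom S' (se_diag n (k - 1)) c \<and> T c = b (k - 1))"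
    by simp
  show ?thesis unfolding st_trees_def mem_Collect_eq 1 2 by auto
qed

end

lemma prod_if_power:
  "finite A \<Longrightarrow> (\<Prod>i\<in>A. if P i then c else 1) = (c::'a::comm_monoid_mult) ^ card {i \<in> A. P i}"
  by (simp flip: prod.inter_filter)

section \<open>The bijection between trees and pairs of a row and a smaller tree\<close>

context row_step
begin

abbreviation bottom_row :: "(nat \<Rightarrow> int) \<Rightarrow> int list" where
  "bottom_row b \<equiv> map b [Suc p..<Suc q]"

definition next_row :: "(nat \<times> nat \<Rightarrow> int) \<Rightarrow> int list" where
  "next_row T = map (\<lambda>j. T (n, j)) [Suc p..<q]"

definition extend :: "(nat \<Rightarrow> int) \<Rightarrow> (nat \<times> nat \<Rightarrow> int) \<Rightarrow> nat \<times> nat \<Rightarrow> int" where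
  "extend b T c = (if c \<in> S' then T c
     else if fst c = Suc n \<and> p < snd c \<and> snd c \<le> q then b (snd c) else undefined)"

lemma length_next_row [simp]: "length (next_row T) = q - Suc p"
  by (simp add: next_row_def)

lemma nth_next_row: "i < q - Suc p \<Longrightarrow> next_row T ! i = T (n, Suc (i + p))"
  by (simp add: next_row_def add.commute)

lemma nth_bottom_row: "i < q - p \<Longrightarrow> bottom_row b ! i = b (Suc (i + p))"
  by (auto simp: add.commute)

lemma mem_strict_rows:
  "ls \<in> strict_rows (bottom_row b) \<longleftrightarrow> length ls = q - Suc p
     \<and> (\<forall>i<q - Suc p. b (Suc (i + p)) \<le> ls ! i \<and> ls ! i \<le> b (Suc (Suc (i + p))))
     \<and> (\<forall>i. Suc i < q - Suc p \<longrightarrow> ls ! i \<noteq> ls ! Suc i)"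
proof -
  have "Suc (length ls) = length (bottom_row b) \<longleftrightarrow> length ls = q - Suc p"
    using p_less_q by auto
  moreover have "bottom_row b ! i = b (Suc (i + p)) \<and> bottom_row b ! Suc i = b (Suc (Suc (i + p)))"
    if "i < q - Suc p" for i
    using that by (auto simp: add.commute)
  ultimately show ?thesis
    by (auto simp: strict_rows_def weak_rows_def)
qed

lemma all_between: "(\<forall>j. p < j \<longrightarrow> j < q \<longrightarrow> P j) \<longleftrightarrow> (\<forall>i<q - Suc p. P (Suc (i + p)))"
proof safe
  fix j assume "\<forall>i<q - Suc p. P (Suc (i + p))" "p < j" "j < q"
  then show "P j" by (auto dest!: spec[of _ "j - Suc p"])
qed auto

lemma is_tree_S:
  "is_tree S T \<longleftrightarrow> T \<in> extensional S \<and> is_tree S' (restrict T S')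
     \<and> (\<forall>j. p < j \<longrightarrow> j < q \<longrightarrow> T (Suc n, j) \<le> T (n, j) \<and> T (n, j) \<le> T (Suc n, Suc j))
     \<and> (\<forall>j. p < j \<longrightarrow> Suc j < q \<longrightarrow> T (n, j) \<noteq> T (n, Suc j))"
proof -
  have r: "restrict T S' (i, j) = T (i, j)" "restrict T S' (Suc i, j) = T (Suc i, j)"
    "restrict T S' (Suc i, Suc j) = T (Suc i, Suc j)" if "regular_cell S' i j" for i j
    using that by (auto simp: regular_cell_def)
  have 1: "(\<forall>i j. regular_cell S i j \<longrightarrow> T (i + 1, j) \<le> T (i, j) \<and> T (i, j) \<le> T (i + 1, j + 1))
     \<longleftrightarrow> (\<forall>i j. regular_cell S' i j \<longrightarrow> restrict T S' (i + 1, j) \<le> restrict T S' (i, j)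
           \<and> restrict T S' (i, j) \<le> restrict T S' (i + 1, j + 1))
       \<and> (\<forall>j. p < j \<longrightarrow> j < q \<longrightarrow> T (Suc n, j) \<le> T (n, j) \<and> T (n, j) \<le> T (Suc n, Suc j))"
    unfolding regular_S by (auto simp del: restrict_apply simp: r)
  have 2: "(\<forall>i j. regular_cell S i j \<and> regular_cell S i (j + 1) \<longrightarrow> T (i, j) \<noteq> T (i, j + 1))
     \<longleftrightarrow> (\<forall>i j. regular_cell S' i j \<and> regular_cell S' i (j + 1) \<longrightarrow> restrict T S' (i, j) \<noteq> restrict T S' (i, j + 1))
       \<and> (\<forall>j. p < j \<longrightarrow> Suc j < q \<longrightarrow> T (n, j) \<noteq> T (n, Suc j))"
    unfolding regular_S by (auto simp del: restrict_apply simp: r dest: regular_S')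
  show ?thesis unfolding is_tree_def 1 2 by auto
qed

lemma bottom_S': "is_bottom S' D c \<Longrightarrow> c \<in> S'"
  by (simp add: is_bottom_def)

lemma bottom_value_cong:
  "(\<And>c. c \<in> S' \<Longrightarrow> T c = T' c) \<Longrightarrow> (\<exists>c. is_bottom S' D c \<and> T c = a) \<longleftrightarrow> (\<exists>c. is_bottom S' D c \<and> T' c = a)"
  using bottom_S' by metis

lemma glue_left: "i \<le> p \<Longrightarrow> glue p b ls i = b i"
  by (simp add: glue_def)

lemma glue_right: "length ls = q - Suc p \<Longrightarrow> q < k \<Longrightarrow> glue p b ls (k - Suc 0) = b k"
  using p_less_q by (auto simp: glue_def)

lemma glue_mid: "length ls = q - Suc p \<Longrightarrow> i < q - Suc p \<Longrightarrow> glue p b ls (Suc (i + p)) = ls ! i"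
  by (auto simp: glue_def)

lemma tree_split:
  assumes T: "T \<in> trees b"
  shows "next_row T \<in> strict_rows (bottom_row b)"
    and "restrict T S' \<in> trees' (glue p b (next_row T))"
    and "extend b (restrict T S') = T"
proof -
  have row: "T (Suc n, j) = b j" if "p < j" "j \<le> q" for j
    using T that by (simp add: mem_trees)
  have tree: "is_tree S T" using T by (simp add: mem_trees)
  show "next_row T \<in> strict_rows (bottom_row b)"
    using tree row by (auto simp: mem_strict_rows nth_next_row is_tree_S)
  have c: "(\<exists>c. is_bottom S' D c \<and> restrict T S' c = a) \<longleftrightarrow> (\<exists>c. is_bottom S' D c \<and> T c = a)" for D a
    by (rule bottom_value_cong) simp
  show "restrict T S' \<in> trees' (glue p b (next_row T))"
    unfolding mem_trees' c all_between
    using T tree S'_last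
    by (auto simp: mem_trees is_tree_S glue_left glue_right[OF length_next_row] glue_mid[OF length_next_row] nth_next_row)
  show "extend b (restrict T S') = T"
  proof
    fix c :: "nat \<times> nat"
    obtain i j where c: "c = (i, j)" by (cases c)
    have "(i, j) \<notin> S \<Longrightarrow> T (i, j) = undefined"
      using tree by (simp add: is_tree_def extensional_def)
    then show "extend b (restrict T S') c = T c"
      using row[of j] S_cases[of i j] by (auto simp: extend_def c)
  qed
qed

lemma extend_S': "c \<in> S' \<Longrightarrow> extend b T c = T c"
  by (simp add: extend_def)

lemma extend_row: "p < j \<Longrightarrow> j \<le> q \<Longrightarrow> extend b T (Suc n, j) = b j"
  by (auto simp: extend_def dest: S'_below)

lemma tree_join:
  assumes ls: "ls \<in> strict_rows (bottom_row b)" and T: "T \<in> trees' (glue p b ls)"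
  shows "extend b T \<in> trees b" and "next_row (extend b T) = ls" and "restrict (extend b T) S' = T"
proof -
  have len: "length ls = q - Suc p" using ls by (simp add: mem_strict_rows)
  have tree: "is_tree S' T" using T by (simp add: mem_trees')
  show res: "restrict (extend b T) S' = T"
    using tree by (auto simp: is_tree_def extensional_def extend_def restrict_def fun_eq_iff)
  have "T (n, Suc (i + p)) = ls ! i" if "i < q - Suc p" for i
    using T that unfolding mem_trees' by (auto simp: glue_mid[OF len])
  then have row: "extend b T (n, Suc (i + p)) = ls ! i" if "i < q - Suc p" for i
    using that S'_last[of "Suc (i + p)"] by (simp add: extend_S')
  show "next_row (extend b T) = ls"
    by (rule nth_equalityI) (use len row in \<open>auto simp: nth_next_row\<close>)
  have c: "(\<exists>c. is_bottom S' D c \<and> extend b T c = a) \<longleftrightarrow> (\<exists>c. is_bottom S' D c \<and> T c = a)" for D a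
    by (rule bottom_value_cong) (rule extend_S')
  have "extend b T \<in> extensional S"
    using S_cases by (auto simp: extensional_def extend_def)
  moreover have "\<forall>j. p < j \<longrightarrow> j < q \<longrightarrow> extend b T (Suc n, j) \<le> extend b T (n, j)
      \<and> extend b T (n, j) \<le> extend b T (Suc n, Suc j)"
    unfolding all_between using ls by (auto simp: mem_strict_rows row extend_row)
  moreover have "extend b T (n, j) \<noteq> extend b T (n, Suc j)" if "p < j" "Suc j < q" for j
    using ls that row[of "j - Suc p"] row[of "j - p"]
    by (auto simp: mem_strict_rows Suc_diff_Suc dest: spec[of _ "j - Suc p"])
  ultimately have "is_tree S (extend b T)"
    unfolding is_tree_S res using tree by blast
  then show "extend b T \<in> trees b"
    unfolding mem_trees c using T
    by (auto simp: mem_trees' extend_row glue_left glue_right[OF len])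
qed

lemma trees_eq_image:
  "trees b = (\<lambda>(ls, T). extend b T) ` (SIGMA ls:strict_rows (bottom_row b). trees' (glue p b ls))"
proof (intro subset_antisym subsetI)
  fix T assume T: "T \<in> trees b"
  show "T \<in> (\<lambda>(ls, T). extend b T) ` (SIGMA ls:strict_rows (bottom_row b). trees' (glue p b ls))"
    using tree_split[OF T] by (intro image_eqI[of _ _ "(next_row T, restrict T S')"]) auto
qed (auto intro: tree_join)

lemma finite_bottom_rows: "finite (strict_rows (bottom_row b))"
  using p_less_q by (intro finite_strict_rows) simp

lemma finite_trees:
  "(\<And>ls. ls \<in> strict_rows (bottom_row b) \<Longrightarrow> finite (trees' (glue p b ls))) \<Longrightarrow> finite (trees b)"
  unfolding trees_eq_image by (intro finite_imageI finite_SigmaI finite_bottom_rows)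

lemma sum_trees:
  assumes "\<And>ls. ls \<in> strict_rows (bottom_row b) \<Longrightarrow> finite (trees' (glue p b ls))"
  shows "(\<Sum>T\<in>trees b. g T) = (\<Sum>ls\<in>strict_rows (bottom_row b). \<Sum>T\<in>trees' (glue p b ls). g (extend b T))"
proof -
  have "inj_on (\<lambda>(ls, T). extend b T) (SIGMA ls:strict_rows (bottom_row b). trees' (glue p b ls))"
    by (auto simp: inj_on_def) (metis tree_join(2), metis tree_join(3))
  then have "(\<Sum>T\<in>trees b. g T) = (\<Sum>(ls, T)\<in>(SIGMA ls:strict_rows (bottom_row b). trees' (glue p b ls)). g (extend b T))"
    unfolding trees_eq_image by (subst sum.reindex) (auto simp: case_prod_unfold)
  also have "\<dots> = (\<Sum>ls\<in>strict_rows (bottom_row b). \<Sum>T\<in>trees' (glue p b ls). g (extend b T))"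
    by (rule sum.Sigma[symmetric]) (use assms finite_bottom_rows in auto)
  finally show ?thesis .
qed

section \<open>Inversion numbers under removal of the last row\<close>

lemma finite_regular: "finite {(i, j). regular_cell S' i j \<and> P i j}"
proof (rule finite_subset)
  show "{(i, j). regular_cell S' i j \<and> P i j} \<subseteq> {..n} \<times> {..n}"
    by (auto simp: regular_cell_def mem_st_shape)
qed simp

lemma card_regular_split:
  assumes "\<And>i j. regular_cell S' i j \<Longrightarrow> P i j \<longleftrightarrow> P' i j"
  shows "card {(i, j). regular_cell S i j \<and> P i j}
    = card {(i, j). regular_cell S' i j \<and> P' i j} + card {i \<in> {..<q - Suc p}. P n (Suc (i + p))}"
proof -
  let ?A = "{(i, j). regular_cell S' i j \<and> P' i j}"
  let ?B = "(\<lambda>i. (n, Suc (i + p))) ` {i \<in> {..<q - Suc p}. P n (Suc (i + p))}"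
  have "(i, j) \<in> ?B" if "p < j" "j < q" "P n j" "i = n" for i j
    using that by (auto intro!: image_eqI[of _ _ "j - Suc p"])
  then have "{(i, j). regular_cell S i j \<and> P i j} = ?A \<union> ?B"
    unfolding regular_S using assms by auto
  moreover have "?A \<inter> ?B = {}" by (auto dest: regular_S')
  moreover have "card ?B = card {i \<in> {..<q - Suc p}. P n (Suc (i + p))}"
    by (rule card_image) (auto simp: inj_on_def)
  ultimately show ?thesis
    by (simp add: card_Un_disjoint finite_regular)
qed

text \<open>Of the NE-diagonals in \<open>I\<close> only the one of index \<open>Suc p\<close> can
  reach the last row, namely in its leftmost cell. So the new inversions are counted as before
  except at the left end of the row.\<close>

lemma inv_vI_split:
  assumes "I \<subseteq> {1..Suc p}"
  shows "inv_vI (Suc n) S I (extend b T) = inv_vI n S' (I - {Suc p}) T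
    + card {i \<in> {..<q - Suc p}. next_row (extend b T) ! i = bottom_row b ! i \<and> \<not> (i = 0 \<and> Suc p \<in> I)}"
proof -
  have 1: "(\<exists>k\<in>I. is_bottom S (ne_diag (Suc n) k) (Suc i, j))
      \<longleftrightarrow> (\<exists>k\<in>I - {Suc p}. is_bottom S' (ne_diag n k) (Suc i, j))" if "regular_cell S' i j" for i j
  proof -
    have "\<not> is_bottom S (ne_diag (Suc n) (Suc p)) (Suc i, j)"
      using regular_S'[OF that] p_less_q by (simp add: bottom_ne_mid)
    moreover have "is_bottom S (ne_diag (Suc n) k) (Suc i, j) \<longleftrightarrow> is_bottom S' (ne_diag n k) (Suc i, j)"
      if "k \<in> I - {Suc p}" for k
      using assms that by (intro bottom_ne_left) force+
    ultimately show ?thesis by (metis DiffI DiffD1 singletonD)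
  qed
  have 2: "(\<exists>k\<in>I. is_bottom S (ne_diag (Suc n) k) (Suc n, Suc (i + p))) \<longleftrightarrow> i = 0 \<and> Suc p \<in> I" for i
  proof -
    have "\<not> is_bottom S (ne_diag (Suc n) k) (Suc n, Suc (i + p))" if "k \<in> I" "k \<noteq> Suc p" for k
      using assms that bottom_ne_left[of k] by (force dest!: bottom_S' S'_below)
    moreover have "is_bottom S (ne_diag (Suc n) (Suc p)) (Suc n, Suc (i + p)) \<longleftrightarrow> i = 0"
      using p_less_q by (simp add: bottom_ne_mid)
    ultimately show ?thesis by blast
  qed
  have "inv_vI (Suc n) S I (extend b T) = inv_vI n S' (I - {Suc p}) T
    + card {i \<in> {..<q - Suc p}. extend b T (n, Suc (i + p)) = extend b T (Suc n, Suc (i + p)) \<and>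
        \<not> (\<exists>k\<in>I. is_bottom S (ne_diag (Suc n) k) (Suc n, Suc (i + p)))}"
    unfolding inv_vI_def
    by (subst card_regular_split[where P'="\<lambda>i j. T (i, j) = T (i + 1, j) \<and>
        \<not> (\<exists>k\<in>I - {Suc p}. is_bottom S' (ne_diag n k) (i + 1, j))"])
      (auto simp: 1 regular_cell_def extend_S')
  also have "{i \<in> {..<q - Suc p}. extend b T (n, Suc (i + p)) = extend b T (Suc n, Suc (i + p)) \<and>
        \<not> (\<exists>k\<in>I. is_bottom S (ne_diag (Suc n) k) (Suc n, Suc (i + p)))}
    = {i \<in> {..<q - Suc p}. next_row (extend b T) ! i = bottom_row b ! i \<and> \<not> (i = 0 \<and> Suc p \<in> I)}"
    unfolding 2 by (auto simp: nth_next_row nth_bottom_row extend_row simp del: nth_map)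
  finally show ?thesis .
qed

text \<open>Mirror image: only the SE-diagonal \<open>q\<close> can end in the last row, in its
  rightmost cell. The remaining indices drop by one, as SE-diagonals are counted from the left in a
  triangle of smaller order.\<close>

lemma inv_uJ_split:
  assumes "J \<subseteq> {q..Suc n}"
  shows "inv_uJ (Suc n) S J (extend b T) = inv_uJ n S' ((\<lambda>k. k - 1) ` (J - {q})) T
    + card {i \<in> {..<q - Suc p}. next_row (extend b T) ! i = bottom_row b ! Suc i \<and> \<not> (Suc i = q - Suc p \<and> q \<in> J)}"
proof -
  have 1: "(\<exists>k\<in>J. is_bottom S (se_diag (Suc n) k) (Suc i, Suc j))
      \<longleftrightarrow> (\<exists>k\<in>(\<lambda>k. k - 1) ` (J - {q}). is_bottom S' (se_diag n k) (Suc i, Suc j))" if "regular_cell S' i j" for i j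
  proof -
    have "\<not> is_bottom S (se_diag (Suc n) q) (Suc i, Suc j)"
      using regular_S'[OF that] p_less_q by (simp add: bottom_se_mid)
    moreover have "is_bottom S (se_diag (Suc n) k) (Suc i, Suc j) \<longleftrightarrow> is_bottom S' (se_diag n (k - 1)) (Suc i, Suc j)"
      if "k \<in> J - {q}" for k
      using assms that by (intro bottom_se_right) force+
    ultimately have "(\<exists>k\<in>J. is_bottom S (se_diag (Suc n) k) (Suc i, Suc j))
        \<longleftrightarrow> (\<exists>k\<in>J - {q}. is_bottom S' (se_diag n (k - 1)) (Suc i, Suc j))" by blast
    then show ?thesis by simp
  qed
  have 2: "(\<exists>k\<in>J. is_bottom S (se_diag (Suc n) k) (Suc n, Suc (Suc (i + p)))) \<longleftrightarrow> Suc i = q - Suc p \<and> q \<in> J"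
    if "i < q - Suc p" for i
  proof -
    have "\<not> is_bottom S (se_diag (Suc n) k) (Suc n, Suc (Suc (i + p)))" if "k \<in> J" "k \<noteq> q" for k
      using assms that bottom_se_right[of k] by (force dest!: bottom_S' S'_below)
    moreover have "is_bottom S (se_diag (Suc n) q) (Suc n, Suc (Suc (i + p))) \<longleftrightarrow> Suc i = q - Suc p"
      using that p_less_q by (auto simp: bottom_se_mid)
    ultimately show ?thesis by blast
  qed
  have "inv_uJ (Suc n) S J (extend b T) = inv_uJ n S' ((\<lambda>k. k - 1) ` (J - {q})) T
    + card {i \<in> {..<q - Suc p}. extend b T (n, Suc (i + p)) = extend b T (Suc n, Suc (Suc (i + p))) \<and>
        \<not> (\<exists>k\<in>J. is_bottom S (se_diag (Suc n) k) (Suc n, Suc (Suc (i + p))))}"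
    unfolding inv_uJ_def
    by (subst card_regular_split[where P'="\<lambda>i j. T (i, j) = T (i + 1, j + 1) \<and>
        \<not> (\<exists>k\<in>(\<lambda>k. k - 1) ` (J - {q}). is_bottom S' (se_diag n k) (i + 1, j + 1))"])
      (auto simp: 1 regular_cell_def extend_S' simp del: bex_simps)
  also have "{i \<in> {..<q - Suc p}. extend b T (n, Suc (i + p)) = extend b T (Suc n, Suc (Suc (i + p))) \<and>
        \<not> (\<exists>k\<in>J. is_bottom S (se_diag (Suc n) k) (Suc n, Suc (Suc (i + p))))}
    = {i \<in> {..<q - Suc p}. next_row (extend b T) ! i = bottom_row b ! Suc i \<and> \<not> (Suc i = q - Suc p \<and> q \<in> J)}"
    using 2 by (auto simp: nth_next_row nth_bottom_row extend_row simp del: nth_map)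
  finally show ?thesis .
qed

end

locale weighted_row_step = weights u v + row_step n l r s t p q
  for u v :: "'a::field_char_0" and n l r s t p q
begin

lemma row_weight_eq:
  "length ls = m \<Longrightarrow> row_weight (if A then 1 else v) (if B then 1 else u) ks ls
    = u ^ card {i \<in> {..<m}. ls ! i = ks ! Suc i \<and> \<not> (Suc i = m \<and> B)}
      * v ^ card {i \<in> {..<m}. ls ! i = ks ! i \<and> \<not> (i = 0 \<and> A)}"
proof -
  assume m: "length ls = m"
  have "row_weight (if A then 1 else v) (if B then 1 else u) ks ls
     = (\<Prod>i<m. (if ls ! i = ks ! i \<and> \<not> (i = 0 \<and> A) then v else 1)
        * (if ls ! i = ks ! Suc i \<and> \<not> (Suc i = m \<and> B) then u else 1))"
    unfolding row_weight_def m by (rule prod.cong) auto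
  then show ?thesis
    by (simp add: prod.distrib prod_if_power mult.commute)
qed

lemma sum_trees_weight:
  assumes "I \<subseteq> {1..Suc p}" "J \<subseteq> {q..Suc n}"
    and "\<And>ls. ls \<in> strict_rows (bottom_row b) \<Longrightarrow> finite (trees' (glue p b ls))"
  shows "(\<Sum>T\<in>trees b. u ^ inv_uJ (Suc n) S J T * v ^ inv_vI (Suc n) S I T * g (T (1, 1)))
    = (\<Sum>ls\<in>strict_rows (bottom_row b).
        row_weight (if Suc p \<in> I then 1 else v) (if q \<in> J then 1 else u) (bottom_row b) ls *
        (\<Sum>T\<in>trees' (glue p b ls). u ^ inv_uJ n S' ((\<lambda>k. k - 1) ` (J - {q})) T
           * v ^ inv_vI n S' (I - {Suc p}) T * g (T (1, 1))))"
proof -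
  have sum: "(\<Sum>T\<in>trees b. h T) = (\<Sum>ls\<in>strict_rows (bottom_row b). \<Sum>T\<in>trees' (glue p b ls). h (extend b T))"
    for h :: "_ \<Rightarrow> 'a"
    by (rule sum_trees) (rule assms(3))
  show ?thesis
    unfolding sum sum_distrib_left
  proof (intro sum.cong refl)
    fix ls T
    assume ls: "ls \<in> strict_rows (bottom_row b)" and T: "T \<in> trees' (glue p b ls)"
    have len: "length ls = q - Suc p" using ls by (simp add: mem_strict_rows)
    show "u ^ inv_uJ (Suc n) S J (extend b T) * v ^ inv_vI (Suc n) S I (extend b T) * g (extend b T (1, 1))
      = row_weight (if Suc p \<in> I then 1 else v) (if q \<in> J then 1 else u) (bottom_row b) ls *
        (u ^ inv_uJ n S' ((\<lambda>k. k - 1) ` (J - {q})) T * v ^ inv_vI n S' (I - {Suc p}) T * g (T (1, 1)))"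
      unfolding inv_vI_split[OF assms(1)] inv_uJ_split[OF assms(2)] tree_join(2)[OF ls T]
        row_weight_eq[OF len] power_add extend_S'[OF top_S']
      by (simp add: mult_ac)
  qed
qed

end

section \<open>Induction on the order\<close>

lemma sorted_list_of_setI: "sorted xs \<Longrightarrow> distinct xs \<Longrightarrow> set xs = A \<Longrightarrow> sorted_list_of_set A = xs"
  using sorted_list_of_set.idem_if_sorted_distinct by blast

lemma funpow_commute_on:
  fixes f g :: "'b \<Rightarrow> 'b"
  assumes fg: "\<And>G. P G \<Longrightarrow> f (g G) = g (f G)" and f: "\<And>G. P G \<Longrightarrow> P (f G)" and g: "\<And>G. P G \<Longrightarrow> P (g G)"
    and G: "P G"
  shows "(f ^^ a) ((g ^^ b) G) = (g ^^ b) ((f ^^ a) G)"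
proof -
  have 1: "f ((g ^^ b) G) = (g ^^ b) (f G)" if "P G" for b G
  proof (induction b)
    case (Suc b)
    have "P ((g ^^ b) G)" by (induction b) (simp_all add: that g)
    then show ?case using Suc fg by simp
  qed simp
  show ?thesis
  proof (induction a)
    case (Suc a)
    have "P ((f ^^ a) G)" by (induction a) (simp_all add: G f)
    then show ?case using Suc 1 by simp
  qed simp
qed

lemma foldr_rev_commute:
  assumes T: "\<And>i j G. P G \<Longrightarrow> T i (T j G) = T j (T i G)" and P: "\<And>i G. P G \<Longrightarrow> P (T i G)"
    and "P G"
  shows "foldr T (rev xs) G = foldr T xs G"
  using assms(3)
proof (induction xs arbitrary: G)
  case (Cons x xs)
  have 1: "foldr T xs (T x G) = T x (foldr T xs G)" if "P G" for G
  proof (induction xs)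
    case (Cons y ys)
    have "P (foldr T ys G)" by (induction ys) (simp_all add: that P)
    then show ?case using Cons T by simp
  qed simp
  show ?case using Cons.IH[OF P[OF Cons.prems]] 1[OF Cons.prems] by simp
qed simp

text \<open>\<open>op_prod\<close> applies the operator of index 1 last, but the summation variables
  have to be fixed from left to right. Commutativity allows the reversal; the operators in
  \<open>u\<close> already come in the right order, the largest index first.\<close>

lemma foldr_rev_fcut:
  "zpoly G \<Longrightarrow> foldr (\<lambda>i. front_cut v i ^^ s i) (rev xs) G = foldr (\<lambda>i. front_cut v i ^^ s i) xs G"
  by (rule foldr_rev_commute[where P=zpoly])
    (auto intro!: funpow_commute_on[where P=zpoly] zpoly_funpow zpoly_fcut simp: front_cut_commute)

lemma foldr_funpow_0: "(\<And>i. i \<in> set xs \<Longrightarrow> k i = 0) \<Longrightarrow> foldr (\<lambda>i. T i ^^ k i) xs G = G"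
  by (induction xs) auto

lemma ex_threshold:
  assumes "\<And>i j. 1 \<le> i \<Longrightarrow> i \<le> j \<Longrightarrow> j \<le> l \<Longrightarrow> P j \<Longrightarrow> P i"
  shows "\<exists>p\<le>l. \<forall>i\<in>{1..l::nat}. P i \<longleftrightarrow> i \<le> p"
  using assms
proof (induction l)
  case (Suc l)
  from Suc.IH Suc.prems obtain p where p: "p \<le> l" "\<forall>i\<in>{1..l}. P i \<longleftrightarrow> i \<le> p"
    by (metis le_SucI)
  show ?case
  proof (cases "P (Suc l)")
    case True
    then show ?thesis using Suc.prems[of _ "Suc l"] by (intro exI[of _ "Suc l"]) auto
  next
    case False
    then show ?thesis using p by (intro exI[of _ p]) (auto simp: le_Suc_eq)
  qed
qed simp

lemma mono_on_Suc:
  assumes "\<And>i. 1 \<le> i \<Longrightarrow> i < n \<Longrightarrow> f i \<le> (f (Suc i) :: int)"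
  shows "mono_on {1..n::nat} f"
proof (rule mono_onI)
  fix i j assume ij: "i \<in> {1..n}" "j \<in> {1..n}" "i \<le> j"
  from \<open>i \<le> j\<close> show "f i \<le> f j"
    using ij
  proof (induction j rule: dec_induct)
    case (step j)
    then show ?case using assms[of j] by force
  qed simp
qed

lemma strict_mono_on_Suc:
  assumes "\<And>i. 1 \<le> i \<Longrightarrow> i < n \<Longrightarrow> f i < (f (Suc i) :: int)"
  shows "strict_mono_on {1..n::nat} f"
proof (rule strict_mono_onI)
  fix i j assume ij: "i \<in> {1..n}" "j \<in> {1..n}" "i < j"
  from \<open>i < j\<close> have "Suc i \<le> j" by simp
  then show "f i < f j"
    using ij
  proof (induction j rule: dec_induct)
    case base
    then show ?case using assms[of i] by force
  next
    case (step j)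
    then show ?case using assms[of j] by force
  qed
qed

lemma neumann_0: "zlinear D \<Longrightarrow> (D ^^ N) F = (\<lambda>x. 0) \<Longrightarrow> neumann D 0 F = F"
  by (rule neumann_eqI) auto

context weights
begin

lemma tree_poly_Suc:
  assumes "antiderivatives \<psi>" "n \<ge> 1"
  shows "tree_poly \<alpha> \<psi> (Suc n) = row_op v u 0 (Suc n) (tree_poly \<alpha> \<psi> n)"
proof
  fix x :: "nat \<Rightarrow> int"
  have "map (glue 0 x ls) [1..<n+1] = ls" if "length ls = n" for ls
    using that by (auto simp: glue_def intro!: nth_equalityI)
  then have "row_sum v u (map x [1..<n+2]) (mop n (ldet (det_col \<alpha> \<psi> n)))
      = row_sum v u (map x [1..<n+2]) (\<lambda>ls. tree_poly \<alpha> \<psi> n (glue 0 x ls))"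
    by (intro row_sum_cong) (auto simp: tree_poly_def)
  then show "tree_poly \<alpha> \<psi> (Suc n) x = row_op v u 0 (Suc n) (tree_poly \<alpha> \<psi> n) x"
    by (simp add: tree_poly_rec[OF assms] row_op_def)
qed

lemma funpow_fcut_row_op:
  assumes "zpoly F" "i \<le> p" "p < q"
  shows "(front_cut v i ^^ k) (row_op v1 u1 p q F) = row_op v1 u1 p q ((front_cut v i ^^ k) F)"
  by (induction k) (simp_all add: fcut_row_op_left zpoly_funpow zpoly_fcut assms)

lemma funpow_bcut_row_op:
  assumes "zpoly F" "q < i" "p < q"
  shows "(back_cut u i ^^ k) (row_op v1 u1 p q F) = row_op v1 u1 p q ((back_cut u (i - 1) ^^ k) F)"
  by (induction k) (simp_all add: bcut_row_op_right zpoly_funpow zpoly_bcut assms)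

text \<open>One copy of the operator of index \<open>i\<close> fixes the leftmost summation
  variable, which makes \<open>i\<close> a parameter; the other \<open>s i - 1\<close> copies then
  pass through the sum to \<open>F\<close>.\<close>

lemma foldr_fcut_row_op:
  assumes "zpoly F" "m < q" "\<And>i. i \<in> {1..m} \<Longrightarrow> 0 < s i"
  shows "foldr (\<lambda>i. front_cut v i ^^ s i) (rev [1..<Suc m]) (row_op v u1 0 q F)
    = row_op v u1 m q (foldr (\<lambda>i. front_cut v i ^^ (s i - Suc 0)) (rev [1..<Suc m]) F)"
  using assms
proof (induction m)
  case (Suc m)
  let ?F = "foldr (\<lambda>i. front_cut v i ^^ (s i - Suc 0)) (rev [1..<Suc m]) F"
  have F: "zpoly ?F" by (intro zpoly_foldr zpoly_funpow zpoly_fcut Suc.prems)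
  obtain k where k: "s (Suc m) = Suc k" using Suc.prems(3)[of "Suc m"] by (metis Suc_le_mono atLeastAtMost_iff gr0_conv_Suc le_refl le0 One_nat_def)
  have rev: "rev [1..<Suc (Suc m)] = Suc m # rev [1..<Suc m]" by (simp add: upt_Suc)
  have "foldr (\<lambda>i. front_cut v i ^^ s i) (rev [1..<Suc (Suc m)]) (row_op v u1 0 q F)
      = (front_cut v (Suc m) ^^ s (Suc m)) (row_op v u1 m q ?F)"
    using Suc unfolding rev by simp
  also have "\<dots> = (front_cut v (Suc m) ^^ k) (row_op v u1 (Suc m) q ?F)"
    unfolding k funpow_Suc_right comp_def using fcut_row_op[OF F, of m q] Suc.prems by simp
  also have "\<dots> = row_op v u1 (Suc m) q ((front_cut v (Suc m) ^^ k) ?F)"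
    by (rule funpow_fcut_row_op[OF F]) (use Suc.prems in auto)
  finally show ?case unfolding rev by (simp add: k)
qed (simp add: upt_Suc)

text \<open>Mirror image, with the right end moving from \<open>Suc n\<close> down to
  \<open>m\<close>. The index drops by one when an operator passes to \<open>F\<close>, because
  \<open>glue\<close> moves these variables by one position.\<close>

lemma foldr_bcut_row_op:
  assumes "zpoly F" "0 < m" "m \<le> Suc n" "\<And>k. m < k \<Longrightarrow> k \<le> Suc n \<Longrightarrow> 0 < t k"
  shows "foldr (\<lambda>k. back_cut u k ^^ t k) [Suc m..<Suc (Suc n)] (row_op v1 u 0 (Suc n) F)
    = row_op v1 u 0 m (foldr (\<lambda>k. back_cut u k ^^ (t (Suc k) - Suc 0)) [m..<Suc n] F)"
  using assms(3,2,4)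
proof (induction m rule: inc_induct)
  case (step m)
  let ?F = "foldr (\<lambda>k. back_cut u k ^^ (t (Suc k) - Suc 0)) [Suc m..<Suc n] F"
  have F: "zpoly ?F" by (intro zpoly_foldr zpoly_funpow zpoly_bcut assms(1))
  obtain k where k: "t (Suc m) = Suc k" using step.prems(2)[of "Suc m"] step.hyps by (metis Suc_leI gr0_conv_Suc lessI)
  have upt: "[Suc m..<Suc (Suc n)] = Suc m # [Suc (Suc m)..<Suc (Suc n)]" "[m..<Suc n] = m # [Suc m..<Suc n]"
    using step.hyps by (simp_all add: upt_conv_Cons)
  have "foldr (\<lambda>k. back_cut u k ^^ t k) [Suc m..<Suc (Suc n)] (row_op v1 u 0 (Suc n) F)
      = (back_cut u (Suc m) ^^ t (Suc m)) (row_op v1 u 0 (Suc m) ?F)"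
    using step unfolding upt by simp
  also have "\<dots> = (back_cut u (Suc m) ^^ k) (row_op v1 u 0 m ?F)"
    unfolding k funpow_Suc_right comp_def using bcut_row_op[OF F, of 0 "Suc m" v1] step.prems by simp
  also have "\<dots> = row_op v1 u 0 m ((back_cut u m ^^ k) ?F)"
    using funpow_bcut_row_op[OF F, of m "Suc m" 0] step.prems by simp
  finally show ?case unfolding upt(2) by (simp add: k)
qed simp

lemma foldr_finv_row_op:
  assumes "zpoly F" "p < q" "\<And>i. i \<in> set xs \<Longrightarrow> i \<le> p"
  shows "foldr (\<lambda>i. neumann (zdiff i) c) xs (row_op v1 u1 p q F) = row_op v1 u1 p q (foldr (\<lambda>i. neumann (zdiff i) c) xs F)"
  using assms(3) by (induction xs) (simp_all add: finv_row_op_left zpoly_foldr zpoly_finv assms(1,2))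

lemma foldr_binv_row_op:
  assumes "zpoly F" "p < q" "\<And>i. i \<in> set xs \<Longrightarrow> q \<le> i"
  shows "foldr (\<lambda>i. neumann (zbdiff i) c) (map Suc xs) (row_op v1 u1 p q F)
    = row_op v1 u1 p q (foldr (\<lambda>i. neumann (zbdiff i) c) xs F)"
  using assms(3) by (induction xs) (simp_all add: binv_row_op_right zpoly_foldr zpoly_binv assms(1,2) less_Suc_eq_le)

end

context weighted_row_step
begin

lemma ltrunc_row_op:
  assumes F: "zpoly F" and R: "zpoly (row_op v u 0 (Suc n) F)"
  shows "ltrunc u v (Suc n) l r s t (row_op v u 0 (Suc n) F)
    = row_op v u p q (ltrunc u v n p (Suc n - q) (\<lambda>i. s i - Suc 0) (\<lambda>k. t (Suc k) - Suc 0) F)"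
proof -
  let ?B = "foldr (\<lambda>k. back_cut u k ^^ t k) [Suc n - r + 1..<Suc n + 1] (row_op v u 0 (Suc n) F)"
  let ?F = "foldr (\<lambda>k. back_cut u k ^^ (t (Suc k) - Suc 0)) [q..<Suc n] F"
  have F': "zpoly ?F" by (intro zpoly_foldr zpoly_funpow zpoly_bcut F)
  have "[Suc n - r + 1..<Suc n + 1] = [Suc n - r + 1..<Suc q] @ [Suc q..<Suc (Suc n)]"
    using qr upt_add_eq_append[of "Suc n - r + 1" "Suc q" "Suc n - q"] by simp
  then have "?B = foldr (\<lambda>k. back_cut u k ^^ t k) [Suc n - r + 1..<Suc q]
      (foldr (\<lambda>k. back_cut u k ^^ t k) [Suc q..<Suc (Suc n)] (row_op v u 0 (Suc n) F))" by simp
  also have "\<dots> = foldr (\<lambda>k. back_cut u k ^^ t k) [Suc q..<Suc (Suc n)] (row_op v u 0 (Suc n) F)"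
    by (rule foldr_funpow_0) (use q qr in force)
  also have "\<dots> = row_op v u 0 q ?F"
    by (rule foldr_bcut_row_op[OF F]) (use p_less_q qr q in auto)
  finally have B: "?B = row_op v u 0 q ?F" .
  have zB: "zpoly (row_op v u 0 q ?F)"
    unfolding B[symmetric] by (intro zpoly_foldr zpoly_funpow zpoly_bcut R)
  have "[1..<l+1] = [1..<Suc p] @ [Suc p..<l+1]"
    using pl upt_add_eq_append[of 1 "Suc p" "l - p"] by simp
  then have "foldr (\<lambda>i. front_cut v i ^^ s i) [1..<l+1] (row_op v u 0 q ?F)
      = foldr (\<lambda>i. front_cut v i ^^ s i) [1..<Suc p] (foldr (\<lambda>i. front_cut v i ^^ s i) [Suc p..<l+1] (row_op v u 0 q ?F))"
    by simp
  also have "foldr (\<lambda>i. front_cut v i ^^ s i) [Suc p..<l+1] (row_op v u 0 q ?F) = row_op v u 0 q ?F"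
  proof (rule foldr_funpow_0)
    fix i assume "i \<in> set [Suc p..<l + 1]"
    then show "s i = 0" using p[of i] by auto
  qed
  also have "foldr (\<lambda>i. front_cut v i ^^ s i) [1..<Suc p] (row_op v u 0 q ?F)
      = foldr (\<lambda>i. front_cut v i ^^ s i) (rev [1..<Suc p]) (row_op v u 0 q ?F)"
    by (rule foldr_rev_fcut[OF zB, symmetric])
  also have "\<dots> = row_op v u p q (foldr (\<lambda>i. front_cut v i ^^ (s i - Suc 0)) (rev [1..<Suc p]) ?F)"
    by (rule foldr_fcut_row_op[OF F' p_less_q]) (use p pl in auto)
  also have "\<dots> = row_op v u p q (foldr (\<lambda>i. front_cut v i ^^ (s i - Suc 0)) [1..<Suc p] ?F)"
    unfolding foldr_rev_fcut[OF F'] ..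
  finally show ?thesis
    using p_less_q qr by (simp add: ltrunc_def B[simplified])
qed

lemma lcorr_row_op:
  assumes F: "zpoly F" and I: "I \<subseteq> {1..Suc p}" and J: "J \<subseteq> {q..Suc n}"
  shows "lcorr u v I J (row_op v u p q F) = row_op (if Suc p \<in> I then 1 else v) (if q \<in> J then 1 else u) p q
    (lcorr u v (I - {Suc p}) ((\<lambda>k. k - 1) ` (J - {q})) F)"
proof -
  let ?J = "(\<lambda>k. k - 1) ` (J - {q})" and ?I = "I - {Suc p}"
  let ?u = "if q \<in> J then 1 else u" and ?v = "if Suc p \<in> I then 1 else v"
  let ?F = "foldr (\<lambda>k. neumann (zbdiff k) (1 - u)) (sorted_list_of_set ?J) F"
  have fin: "finite I" "finite J" using I J finite_subset by blast+
  have J': "j \<ge> q" if "j \<in> ?J" for j using J that by force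
  have "Suc ` ?J = J - {q}"
    using J p_less_q by (force simp: image_image)
  \<comment> \<open>\<open>foldr\<close> starts at the end of the list. The element \<open>q\<close>
    is the smallest in \<open>J\<close> and acts last, after the others have passed through the sum;
    \<open>Suc p\<close> is the largest in \<open>I\<close> and acts first.\<close>
  then have J_list: "sorted_list_of_set J = (if q \<in> J then [q] else []) @ map Suc (sorted_list_of_set ?J)"
    using fin J J' by (intro sorted_list_of_setI) (auto simp: sorted_append sorted_wrt_map distinct_map le_SucI)
  have I_list: "sorted_list_of_set I = sorted_list_of_set ?I @ (if Suc p \<in> I then [Suc p] else [])"
    using fin I by (intro sorted_list_of_setI) (auto simp: sorted_append)
  have F': "zpoly ?F" by (intro zpoly_foldr zpoly_binv F)
  have "foldr (\<lambda>k. neumann (zbdiff k) (1 - u)) (sorted_list_of_set J) (row_op v u p q F)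
      = foldr (\<lambda>k. neumann (zbdiff k) (1 - u)) (if q \<in> J then [q] else []) (row_op v u p q ?F)"
    unfolding J_list foldr_append using fin J' p_less_q F by (subst foldr_binv_row_op) auto
  also have "\<dots> = row_op v ?u p q ?F"
    using binv_row_op[OF F' p_less_q] by simp
  finally have 1: "foldr (\<lambda>k. neumann (zbdiff k) (1 - u)) (sorted_list_of_set J) (row_op v u p q F) = row_op v ?u p q ?F" .
  have 2: "foldr (\<lambda>k. neumann (zdiff k) (v - 1)) (if Suc p \<in> I then [Suc p] else []) (row_op v ?u p q ?F)
      = row_op ?v ?u p q ?F"
    using finv_row_op[OF F' p_less_q, of ?u]
    by (cases "Suc p \<in> I") (simp_all only: if_True if_False foldr.simps comp_def id_apply)
  have "foldr (\<lambda>k. neumann (zdiff k) (v - 1)) (sorted_list_of_set I) (row_op v ?u p q ?F)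
      = foldr (\<lambda>k. neumann (zdiff k) (v - 1)) (sorted_list_of_set ?I) (row_op ?v ?u p q ?F)"
    unfolding I_list foldr_append 2 ..
  also have "\<dots> = row_op ?v ?u p q (foldr (\<lambda>k. neumann (zdiff k) (v - 1)) (sorted_list_of_set ?I) ?F)"
    using fin I by (intro foldr_finv_row_op[OF F' p_less_q]) force
  finally show ?thesis unfolding lcorr_def 1 .
qed

text \<open>Removing the last row also removes one deletion from each truncated diagonal, so its
  deleted cells and its new bottom cell in the smaller shape are among those in the larger
  shape.\<close>

lemma noninterfering_step:
  "noninterfering n p (Suc n - q) (\<lambda>i. s i - Suc 0) (\<lambda>k. t (Suc k) - Suc 0)"
proof -
  have st: "\<And>i. i \<in> {1..l} \<Longrightarrow> s i < Suc n - i + 1" "\<And>k. k \<in> {Suc n - r + 1..Suc n} \<Longrightarrow> t k < k"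
    and disj: "\<And>i k. i \<in> {1..l} \<Longrightarrow> k \<in> {Suc n - r + 1..Suc n} \<Longrightarrow>
        bottom_cells (Suc n) (s i + 1) (ne_diag (Suc n) i) \<inter> bottom_cells (Suc n) (t k + 1) (se_diag (Suc n) k) = {}"
    using nonint unfolding noninterfering_def by blast+
  have e: "n - (Suc n - q) + 1 = q" using p_less_q qr by linarith
  show ?thesis
    unfolding noninterfering_def e
  proof (intro conjI ballI)
    fix i assume i: "i \<in> {1..p}"
    then show "s i - Suc 0 < n - i + 1" using st(1)[of i] pl p_less_q qr(2) by auto
  next
    fix k assume k: "k \<in> {q..n}"
    then show "t (Suc k) - Suc 0 < k" using st(2)[of "Suc k"] q[of "Suc k"] qr(1) by auto
  next
    fix i k assume i: "i \<in> {1..p}" and k: "k \<in> {q..n}"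
    have "bottom_cells n (s i - Suc 0 + 1) (ne_diag n i) \<subseteq> bottom_cells (Suc n) (s i + 1) (ne_diag (Suc n) i)"
      using p[of i] i pl by (auto simp: bottom_cells_def mem_ne_diag)
    moreover have "bottom_cells n (t (Suc k) - Suc 0 + 1) (se_diag n k) \<subseteq> bottom_cells (Suc n) (t (Suc k) + 1) (se_diag (Suc n) (Suc k))"
      using q[of "Suc k"] k qr by (auto simp: bottom_cells_def mem_se_diag)
    moreover have "i \<in> {1..l}" "Suc k \<in> {Suc n - r + 1..Suc n}" using i k pl qr by auto
    ultimately show "bottom_cells n (s i - Suc 0 + 1) (ne_diag n i) \<inter>
        bottom_cells n (t (Suc k) - Suc 0 + 1) (se_diag n k) = {}"
      using disj by blast
  qed
qed

text \<open>Three equal neighbours squeeze two adjacent regular entries above them to the same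
  value, contrary to strictness.\<close>

lemma trees'_triple:
  assumes "triple ls" "length ls = q - Suc p"
  shows "trees' (glue p b ls) = {}"
proof -
  from assms(1) obtain xs k ys where ls: "ls = xs @ k # k # k # ys" unfolding triple_def by blast
  define j where "j = Suc (length xs + p)"
  have j: "p < j" "Suc (Suc j) < q" using assms(2) by (auto simp: ls j_def)
  have "glue p b ls j = k" "glue p b ls (Suc j) = k" "glue p b ls (Suc (Suc j)) = k"
    using glue_mid[OF assms(2), of "length xs"] glue_mid[OF assms(2), of "Suc (length xs)"]
      glue_mid[OF assms(2), of "Suc (Suc (length xs))"] j
    by (auto simp: j_def ls nth_append)
  moreover have "(n - 1, j') \<in> S'" if "p < j'" "Suc j' < q" for j'
    using that qr by (auto simp: mem_st_shape)
  then have reg: "regular_cell S' (n - 1) j" "regular_cell S' (n - 1) (Suc j)"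
    using j S'_last n by (auto simp: regular_cell_def)
  ultimately show ?thesis
  proof (intro equals0I)
    fix T assume g: "glue p b ls j = k" "glue p b ls (Suc j) = k" "glue p b ls (Suc (Suc j)) = k"
      and T: "T \<in> trees' (glue p b ls)"
    have row: "T (n, j) = k" "T (n, Suc j) = k" "T (n, Suc (Suc j)) = k"
      using T j g by (auto simp: mem_trees')
    have tree: "is_tree S' T" using T by (simp add: mem_trees')
    then have "T (n, j) \<le> T (n - 1, j) \<and> T (n - 1, j) \<le> T (n, Suc j)"
      "T (n, Suc j) \<le> T (n - 1, Suc j) \<and> T (n - 1, Suc j) \<le> T (n, Suc (Suc j))"
      using reg n unfolding is_tree_def by (metis Suc_eq_plus1 le_add_diff_inverse2)+
    moreover have "T (n - 1, j) \<noteq> T (n - 1, Suc j)"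
      using tree reg unfolding is_tree_def by (metis Suc_eq_plus1)
    ultimately show False using row by simp
  qed
qed

lemma glue_bounds:
  assumes "ls \<in> weak_rows (bottom_row b)" and mono: "\<And>i. 1 \<le> i \<Longrightarrow> i \<le> n \<Longrightarrow> b i \<le> b (Suc i)"
    and i: "1 \<le> i" "i \<le> n"
  shows "b i \<le> glue p b ls i \<and> glue p b ls i \<le> b (Suc i)"
proof -
  have len: "length ls = q - Suc p"
    using assms(1) p_less_q by (auto simp: weak_rows_def)
  consider "i \<le> p" | "p < i" "i < q" | "q \<le> i" by linarith
  then show ?thesis
  proof cases
    case 2
    define j where "j = i - Suc p"
    have ij: "i = Suc (j + p)" "j < q - Suc p" using 2 by (auto simp: j_def)
    then have "bottom_row b ! j \<le> ls ! j \<and> ls ! j \<le> bottom_row b ! Suc j"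
      using assms(1) len by (simp add: weak_rows_def)
    then show ?thesis using ij by (simp add: glue_mid[OF len] nth_bottom_row del: nth_map)
  next
    case 3
    then show ?thesis using glue_right[OF len, of "Suc i"] mono[OF i] by simp
  qed (use mono[OF i] in \<open>simp add: glue_left\<close>)
qed

lemma glue_mono:
  assumes "ls \<in> weak_rows (bottom_row b)" and "mono_on {1..Suc n} b"
  shows "mono_on {1..n} (glue p b ls)"
proof (rule mono_on_Suc)
  fix i assume i: "1 \<le> i" "i < n"
  have "b i \<le> b (Suc i)" if "1 \<le> i" "i \<le> n" for i
    using that assms(2) by (auto intro: mono_onD)
  from glue_bounds[OF assms(1) this, of i] glue_bounds[OF assms(1) this, of "Suc i"] i
  show "glue p b ls i \<le> glue p b ls (Suc i)" by linarith
qed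

lemma glue_strict_mono:
  assumes ls: "ls \<in> strict_rows (bottom_row b)" and "strict_mono_on {1..Suc n} b"
  shows "strict_mono_on {1..n} (glue p b ls)"
proof (rule strict_mono_on_Suc)
  fix i assume i: "1 \<le> i" "i < n"
  have b: "b i < b (Suc i)" if "1 \<le> i" "i \<le> n" for i
    using that assms(2) by (auto intro: strict_mono_onD)
  have w: "ls \<in> weak_rows (bottom_row b)" using ls by (simp add: strict_rows_def)
  have len: "length ls = q - Suc p" using ls by (simp add: mem_strict_rows)
  have bounds: "b i \<le> glue p b ls i \<and> glue p b ls i \<le> b (Suc i)"
    "b (Suc i) \<le> glue p b ls (Suc i) \<and> glue p b ls (Suc i) \<le> b (Suc (Suc i))"
    using glue_bounds[OF w, of i] glue_bounds[OF w, of "Suc i"] b i by (auto intro: less_imp_le)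
  consider "i \<le> p" | "p < i" "Suc i < q" | "q \<le> Suc i" by linarith
  then show "glue p b ls i < glue p b ls (Suc i)"
  proof cases
    case 1
    then show ?thesis using bounds b[of i] i by (simp add: glue_left)
  next
    case 2
    define j where "j = i - Suc p"
    have j: "i = Suc (j + p)" "Suc j < q - Suc p" using 2 by (auto simp: j_def)
    then have "ls ! j \<noteq> ls ! Suc j" using ls by (simp add: mem_strict_rows)
    then show ?thesis
      using bounds j glue_mid[OF len, of j] glue_mid[OF len, of "Suc j"] by simp
  next
    case 3
    then show ?thesis using bounds b[of "Suc i"] i glue_right[OF len, of "Suc (Suc i)"] by simp
  qed
qed

lemma row_summableI:
  assumes b: "strict_mono_on {1..Suc n} b \<or> u = 1 \<and> v = 1 \<and> mono_on {1..Suc n} b"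
    and f: "u = 1 \<Longrightarrow> v = 1 \<Longrightarrow> (\<And>ls. ls \<in> weak_rows (bottom_row b) \<Longrightarrow> triple ls \<Longrightarrow> f ls = 0)"
  shows "row_summable (if A then 1 else v) (if B then 1 else u) (bottom_row b) f"
proof (cases "strict_mono_on {1..Suc n} b")
  case True
  have "sorted_wrt (<) (bottom_row b)"
    unfolding sorted_wrt_map by (rule sorted_wrt_mono_rel[OF _ sorted_wrt_upt])
      (use qr in \<open>auto intro!: strict_mono_onD[OF True]\<close>)
  then show ?thesis using p_less_q by (simp add: row_summable_def)
next
  case False
  with b have uv: "u = 1" "v = 1" and m: "mono_on {1..Suc n} b" by auto
  have "sorted (bottom_row b)"
    unfolding sorted_map by (rule sorted_wrt_mono_rel[OF _ sorted_upt])
      (use qr in \<open>auto intro!: mono_onD[OF m]\<close>)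
  then show ?thesis
    unfolding row_summable_def using p_less_q uv f by simp
qed

end

lemma trees_1:
  assumes "noninterfering 1 l r s t"
  shows "st_shape 1 l r s t = {(1, 1)}"
    and "st_trees 1 l r s t b = {\<lambda>c. if c = (1, 1) then b 1 else undefined}"
proof -
  let ?S = "st_shape 1 l r s t"
  have st: "\<forall>i\<in>{1..l}. s i < 1 - i + 1" "\<forall>k\<in>{1 - r + 1..1}. t k < k"
    using assms by (simp_all add: noninterfering_def)
  have "(i, j) \<in> ?S \<longleftrightarrow> (i, j) = (1, 1)" for i j
    using st(1)[THEN bspec, of 1] st(2)[THEN bspec, of 1] by (auto simp: mem_st_shape)
  then show S: "?S = {(1, 1)}" by auto
  have reg: "\<not> regular_cell {(1, 1)} i j" for i j
    by (simp add: regular_cell_def)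
  have ne: "is_bottom {(1, 1)} (ne_diag 1 1) c \<longleftrightarrow> c = (1, 1)" for c
    by (auto simp: is_bottom_def mem_ne_diag)
  have se: "is_bottom {(1, 1)} (se_diag 1 1) c \<longleftrightarrow> c = (1, 1)" for c
    by (auto simp: is_bottom_def mem_se_diag)
  have "T \<in> st_trees 1 l r s t b \<longleftrightarrow> T \<in> extensional {(1, 1)} \<and> T (1, 1) = b 1" for T
    unfolding st_trees_def is_tree_def S using reg ne se by (cases r) auto
  then show "st_trees 1 l r s t b = {\<lambda>c. if c = (1, 1) then b 1 else undefined}"
    by (auto simp: extensional_def fun_eq_iff)
qed

context weights
begin

text \<open>At order 1 the operators act on the weight \<open>\<psi> 0\<close> itself. They are
  trivial if their coefficients \<open>v - 1\<close> and \<open>1 - u\<close> vanish or if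
  \<open>\<psi> 0\<close> is constant; this is the source of the exception
  \<open>top_in_cut\<close>.\<close>

lemma lcorr_1:
  assumes "antiderivatives \<psi>" "I \<subseteq> {1}" "J \<subseteq> {1}"
    and "u = 1 \<and> v = 1 \<or> I = {} \<and> J = {} \<or> (\<forall>y z. \<psi> 0 y = \<psi> 0 z)"
  shows "lcorr u v I J (tree_poly \<alpha> \<psi> 1) = tree_poly \<alpha> \<psi> 1"
proof -
  let ?F = "tree_poly \<alpha> \<psi> 1"
  have F: "?F = (\<lambda>x. \<psi> 0 (x 1))" by (rule ext) (rule tree_poly_1)
  obtain N where N: "znil 1 N ?F" using zpoly_tree_poly[OF assms(1)] unfolding zpoly_def by blast
  have fin: "neumann (zdiff 1) (v - 1) ?F = ?F" if "u = 1 \<and> v = 1 \<or> (\<forall>y z. \<psi> 0 y = \<psi> 0 z)"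
    using that
  proof
    assume "u = 1 \<and> v = 1"
    then have c: "v - 1 = 0" by simp
    show ?thesis unfolding c by (rule neumann_0[OF zlinear_zdiff N[unfolded znil_def]])
  next
    assume "\<forall>y z. \<psi> 0 y = \<psi> 0 z"
    then have z: "zdiff 1 ?F = (\<lambda>x. 0)" unfolding F zdiff_def by (metis diff_self)
    show ?thesis
      by (rule neumann_eqI[OF zlinear_zdiff, where N=1]) (simp_all add: z[simplified])
  qed
  have bin: "neumann (zbdiff 1) (1 - u) ?F = ?F" if "u = 1 \<and> v = 1 \<or> (\<forall>y z. \<psi> 0 y = \<psi> 0 z)"
    using that
  proof
    assume "u = 1 \<and> v = 1"
    then have c: "1 - u = 0" by simp
    show ?thesis unfolding c by (rule neumann_0[OF zlinear_zbdiff znil_zbdiff[OF N]])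
  next
    assume "\<forall>y z. \<psi> 0 y = \<psi> 0 z"
    then have z: "zbdiff 1 ?F = (\<lambda>x. 0)" unfolding F zbdiff_def by (metis diff_self)
    show ?thesis
      by (rule neumann_eqI[OF zlinear_zbdiff, where N=1]) (simp_all add: z[simplified])
  qed
  have "I = {} \<or> I = {1}" "J = {} \<or> J = {1}" using assms by auto
  then show ?thesis using assms(4) fin bin by (auto simp: lcorr_def)
qed

text \<open>The free weight \<open>\<psi> 0\<close> lets one induction serve both generating
  functions: the constant 1 counts all trees, the indicator of \<open>a\<close> those with top entry
  \<open>a\<close>. Agreement with \<open>g\<close> is assumed only between \<open>b 1\<close> and
  \<open>b n\<close>, since interpolation is correct only there; the interval does not grow on
  passing to the next row.\<close>

theorem tree_enumeration:
  assumes \<psi>: "antiderivatives \<psi>"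
  shows "n \<ge> 1 \<Longrightarrow> l + r \<le> n \<Longrightarrow> antimono_on {1..l} s \<Longrightarrow> mono_on {n-r+1..n} t \<Longrightarrow> noninterfering n l r s t
    \<Longrightarrow> strict_mono_on {1..n} b \<or> u = 1 \<and> v = 1 \<and> mono_on {1..n} b
    \<Longrightarrow> I \<subseteq> {1} \<union> {i\<in>{2..l}. s (i - 1) > s i}
    \<Longrightarrow> J \<subseteq> {j\<in>{n-r+1..<n}. t j < t (j + 1)} \<union> {n}
    \<Longrightarrow> (top_in_cut n (st_shape n l r s t) I J \<longrightarrow> u = 1 \<and> v = 1) \<or> (\<forall>y z. \<psi> 0 y = \<psi> 0 z)
    \<Longrightarrow> (\<And>z. b 1 \<le> z \<Longrightarrow> z \<le> b n \<Longrightarrow> \<psi> 0 z = g z)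
    \<Longrightarrow> finite (st_trees n l r s t b) \<and>
      lcorr u v I J (ltrunc u v n l r s t (tree_poly \<alpha> \<psi> n)) b =
        (\<Sum>T\<in>st_trees n l r s t b. u ^ inv_uJ n (st_shape n l r s t) J T
           * v ^ inv_vI n (st_shape n l r s t) I T * g (T (1, 1)))"
proof (induction n arbitrary: l r s t b I J rule: nat_induct_at_least)
  case base
  let ?S = "st_shape 1 l r s t"
  note S = trees_1[OF base(4)]
  have st: "\<forall>i\<in>{1..l}. s i < 1 - i + 1" "\<forall>k\<in>{1 - r + 1..1}. t k < k"
    using base(4) by (simp_all add: noninterfering_def)
  have l: "l \<le> 1" "r \<le> 1" using base(1) by auto
  have tr: "ltrunc u v 1 l r s t F = F" for F
  proof -
    have "foldr (\<lambda>k. back_cut u k ^^ t k) [1 - r + 1..<1 + 1] F = F"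
    proof (rule foldr_funpow_0)
      fix k assume "k \<in> set [1 - r + 1..<1 + 1]"
      then have "k \<in> {1 - r + 1..1}" by auto
      then show "t k = 0" using st(2) by fastforce
    qed
    moreover have "foldr (\<lambda>i. front_cut v i ^^ s i) [1..<l + 1] F = F"
    proof (rule foldr_funpow_0)
      fix i assume "i \<in> set [1..<l + 1]"
      then have "i \<in> {1..l}" "i = 1" using l by auto
      then show "s i = 0" using st(1) by fastforce
    qed
    ultimately show ?thesis by (simp add: ltrunc_def)
  qed
  have IJ: "I \<subseteq> {1}" "J \<subseteq> {1}" using base(6,7) l by auto
  have "top_in_cut 1 ?S I J" if "I \<noteq> {} \<or> J \<noteq> {}"
  proof -
    have "is_bottom ?S (ne_diag 1 1) (1, 1)" "is_bottom ?S (se_diag 1 1) (1, 1)"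
      unfolding S by (simp_all add: is_bottom_def mem_ne_diag mem_se_diag)
    moreover have "1 \<in> I \<or> 1 \<in> J" using that IJ by blast
    ultimately show ?thesis unfolding top_in_cut_def by blast
  qed
  then have "lcorr u v I J (tree_poly \<alpha> \<psi> 1) = tree_poly \<alpha> \<psi> 1"
    using base(8) by (intro lcorr_1[OF \<psi> IJ]) blast
  then have z: "lcorr u v I J (tree_poly \<alpha> \<psi> 1) b = \<psi> 0 (b 1)" by (simp only: tree_poly_1)
  have reg: "\<not> regular_cell ?S i j" for i j
    unfolding S by (simp add: regular_cell_def)
  have inv: "inv_uJ 1 ?S J T = 0" "inv_vI 1 ?S I T = 0" for T
    using reg unfolding inv_uJ_def inv_vI_def by simp_all
  have "\<psi> 0 (b 1) = g (b 1)" by (rule base(9)) simp_all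
  then show ?case
    unfolding tr z inv unfolding S(2) by simp
next
  case (Suc n)
  \<comment> \<open>As \<open>s\<close> decreases weakly, the diagonals with deletions form an
    initial segment. Likewise \<open>t\<close> yields a final segment; its complement is counted
    from \<open>Suc n - r + 1\<close> on, to start at 1.\<close>
  obtain p where p: "p \<le> l" "\<forall>i\<in>{1..l}. 0 < s i \<longleftrightarrow> i \<le> p"
  proof -
    have "0 < s i" if "1 \<le> i" "i \<le> j" "j \<le> l" "0 < s j" for i j
      using monotone_onD[OF Suc.prems(2), of i j] that by auto
    then show ?thesis using that ex_threshold[of l "\<lambda>i. 0 < s i"] by blast
  qed
  obtain q' where q': "q' \<le> r" "\<forall>i\<in>{1..r}. t (Suc n - r + i) = 0 \<longleftrightarrow> i \<le> q'"
  proof -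
    have "t (Suc n - r + i) = 0" if "1 \<le> i" "i \<le> j" "j \<le> r" "t (Suc n - r + j) = 0" for i j
      using mono_onD[OF Suc.prems(3), of "Suc n - r + i" "Suc n - r + j"] that Suc.prems(1) by auto
    then show ?thesis using that ex_threshold[of r "\<lambda>i. t (Suc n - r + i) = 0"] by blast
  qed
  define q where "q = Suc n - r + q'"
  have q: "0 < t k \<longleftrightarrow> q < k" if range: "k \<in> {Suc n - r + 1..Suc n}" for k
  proof -
    obtain i where k: "k = Suc n - r + i" "i \<in> {1..r}"
    proof
      show "k = Suc n - r + (k - (Suc n - r))" "k - (Suc n - r) \<in> {1..r}" using range by auto
    qed
    have "t k = 0 \<longleftrightarrow> i \<le> q'" unfolding k(1) using q'(2)[THEN bspec, OF k(2)] .
    moreover have "q < k \<longleftrightarrow> \<not> i \<le> q'" using k(1) q_def by linarith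
    ultimately show ?thesis by (metis gr0I less_not_refl)
  qed
  interpret weighted_row_step u v n l r s t p q
    by standard (use Suc.hyps Suc.prems(1,4) p q q'(1) in \<open>auto simp: q_def\<close>)
  let ?I = "I - {Suc p}" and ?J = "(\<lambda>k. k - 1) ` (J - {q})"
  let ?v = "if Suc p \<in> I then 1 else v" and ?u = "if q \<in> J then 1 else u"
  let ?s = "\<lambda>i. s i - Suc 0" and ?t = "\<lambda>k. t (Suc k) - Suc 0"
  let ?G = "lcorr u v ?I ?J (ltrunc u v n p (Suc n - q) ?s ?t (tree_poly \<alpha> \<psi> n))"
  \<comment> \<open>A descent \<open>s (i - 1) > s i\<close> forces \<open>s (i - 1) > 0\<close>,
    hence \<open>i - 1 \<le> p\<close>; ascents of \<open>t\<close> bound \<open>J\<close> in the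
    same way.\<close>
  have I: "I \<subseteq> {1..Suc p}"
  proof
    fix i assume "i \<in> I"
    then consider "i = 1" | "i \<in> {2..l}" "s i < s (i - 1)" using Suc.prems(6) by blast
    then show "i \<in> {1..Suc p}"
    proof cases
      case 2
      then have "i - 1 \<in> {1..l}" "0 < s (i - 1)" by auto
      then have "i - 1 \<le> p" using p by blast
      then show ?thesis using 2 by auto
    qed auto
  qed
  have J: "J \<subseteq> {q..Suc n}"
  proof
    fix j assume "j \<in> J"
    then consider "j = Suc n" | "j \<in> {Suc n - r + 1..<Suc n}" "t j < t (j + 1)" using Suc.prems(7) by blast
    then show "j \<in> {q..Suc n}"
    proof cases
      case 2
      then have "Suc j \<in> {Suc n - r + 1..Suc n}" "0 < t (Suc j)" by auto
      then have "q < Suc j" using q by blast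
      then show ?thesis using 2 by auto
    qed (use qr in auto)
  qed
  have b_mono: "mono_on {1..Suc n} b"
    using Suc.prems(5) strict_mono_on_imp_mono_on by blast
  \<comment> \<open>For \<open>u = v = 1\<close> the hypothesis also covers rows that are not
    strict. It is used there to see that the smaller polynomial vanishes at three equal
    neighbours.\<close>
  have IH: "finite (trees' (glue p b ls)) \<and> ?G (glue p b ls) = (\<Sum>T\<in>trees' (glue p b ls).
      u ^ inv_uJ n S' ?J T * v ^ inv_vI n S' ?I T * g (T (1, 1)))"
    if ls: "ls \<in> weak_rows (bottom_row b)" and strict: "ls \<in> strict_rows (bottom_row b) \<or> u = 1 \<and> v = 1 \<and> mono_on {1..Suc n} b" for ls
  proof (rule Suc.IH)
    show "p + (Suc n - q) \<le> n" using p_less_q qr by linarith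
    show "antimono_on {1..p} ?s"
      using Suc.prems(2) pl by (auto simp: monotone_on_def intro!: diff_le_mono)
    show "mono_on {n - (Suc n - q) + 1..n} ?t"
      using qr p_less_q by (auto intro!: mono_onI diff_le_mono mono_onD[OF Suc.prems(3)])
    show "noninterfering n p (Suc n - q) ?s ?t" by (rule noninterfering_step)
    show "strict_mono_on {1..n} (glue p b ls) \<or> u = 1 \<and> v = 1 \<and> mono_on {1..n} (glue p b ls)"
      using strict Suc.prems(5) glue_strict_mono[of ls b] glue_mono[OF ls] by blast
    show "?I \<subseteq> {1} \<union> {i\<in>{2..p}. ?s i < ?s (i - 1)}"
    proof
      fix i assume i: "i \<in> ?I"
      then have "i \<le> p" using I by force
      then show "i \<in> {1} \<union> {i\<in>{2..p}. ?s i < ?s (i - 1)}"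
        using i Suc.prems(6) p[of i] pl by auto
    qed
    show "?J \<subseteq> {j\<in>{n - (Suc n - q) + 1..<n}. ?t j < ?t (j + 1)} \<union> {n}"
    proof
      fix k assume "k \<in> ?J"
      then obtain j where j: "j \<in> J" "j \<noteq> q" "k = j - 1" by blast
      then have "q < j" using J by force
      moreover have "j = Suc n \<or> (j \<in> {Suc n - r + 1..<Suc n} \<and> t j < t (j + 1))"
        using j(1) Suc.prems(7) by blast
      ultimately show "k \<in> {j\<in>{n - (Suc n - q) + 1..<n}. ?t j < ?t (j + 1)} \<union> {n}"
        using j(3) q[of j] qr p_less_q by auto
    qed
    show "(top_in_cut n S' ?I ?J \<longrightarrow> u = 1 \<and> v = 1) \<or> (\<forall>y z. \<psi> 0 y = \<psi> 0 z)"
    proof -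
      have "is_bottom S (ne_diag (Suc n) i) (1, 1)" if "i \<in> ?I" "is_bottom S' (ne_diag n i) (1, 1)" for i
      proof -
        have "1 \<le> i" "i \<le> p" using that(1) I by force+
        then show ?thesis using that(2) by (simp add: bottom_ne_left)
      qed
      moreover have "is_bottom S (se_diag (Suc n) j) (1, 1)"
        if "j \<in> J - {q}" "is_bottom S' (se_diag n (j - 1)) (1, 1)" for j
      proof -
        have "q < j" "j \<le> Suc n" using that(1) J by force+
        then show ?thesis using that(2) by (simp add: bottom_se_right)
      qed
      ultimately have "top_in_cut n S' ?I ?J \<Longrightarrow> top_in_cut (Suc n) S I J"
        unfolding top_in_cut_def by blast
      then show ?thesis using Suc.prems(8) by blast
    qed
    fix z assume "glue p b ls 1 \<le> z" "z \<le> glue p b ls n"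
    moreover have "b 1 \<le> glue p b ls 1" "glue p b ls n \<le> b (Suc n)"
      using glue_bounds[OF ls, of 1] glue_bounds[OF ls, of n] Suc.hyps mono_onD[OF b_mono] by auto
    ultimately show "\<psi> 0 z = g z" by (intro Suc.prems(9)) auto
  qed
  have fin: "finite (trees' (glue p b ls))" if "ls \<in> strict_rows (bottom_row b)" for ls
    using IH[of ls] that by (auto simp: strict_rows_def)
  have F: "zpoly (tree_poly \<alpha> \<psi> n)" and F': "zpoly (row_op v u 0 (Suc n) (tree_poly \<alpha> \<psi> n))"
    using zpoly_tree_poly[OF \<psi>] tree_poly_Suc[OF \<psi> Suc.hyps] by metis+
  have "lcorr u v I J (ltrunc u v (Suc n) l r s t (tree_poly \<alpha> \<psi> (Suc n))) b = row_op ?v ?u p q ?G b"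
    unfolding tree_poly_Suc[OF \<psi> Suc.hyps] ltrunc_row_op[OF F F'] using lcorr_row_op[OF zpoly_ltrunc[OF F] I J] by simp
  also have "\<dots> = (\<Sum>ls\<in>strict_rows (bottom_row b). row_weight ?v ?u (bottom_row b) ls * ?G (glue p b ls))"
    unfolding row_op_def
  proof (rule row_sum_eq_sum_strict_rows, rule row_summableI[OF Suc.prems(5)])
    \<comment> \<open>By the induction hypothesis the value is a sum over trees, and this sum is
      empty.\<close>
    fix ls assume uv: "u = 1" "v = 1" and ls: "ls \<in> weak_rows (bottom_row b)" "triple ls"
    then have "length ls = q - Suc p" using p_less_q by (auto simp: weak_rows_def)
    then show "?G (glue p b ls) = 0"
      using IH[OF ls(1)] uv b_mono trees'_triple[OF ls(2)] by simp
  qed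
  also have "\<dots> = (\<Sum>ls\<in>strict_rows (bottom_row b). row_weight ?v ?u (bottom_row b) ls *
      (\<Sum>T\<in>trees' (glue p b ls). u ^ inv_uJ n S' ?J T * v ^ inv_vI n S' ?I T * g (T (1, 1))))"
    by (rule sum.cong) (use IH in \<open>auto simp: strict_rows_def\<close>)
  also have "\<dots> = (\<Sum>T\<in>trees b. u ^ inv_uJ (Suc n) S J T * v ^ inv_vI (Suc n) S I T * g (T (1, 1)))"
    by (rule sum_trees_weight[OF I J fin, symmetric])
  finally show ?case using finite_trees[OF fin] by blast
qed

end

section \<open>Order 0 and transfer to the polynomial functions\<close>

lemma neumann_const: "zlinear D \<Longrightarrow> D (\<lambda>x. k) = (\<lambda>x. 0) \<Longrightarrow> neumann D c (\<lambda>x. k) = (\<lambda>x. k)"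
  by (rule neumann_eqI[where N = 1]) simp_all

lemma lcorr_const: "lcorr u v I J (\<lambda>x. k) = (\<lambda>x. k)"
proof -
  have "foldr (\<lambda>i. neumann (zbdiff i) c) xs (\<lambda>x. k) = (\<lambda>x. k)"
    "foldr (\<lambda>i. neumann (zdiff i) c) xs (\<lambda>x. k) = (\<lambda>x. k)" for c and k :: 'a and xs
    by (induction xs) (simp_all add: neumann_const zlinear_zdiff zlinear_zbdiff zdiff_def zbdiff_def)
  then show ?thesis by (simp add: lcorr_def)
qed

lemma inv_uJ_empty [simp]: "inv_uJ n S {} T = inv_u S T"
  by (simp add: inv_uJ_def inv_u_def)

lemma inv_vI_empty [simp]: "inv_vI n S {} T = inv_v S T"
  by (simp add: inv_vI_def inv_v_def)

lemma lcorr_empty [simp]: "lcorr u v {} {} F = F"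
  by (simp add: lcorr_def)

lemma on_ltrunc_at:
  "truncation_op u v n l r s t f (\<lambda>i. of_int (b i)) = lcorr u v {} {} (ltrunc u v n l r s t (on_lattice f)) b"
  unfolding lcorr_empty on_lattice_truncation[symmetric] by (simp add: on_lattice_def)

lemma on_lcorr_at:
  "correction_op u v I J (truncation_op u v n l r s t f) (\<lambda>i. of_int (b i))
     = lcorr u v I J (ltrunc u v n l r s t (on_lattice f)) b"
  unfolding on_lattice_correction[symmetric] on_lattice_truncation[symmetric]
  by (simp add: on_lattice_def)

text \<open>The induction starts at order 1, so the empty shape is treated separately: it carries
  exactly one tree, and the polynomial is the constant 1.\<close>

lemma order_0:
  assumes "l + r \<le> 0"
  shows "lcorr u v I J (ltrunc u v 0 l r s t (on_lattice (M_poly u v 0))) b =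
    (\<Sum>T\<in>st_trees 0 l r s t b. u ^ inv_uJ 0 (st_shape 0 l r s t) J T * v ^ inv_vI 0 (st_shape 0 l r s t) I T)"
proof -
  have lr: "l = 0" "r = 0" using assms by auto
  have M: "on_lattice (M_poly u v 0) = (\<lambda>x. 1)"
    by (auto simp: on_lattice_def M_poly_def strict_all_def op_prod_foldr GT_poly_def intro!: prod.neutral)
  have S: "st_shape 0 l r s t = {}" by (auto simp: mem_st_shape)
  have "st_trees 0 l r s t b = {\<lambda>c. undefined}"
    unfolding st_trees_def is_tree_def S by (auto simp: lr regular_cell_def)
  then show ?thesis
    unfolding M S by (simp add: lr ltrunc_def lcorr_const inv_uJ_def inv_vI_def regular_cell_def)
qed

theorem theorem2p4:
  fixes n l r :: nat and s t :: "nat \<Rightarrow> nat" and b :: "nat \<Rightarrow> int"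
    and u v :: "'a::field_char_0"
  assumes "l + r \<le> n"
    and "antimono_on {1..l} s" and "mono_on {n-r+1..n} t"
    and "noninterfering n l r s t"
    and "strict_mono_on {1..n} b \<or> u = 1 \<and> v = 1 \<and> mono_on {1..n} b"
  shows
    "(truncation_op u v n l r s t (M_poly u v n) (\<lambda>i. of_int (b i)) =
       (\<Sum>T\<in>st_trees n l r s t b.
          u ^ inv_u (st_shape n l r s t) T * v ^ inv_v (st_shape n l r s t) T))
     \<and> (\<forall>I J. I \<subseteq> {1} \<union> {i\<in>{2..l}. s (i - 1) > s i} \<and>
            J \<subseteq> {j\<in>{n-r+1..<n}. t j < t (j + 1)} \<union> {n} \<longrightarrow>
       correction_op u v I J (truncation_op u v n l r s t (M_poly u v n)) (\<lambda>i. of_int (b i)) =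
         (\<Sum>T\<in>st_trees n l r s t b.
            u ^ inv_uJ n (st_shape n l r s t) J T * v ^ inv_vI n (st_shape n l r s t) I T))
     \<and> (\<forall>a \<alpha> \<beta>. 1 \<le> n \<and> \<alpha> \<le> a \<and> a \<le> \<beta> \<and> \<alpha> \<le> b 1 \<and> b n \<le> \<beta> \<longrightarrow>
       truncation_op u v n l r s t (M_top u v n a \<alpha> \<beta>) (\<lambda>i. of_int (b i)) =
         (\<Sum>T\<in>{T \<in> st_trees n l r s t b. T (1, 1) = a}.
            u ^ inv_u (st_shape n l r s t) T * v ^ inv_v (st_shape n l r s t) T))
     \<and> (\<forall>a \<alpha> \<beta> I J. 1 \<le> n \<and> \<alpha> \<le> a \<and> a \<le> \<beta> \<and> \<alpha> \<le> b 1 \<and> b n \<le> \<beta> \<and>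
            I \<subseteq> {1} \<union> {i\<in>{2..l}. s (i - 1) > s i} \<and>
            J \<subseteq> {j\<in>{n-r+1..<n}. t j < t (j + 1)} \<union> {n} \<and>
            (top_in_cut n (st_shape n l r s t) I J \<longrightarrow> u = 1 \<and> v = 1) \<longrightarrow>
       correction_op u v I J (truncation_op u v n l r s t (M_top u v n a \<alpha> \<beta>)) (\<lambda>i. of_int (b i)) =
         (\<Sum>T\<in>{T \<in> st_trees n l r s t b. T (1, 1) = a}.
            u ^ inv_uJ n (st_shape n l r s t) J T * v ^ inv_vI n (st_shape n l r s t) I T))"
proof -
  interpret weights u v .
  let ?S = "st_shape n l r s t" and ?T = "st_trees n l r s t b"
  have M: "lcorr u v I J (ltrunc u v n l r s t (on_lattice (M_poly u v n))) b
      = (\<Sum>T\<in>?T. u ^ inv_uJ n ?S J T * v ^ inv_vI n ?S I T)"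
    if "I \<subseteq> {1} \<union> {i\<in>{2..l}. s (i - 1) > s i}" "J \<subseteq> {j\<in>{n-r+1..<n}. t j < t (j + 1)} \<union> {n}" for I J
  proof (cases "n = 0")
    case True
    then show ?thesis using order_0 assms(1) by blast
  next
    case False
    then show ?thesis
      using tree_enumeration[OF antiderivatives_gbinomial _ assms that, of "\<lambda>z. 1" 0]
      by (simp add: on_lattice_M_poly)
  qed
  have top: "lcorr u v I J (ltrunc u v n l r s t (on_lattice (M_top u v n a \<alpha> \<beta>))) b
      = (\<Sum>T\<in>{T \<in> ?T. T (1, 1) = a}. u ^ inv_uJ n ?S J T * v ^ inv_vI n ?S I T)"
    if n: "1 \<le> n" and ab: "\<alpha> \<le> a" "\<alpha> \<le> b 1" "b n \<le> \<beta>"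
      and IJ: "I \<subseteq> {1} \<union> {i\<in>{2..l}. s (i - 1) > s i}" "J \<subseteq> {j\<in>{n-r+1..<n}. t j < t (j + 1)} \<union> {n}"
      and cut: "top_in_cut n ?S I J \<longrightarrow> u = 1 \<and> v = 1" for a \<alpha> \<beta> I J
  proof -
    have "top_psi a \<alpha> \<beta> 0 z = (if z = a then 1 else 0)" if "b 1 \<le> z" "z \<le> b n" for z
      by (rule top_psi_0) (use ab that in auto)
    then have "finite ?T \<and> lcorr u v I J (ltrunc u v n l r s t (tree_poly \<alpha> (top_psi a \<alpha> \<beta>) n)) b
        = (\<Sum>T\<in>?T. u ^ inv_uJ n ?S J T * v ^ inv_vI n ?S I T * (if T (1, 1) = a then 1 else 0))"
      by (intro tree_enumeration[OF antiderivatives_top_psi n assms IJ]) (use cut in auto)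
    then show ?thesis
      unfolding on_lattice_M_top[OF n]
      by (simp add: sum.inter_filter if_distrib[of "(*) _"] cong: if_cong)
  qed
  have "\<not> top_in_cut n ?S {} {}" by (simp add: top_in_cut_def)
  then show ?thesis
    unfolding on_ltrunc_at on_lcorr_at
    using M[of "{}" "{}"] M top[of _ _ _ "{}" "{}"] top by simp
qed

end
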